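(* Let $0<\alpha,\beta<\infty$ and consider the bilinear form $\mathcal A(\boldsymbol u,\boldsymbol v)=\alpha(\boldsymbol u,\boldsymbol v)_{L^2(\Omega)}+\beta(\mathcal X\boldsymbol u,\mathcal X\boldsymbol v)_{L^2(\Omega)}$ and the related discrete problem (with natural boundary conditions), either (i) for $d=2$, $\mathcal X=\mathrm{curl}$, on the lowest-order Nedelec (first kind) subspace of $H(\mathrm{curl})$ on squares, or (ii) for $d=3$, $\mathcal X=\mathrm{div}$, on the lowest-order Raviart-Thomas-Nedelec subspace of $H(\mathrm{div})$ on cubes. Assume that the underlying mesh is uniform. Put $\Theta=3/8$ in case (i) and $\Theta=1/2$ in case (ii). Let $\gamma$ be the constant in the strengthened Cauchy-Bunyakowski-Schwarz (CBS) inequality of the hierarchical splitting (differences versus aggregates, after exact elimination of the macro-element interior unknowns), let $\gamma_G$ be the corresponding macro-element constant, and let $\gamma^{(k)}$ be the CBS constant $\gamma$ of the splitting at level $k$ of the recursion, where level $L$ is the finest level; all are defined in the context. Then: (a) $\gamma\le\gamma_G<\sqrt{\Theta}$, and this upper bound holds for each step of the recursive hierarchical splitting; (b) $\gamma^{(L-\ell)}$ is strictly monotonically decreasing in $\ell$ and bounded above by $\sqrt\Theta$ for all $\ell=0,1,\dots,L$, i.e. $$\gamma^{(0)}<\gamma^{(1)}<\dots<\gamma^{(\ell)}<\dots<\gamma^{(L-1)}<\gamma^{(L)}<\sqrt{\Theta}.$$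
   Context: **CBS constant.** For a symmetric positive definite matrix $M=\begin{bmatrix}M_{11}&M_{12}\\ M_{21}&M_{22}\end{bmatrix}$ the constant in the strengthened CBS inequality of the splitting is $$\gamma(M)=\sup_{u_1\ne0,\,u_2\ne0}\frac{u_1^TM_{12}u_2}{\sqrt{u_1^TM_{11}u_1}\,\sqrt{u_2^TM_{22}u_2}} .$$ **Finest-level element matrices.** Let $h>0$ be the mesh size of the finest (level $L$) mesh, which is obtained from a uniform coarsest (level $0$) mesh by $L$ regular refinement steps, and let $e=(\alpha/\beta)h^2>0$. Case (i): the four degrees of freedom (DOF) of a square element $K$ belong to its edges, ordered bottom, top, left, right (tangential line integrals, horizontal edges oriented in $+x$, vertical edges in $+y$ direction). The element matrix of $\mathcal A$ is $$A_K^{(L)}=\frac{\beta}{6h^2}\begin{bmatrix}2e+6&e-6&-6&6\\ e-6&2e+6&6&-6\\ -6&6&2e+6&e-6\\ 6&-6&e-6&2e+6\end{bmatrix}.$$ Case (ii): the six DOF of a cubic element $K$ belong to its faces, ordered lower $x$-face, upper $x$-face, lower $y$-face, upper $y$-face, lower $z$-face, upper $z$-face (fluxes in the positive coordinate directions). The element matrix of $\mathcal A$ is $$A_K^{(L)}=\frac{\beta}{6h^3}\begin{bmatrix}2e+6&e-6&6&-6&6&-6\\ e-6&2e+6&-6&6&-6&6\\ 6&-6&2e+6&e-6&6&-6\\ -6&6&e-6&2e+6&-6&6\\ 6&-6&6&-6&2e+6&e-6\\ -6&6&-6&6&e-6&2e+6\end{bmatrix}.$$ **Macro-elements and one splitting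 step.** A macro-element $G$ is a coarse square (cube) divided regularly into $2^d$ congruent squares (cubes). It has $12$ edge DOF in case (i): $4$ interior edges and $2$ on each of the $4$ coarse edges of $G$. It has $36$ face DOF in case (ii): $12$ interior faces and $4$ on each of the $6$ coarse faces of $G$. Given a level-$k$ element matrix $A_K^{(k)}$ (the same for all elements $K$), assemble the macro-element matrix $A_G^{(k)}=\sum_{K\subset G}R_K^TA_K^{(k)}R_K$, where $R_K$ restricts the macro-element DOF vector to the DOF of $K$. Change to the two-level hierarchical basis $\hat\varphi_G=J_G\varphi_G$, that is, $\hat A_G^{(k)}=J_GA_G^{(k)}J_G^T$, where: - interior basis functions are kept unchanged; - case (i): for each coarse edge with its two basis functions $\phi_i,\phi_j$, use the difference $\frac12(\phi_i-\phi_j)$ and the aggregate $\frac12(\phi_i+\phi_j)$; - case (ii): for each coarse face with its four basis functions $\phi_1,\dots,\phi_4$, use the three differences $\frac14(\phi_1-\phi_2+\phi_3-\phi_4)$, $\frac14(\phi_1+\phi_2-\phi_3-\phi_4)$, $\frac14(\phi_1-\phi_2-\phi_3+\phi_4)$ and the aggregate $\frac14(\phi_1+\phi_2+\phi_3+\phi_4)$. Let $B_G^{(k)}$ be the Schur complement of $\hat A_G^{(k)}$ obtained by eliminating the interior DOF, partitioned as $B_G^{(k)}=\begin{bmatrix}B_{G,11}^{(k)}&B_{G,12}^{(k)}\\ B_{G,21}^{(k)}&B_{G,22}^{(k)}\end{bmatrix}$ with differences first and aggregates last (the aggregates being ordered by coarse edges/faces of $G$ in the same order as the element DOF above). The macro-element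 constant at level $k$ is $\gamma_G=\gamma_G^{(k)}=\gamma(B_G^{(k)})$; it is the same for all macro-elements $G$ because the mesh is uniform. **Recursion.** The element matrix on the next coarser level is $A_K^{(k-1)}:=B_{G,22}^{(k)}$. Starting from $A_K^{(L)}$ this defines $A_K^{(k)}$, $B_G^{(k)}$ and $\gamma_G^{(k)}$ for $k=L,L-1,\dots,0$. **CBS constant of the splitting at level $k$.** The level-$k$ mesh is partitioned into macro-elements $G$ (for $k=0$ the level-$0$ mesh is likewise taken to be a union of macro-elements, so that a further splitting step is defined). The global level-$k$ matrix is $A^{(k)}=\sum_KR_K^TA_K^{(k)}R_K$, with no essential boundary conditions imposed. The hierarchical transformation is applied globally in a way compatible with the local ones, and the macro-element interior DOF are eliminated. The resulting Schur complement is $B^{(k)}=\sum_GR_G^TB_G^{(k)}R_G$, where $R_G$ restricts to the difference and aggregate DOF of $G$. With $B^{(k)}$ partitioned into differences and aggregates, the CBS constant $\gamma$ of the splitting at level $k$ is $\gamma^{(k)}=\gamma(B^{(k)})$. *)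

theory Defs
  imports "HOL-Analysis.Analysis"
begin

section \<open>Matrices over finite index sets\<close>

text \<open>A matrix is a function of its row and column index; the finite index sets are passed
  explicitly to the operations below.\<close>

type_synonym ('i, 'j) matrix = "'i \<Rightarrow> 'j \<Rightarrow> real"

definition inverse_on :: "'i set \<Rightarrow> ('i, 'i) matrix \<Rightarrow> ('i, 'i) matrix" where
  "inverse_on I M = (SOME N. \<forall>i\<in>I. \<forall>j\<in>I.
      (\<Sum>k\<in>I. M i k * N k j) = of_bool (i = j) \<and> (\<Sum>k\<in>I. N i k * M k j) = of_bool (i = j))"

definition schur_complement :: "'i set \<Rightarrow> ('i, 'i) matrix \<Rightarrow> ('i, 'i) matrix" where
  "schur_complement I M = (\<lambda>p q. M p q - (\<Sum>i\<in>I. \<Sum>j\<in>I. M p i * inverse_on I M i j * M j q))"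

definition bilin :: "'i set \<Rightarrow> 'j set \<Rightarrow> ('i, 'j) matrix \<Rightarrow> ('i \<Rightarrow> real) \<Rightarrow> ('j \<Rightarrow> real) \<Rightarrow> real" where
  "bilin I J M u v = (\<Sum>i\<in>I. \<Sum>j\<in>J. u i * M i j * v j)"

definition cbs_constant :: "'i set \<Rightarrow> 'i set \<Rightarrow> ('i, 'i) matrix \<Rightarrow> real" where
  "cbs_constant I1 I2 M =
     Sup {bilin I1 I2 M u1 u2 / (sqrt (bilin I1 I1 M u1 u1) * sqrt (bilin I2 I2 M u2 u2)) | u1 u2.
            (\<exists>i\<in>I1. u1 i \<noteq> 0) \<and> (\<exists>i\<in>I2. u2 i \<noteq> 0)}"


section \<open>Hierarchical splitting on uniform meshes\<close>

text \<open>On a mesh of level \<open>k\<close> and mesh size \<open>h\<^sub>k\<close>, a cell is given by the integer coordinates of its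
  lower corner in units of \<open>h\<^sub>k\<close>; halving the mesh size doubles the coordinates.  The cells carry
  \<open>ndof\<close> degrees of freedom, one per facet (edge of a square, face of a cube):
  \<open>dof c a\<close> is the facet of the cell \<open>c\<close> with local number \<open>a < ndof\<close>,
  \<open>children c\<close> are the \<open>2\<^sup>d\<close> cells into which \<open>c\<close> is divided,
  \<open>parts F\<close> are the \<open>2\<^sup>d\<^sup>-\<^sup>1\<close> facets into which the facet \<open>F\<close> is divided, and
  each list in \<open>diff_signs\<close> contains the signs of one difference of the basis functions of
  these parts.\<close>

record ('c, 'f) geometry =
  ndof :: nat
  dof :: "'c \<Rightarrow> nat \<Rightarrow> 'f"
  children :: "'c \<Rightarrow> 'c set"
  parts :: "'f \<Rightarrow> 'f list"
  diff_signs :: "real list list"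

definition refine :: "('c, 'f) geometry \<Rightarrow> 'c set \<Rightarrow> 'c set" where
  "refine g C = (\<Union>c\<in>C. children g c)"

definition facets :: "('c, 'f) geometry \<Rightarrow> 'c set \<Rightarrow> 'f set" where
  "facets g C = (\<Union>c\<in>C. dof g c ` {..<ndof g})"

definition restriction :: "('c, 'f) geometry \<Rightarrow> 'c \<Rightarrow> (nat, 'f) matrix" where
  "restriction g K = (\<lambda>a f. of_bool (dof g K a = f))"

definition assemble :: "('c, 'f) geometry \<Rightarrow> (nat, nat) matrix \<Rightarrow> 'c set \<Rightarrow> ('f, 'f) matrix" where
  "assemble g A C = (\<lambda>f f'. \<Sum>K\<in>C. \<Sum>a<ndof g. \<Sum>b<ndof g.
      restriction g K a f * A a b * restriction g K b f')"

text \<open>In the hierarchical basis, \<open>Inner f\<close> belongs to a fine facet \<open>f\<close> in the interior of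
  a macro-element, while \<open>Diff m F\<close> (the \<open>m\<close>-th difference) and \<open>Aggr F\<close> (the aggregate) belong to
  a facet \<open>F\<close> of a macro-element.\<close>

datatype 'f hdof = Inner 'f | Diff nat 'f | Aggr 'f

fun hier_transform :: "('c, 'f) geometry \<Rightarrow> ('f hdof, 'f) matrix" where
  "hier_transform g (Inner f) f' = of_bool (f = f')"
| "hier_transform g (Diff m F) f' =
     (\<Sum>i<length (parts g F).
        diff_signs g ! m ! i / real (length (parts g F)) * of_bool (parts g F ! i = f'))"
| "hier_transform g (Aggr F) f' =
     (\<Sum>i<length (parts g F). 1 / real (length (parts g F)) * of_bool (parts g F ! i = f'))"

text \<open>Below, \<open>C\<close> is a finite set of macro-elements, each given as a cell of the next coarser
  mesh, so that \<open>refine g C\<close> is the mesh they consist of.  For \<open>C = {G}\<close> one obtains the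
  macro-element matrices, and for the set of all macro-elements the global ones.\<close>

definition inner_dofs :: "('c, 'f) geometry \<Rightarrow> 'c set \<Rightarrow> 'f hdof set" where
  "inner_dofs g C = Inner ` (facets g (refine g C) - (\<Union>F\<in>facets g C. set (parts g F)))"

definition differences :: "('c, 'f) geometry \<Rightarrow> 'c set \<Rightarrow> 'f hdof set" where
  "differences g C = {Diff m F | m F. m < length (diff_signs g) \<and> F \<in> facets g C}"

definition aggregates :: "('c, 'f) geometry \<Rightarrow> 'c set \<Rightarrow> 'f hdof set" where
  "aggregates g C = Aggr ` facets g C"

definition hier_matrix ::
    "('c, 'f) geometry \<Rightarrow> (nat, nat) matrix \<Rightarrow> 'c set \<Rightarrow> ('f hdof, 'f hdof) matrix" where
  "hier_matrix g A C = (\<lambda>p q. \<Sum>f\<in>facets g (refine g C). \<Sum>f'\<in>facets g (refine g C).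
      hier_transform g p f * assemble g A (refine g C) f f' * hier_transform g q f')"

definition reduced_matrix ::
    "('c, 'f) geometry \<Rightarrow> (nat, nat) matrix \<Rightarrow> 'c set \<Rightarrow> ('f hdof, 'f hdof) matrix" where
  "reduced_matrix g A C = schur_complement (inner_dofs g C) (hier_matrix g A C)"

definition splitting_constant :: "('c, 'f) geometry \<Rightarrow> (nat, nat) matrix \<Rightarrow> 'c set \<Rightarrow> real" where
  "splitting_constant g A C = cbs_constant (differences g C) (aggregates g C) (reduced_matrix g A C)"

text \<open>The recursion uses the macro-element at the origin; by translation invariance the
  choice does not matter.\<close>

definition coarse_element_matrix ::
    "('c::zero, 'f) geometry \<Rightarrow> (nat, nat) matrix \<Rightarrow> (nat, nat) matrix" where
  "coarse_element_matrix g A =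
     (\<lambda>a b. reduced_matrix g A {0} (Aggr (dof g 0 a)) (Aggr (dof g 0 b)))"

definition level_element_matrix ::
    "('c::zero, 'f) geometry \<Rightarrow> (nat, nat) matrix \<Rightarrow> nat \<Rightarrow> nat \<Rightarrow> (nat, nat) matrix" where
  "level_element_matrix g A L k = (coarse_element_matrix g ^^ (L - k)) A"

text \<open>\<open>C\<close> is the set of macro-elements of the level \<open>0\<close> mesh, so the level \<open>0\<close> mesh itself is
  \<open>refine g C\<close>, and the level \<open>k\<close> mesh is \<open>refine g (level_macros g C k)\<close>.\<close>

definition level_macros :: "('c, 'f) geometry \<Rightarrow> 'c set \<Rightarrow> nat \<Rightarrow> 'c set" where
  "level_macros g C k = (refine g ^^ k) C"

definition gamma_macro ::
    "('c::zero, 'f) geometry \<Rightarrow> (nat, nat) matrix \<Rightarrow> nat \<Rightarrow> nat \<Rightarrow> 'c \<Rightarrow> real" where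
  "gamma_macro g A L k G = splitting_constant g (level_element_matrix g A L k) {G}"

definition gamma_level ::
    "('c::zero, 'f) geometry \<Rightarrow> (nat, nat) matrix \<Rightarrow> nat \<Rightarrow> 'c set \<Rightarrow> nat \<Rightarrow> real" where
  "gamma_level g A L C k = splitting_constant g (level_element_matrix g A L k) (level_macros g C k)"


section \<open>The lowest-order Nedelec element on squares\<close>

text \<open>\<open>HEdge x y\<close> joins \<open>(x, y)\<close> and \<open>(x + 1, y)\<close>, and \<open>VEdge x y\<close> joins \<open>(x, y)\<close> and
  \<open>(x, y + 1)\<close>, in units of the mesh size.\<close>

datatype edge = HEdge int int | VEdge int int

fun square_dof :: "int \<times> int \<Rightarrow> nat \<Rightarrow> edge" where
  "square_dof (x, y) a = [HEdge x y, HEdge x (y + 1), VEdge x y, VEdge (x + 1) y] ! a"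

fun square_children :: "int \<times> int \<Rightarrow> (int \<times> int) set" where
  "square_children (x, y) = {2 * x, 2 * x + 1} \<times> {2 * y, 2 * y + 1}"

fun edge_parts :: "edge \<Rightarrow> edge list" where
  "edge_parts (HEdge x y) = [HEdge (2 * x) (2 * y), HEdge (2 * x + 1) (2 * y)]"
| "edge_parts (VEdge x y) = [VEdge (2 * x) (2 * y), VEdge (2 * x) (2 * y + 1)]"

definition square_geometry :: "(int \<times> int, edge) geometry" where
  "square_geometry =
     \<lparr>ndof = 4, dof = square_dof, children = square_children, parts = edge_parts,
      diff_signs = [[1, -1]]\<rparr>"

definition curl2 :: "(real \<times> real \<Rightarrow> real \<times> real) \<Rightarrow> real \<times> real \<Rightarrow> real" where
  "curl2 u = (\<lambda>(x, y). deriv (\<lambda>s. snd (u (s, y))) x - deriv (\<lambda>t. fst (u (x, t))) y)"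

definition curl_form ::
    "real \<Rightarrow> real \<Rightarrow> (real \<times> real) set \<Rightarrow>
     (real \<times> real \<Rightarrow> real \<times> real) \<Rightarrow> (real \<times> real \<Rightarrow> real \<times> real) \<Rightarrow> real" where
  "curl_form \<alpha> \<beta> \<Omega> u v =
     \<alpha> * integral \<Omega> (\<lambda>p. u p \<bullet> v p) + \<beta> * integral \<Omega> (\<lambda>p. curl2 u p * curl2 v p)"

text \<open>The local basis on \<open>[0,h]\<^sup>2\<close> dual to the tangential line integrals over the bottom, top,
  left and right edge (not to the mean tangential values, whence the second division by \<open>h\<close>).\<close>

definition nedelec_basis :: "real \<Rightarrow> nat \<Rightarrow> real \<times> real \<Rightarrow> real \<times> real" where
  "nedelec_basis h a =
     [\<lambda>(x, y). ((1 - y / h) / h, 0), \<lambda>(x, y). (y / h / h, 0),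
      \<lambda>(x, y). (0, (1 - x / h) / h), \<lambda>(x, y). (0, x / h / h)] ! a"

definition nedelec_element_matrix :: "real \<Rightarrow> real \<Rightarrow> real \<Rightarrow> (nat, nat) matrix" where
  "nedelec_element_matrix \<alpha> \<beta> h a b =
     curl_form \<alpha> \<beta> (cbox (0, 0) (h, h)) (nedelec_basis h a) (nedelec_basis h b)"


section \<open>The lowest-order Raviart-Thomas-Nedelec element on cubes\<close>

text \<open>\<open>XFace x y z\<close> is the face normal to the \<open>x\<close>-axis with lower corner \<open>(x, y, z)\<close>, in units of
  the mesh size, and so on.\<close>

datatype face = XFace int int int | YFace int int int | ZFace int int int

fun cube_dof :: "int \<times> int \<times> int \<Rightarrow> nat \<Rightarrow> face" where
  "cube_dof (x, y, z) a =
     [XFace x y z, XFace (x + 1) y z, YFace x y z, YFace x (y + 1) z,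
      ZFace x y z, ZFace x y (z + 1)] ! a"

fun cube_children :: "int \<times> int \<times> int \<Rightarrow> (int \<times> int \<times> int) set" where
  "cube_children (x, y, z) = {2 * x, 2 * x + 1} \<times> {2 * y, 2 * y + 1} \<times> {2 * z, 2 * z + 1}"

fun face_parts :: "face \<Rightarrow> face list" where
  "face_parts (XFace x y z) =
     [XFace (2 * x) (2 * y) (2 * z), XFace (2 * x) (2 * y + 1) (2 * z),
      XFace (2 * x) (2 * y) (2 * z + 1), XFace (2 * x) (2 * y + 1) (2 * z + 1)]"
| "face_parts (YFace x y z) =
     [YFace (2 * x) (2 * y) (2 * z), YFace (2 * x + 1) (2 * y) (2 * z),
      YFace (2 * x) (2 * y) (2 * z + 1), YFace (2 * x + 1) (2 * y) (2 * z + 1)]"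
| "face_parts (ZFace x y z) =
     [ZFace (2 * x) (2 * y) (2 * z), ZFace (2 * x + 1) (2 * y) (2 * z),
      ZFace (2 * x) (2 * y + 1) (2 * z), ZFace (2 * x + 1) (2 * y + 1) (2 * z)]"

text \<open>Up to their order and signs, the three differences do not depend on the order of the
  four parts of a face.\<close>

definition cube_geometry :: "(int \<times> int \<times> int, face) geometry" where
  "cube_geometry =
     \<lparr>ndof = 6, dof = cube_dof, children = cube_children, parts = face_parts,
      diff_signs = [[1, -1, 1, -1], [1, 1, -1, -1], [1, -1, -1, 1]]\<rparr>"

definition div3 ::
    "(real \<times> real \<times> real \<Rightarrow> real \<times> real \<times> real) \<Rightarrow> real \<times> real \<times> real \<Rightarrow> real" where
  "div3 u = (\<lambda>(x, y, z). deriv (\<lambda>s. fst (u (s, y, z))) x + deriv (\<lambda>s. fst (snd (u (x, s, z)))) y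
     + deriv (\<lambda>s. snd (snd (u (x, y, s)))) z)"

definition div_form ::
    "real \<Rightarrow> real \<Rightarrow> (real \<times> real \<times> real) set \<Rightarrow>
     (real \<times> real \<times> real \<Rightarrow> real \<times> real \<times> real) \<Rightarrow>
     (real \<times> real \<times> real \<Rightarrow> real \<times> real \<times> real) \<Rightarrow> real" where
  "div_form \<alpha> \<beta> \<Omega> u v =
     \<alpha> * integral \<Omega> (\<lambda>p. u p \<bullet> v p) + \<beta> * integral \<Omega> (\<lambda>p. div3 u p * div3 v p)"

text \<open>The local basis on \<open>[0,h]\<^sup>3\<close> dual to the fluxes in the positive coordinate directions
  through the lower and upper \<open>x\<close>-, \<open>y\<close>- and \<open>z\<close>-faces.\<close>

definition rt_basis :: "real \<Rightarrow> nat \<Rightarrow> real \<times> real \<times> real \<Rightarrow> real \<times> real \<times> real" where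
  "rt_basis h a =
     [\<lambda>(x, y, z). ((1 - x / h) / h^2, 0, 0), \<lambda>(x, y, z). (x / h / h^2, 0, 0),
      \<lambda>(x, y, z). (0, (1 - y / h) / h^2, 0), \<lambda>(x, y, z). (0, y / h / h^2, 0),
      \<lambda>(x, y, z). (0, 0, (1 - z / h) / h^2), \<lambda>(x, y, z). (0, 0, z / h / h^2)] ! a"

definition rt_element_matrix :: "real \<Rightarrow> real \<Rightarrow> real \<Rightarrow> (nat, nat) matrix" where
  "rt_element_matrix \<alpha> \<beta> h a b =
     div_form \<alpha> \<beta> (cbox (0, 0, 0) (h, h, h)) (rt_basis h a) (rt_basis h b)"


section \<open>Explicit element matrices\<close>

lemma rt_alg:
  fixes h P P' Q Q' :: real
  assumes "0 < h"
  shows "h * h * (P / h^2 * (P' / h^2) * h + (P / h^2 * (Q' / h^3) + Q / h^3 * (P' / h^2)) * h^2 / 2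
      + Q / h^3 * (Q' / h^3) * h^3 / 3) = (P * P' + (P * Q' + Q * P') / 2 + Q * Q' / 3) / h"
proof -
  have "P / h^2 * (P' / h^2) * h = P * P' / h^3" "P / h^2 * (Q' / h^3) * h^2 = P * Q' / h^3"
    "Q / h^3 * (P' / h^2) * h^2 = Q * P' / h^3" "Q / h^3 * (Q' / h^3) * h^3 = Q * Q' / h^3"
    using assms by (simp_all add: eval_nat_numeral)
  then have "P / h^2 * (P' / h^2) * h + (P / h^2 * (Q' / h^3) + Q / h^3 * (P' / h^2)) * h^2 / 2
      + Q / h^3 * (Q' / h^3) * h^3 / 3 = (P * P' + (P * Q' + Q * P') / 2 + Q * Q' / 3) / h^3"
    by (simp add: distrib_right add_divide_distrib)
  then show ?thesis using assms by (simp add: power3_eq_cube)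
qed

lemma ned_alg:
  fixes h P P' Q Q' :: real
  assumes "0 < h"
  shows "h * (P / h * (P' / h) * h + (P / h * (Q' / h^2) + Q / h^2 * (P' / h)) * h^2 / 2
      + Q / h^2 * (Q' / h^2) * h^3 / 3) = P * P' + (P * Q' + Q * P') / 2 + Q * Q' / 3"
proof -
  have "P / h * (P' / h) * h = P * P' / h" "P / h * (Q' / h^2) * h^2 = P * Q' / h"
    "Q / h^2 * (P' / h) * h^2 = Q * P' / h" "Q / h^2 * (Q' / h^2) * h^3 = Q * Q' / h"
    using assms by (simp_all add: eval_nat_numeral)
  then have "P / h * (P' / h) * h + (P / h * (Q' / h^2) + Q / h^2 * (P' / h)) * h^2 / 2
      + Q / h^2 * (Q' / h^2) * h^3 / 3 = (P * P' + (P * Q' + Q * P') / 2 + Q * Q' / 3) / h"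
    by (simp add: distrib_right add_divide_distrib)
  then show ?thesis using assms by simp
qed

lemma integral_lin_prod:
  fixes h :: real assumes "0 < h"
  shows "integral {0..h} (\<lambda>x. c) = c * h"
    "integral {0..h} (\<lambda>x. (p + q * x) * (r + s * x)) = p * r * h + (p * s + q * r) * h^2 / 2 + q * s * h^3 / 3"
proof -
  show "integral {0..h} (\<lambda>x. c) = c * h" using assms by simp
  have "((\<lambda>x. (p + q * x) * (r + s * x)) has_integral
     ((p * r * h + (p * s + q * r) * h^2 / 2 + q * s * h^3 / 3) - (p * r * 0 + (p * s + q * r) * 0^2 / 2 + q * s * 0^3 / 3))) {0..h}"
    by (rule fundamental_theorem_of_calculus)
      (use assms in \<open>auto intro!: derivative_eq_intros simp flip: has_real_derivative_iff_has_vector_derivative simp: power2_eq_square algebra_simps\<close>)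
  then show "integral {0..h} (\<lambda>x. (p + q * x) * (r + s * x)) = p * r * h + (p * s + q * r) * h^2 / 2 + q * s * h^3 / 3"
    by (simp add: integral_unique)
qed

lemma integral_square:
  assumes "continuous_on UNIV f" "continuous_on UNIV g"
  shows "integral (cbox (0::real, 0::real) (h, h)) (\<lambda>(x, y). f x * g y) = integral {0..h} f * integral {0..h} (g :: real \<Rightarrow> real)"
proof -
  have "continuous_on (cbox (0::real, 0::real) (h, h)) (\<lambda>(x, y). f x * g y)"
    unfolding case_prod_unfold
    by (intro continuous_intros continuous_on_compose2[OF assms(1)] continuous_on_compose2[OF assms(2)]) auto
  from integral_prod_continuous[OF this] show ?thesis by (simp add: cbox_interval)
qed

lemma integral_cube:
  assumes "continuous_on UNIV f" "continuous_on UNIV g" "continuous_on UNIV k"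
  shows "integral (cbox (0::real, 0::real, 0::real) (h, h, h)) (\<lambda>(x, y, z). f x * g y * k z)
    = integral {0..h} f * integral {0..h} g * integral {0..h} (k :: real \<Rightarrow> real)"
proof -
  have *: "continuous_on (cbox (0::real, 0::real, 0::real) (h, h, h)) (\<lambda>(x, y, z). f x * g y * k z)"
    unfolding case_prod_unfold
    by (intro continuous_intros continuous_on_compose2[OF assms(1)] continuous_on_compose2[OF assms(2)]
       continuous_on_compose2[OF assms(3)]) auto
  show ?thesis
    using integral_prod_continuous[OF *] integral_square[OF assms(2,3), of h]
    by (simp add: cbox_interval case_prod_unfold mult.assoc)
qed


lemma curl2_nedelec:
  assumes "0 < h" "a < 4"
  shows "curl2 (nedelec_basis h a) = (\<lambda>_. (if a = 0 \<or> a = 3 then 1 else - 1) / h^2)"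
proof -
  have "a \<in> {0,1,2,3}" using assms(2) by auto
  then show ?thesis using assms(1)
    by (auto simp: curl2_def nedelec_basis_def fun_eq_iff power2_eq_square
      intro!: DERIV_imp_deriv derivative_eq_intros simp: field_simps)
qed

lemma div3_rt:
  assumes "0 < h" "a < 6"
  shows "div3 (rt_basis h a) = (\<lambda>_. (if even a then - 1 else 1) / h^3)"
proof -
  have h6: "h ^ 6 = h * (h * (h * (h * (h * h))))" by (simp add: eval_nat_numeral)
  have "a \<in> {0,1,2,3,4,5}" using assms(2) by auto
  then show ?thesis using assms(1)
    by (auto simp: div3_def rt_basis_def fun_eq_iff power2_eq_square power3_eq_cube
      intro!: DERIV_imp_deriv derivative_eq_intros simp: field_simps h6)
qed

lemma nedelec_basis_affine:
  assumes "0 < h" "a < 4"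
  shows "nedelec_basis h a = (\<lambda>(x, y).
    let p = of_bool (even a) / h; q = (if even a then - 1 else 1) / h^2
    in if a < 2 then (p + q * y, 0) else (0, p + q * x))"
proof -
  have "a \<in> {0,1,2,3}" using assms(2) by auto
  then show ?thesis using assms(1)
    by (auto simp: nedelec_basis_def fun_eq_iff power2_eq_square field_simps)
qed

lemma rt_basis_affine:
  assumes "0 < h" "a < 6"
  shows "rt_basis h a = (\<lambda>(x, y, z).
    let p = of_bool (even a) / h^2; q = (if even a then - 1 else 1) / h^3
    in if a < 2 then (p + q * x, 0, 0) else if a < 4 then (0, p + q * y, 0) else (0, 0, p + q * z))"
proof -
  have "a \<in> {0,1,2,3,4,5}" using assms(2) by auto
  then show ?thesis using assms(1)
    by (auto simp: rt_basis_def fun_eq_iff power2_eq_square power3_eq_cube field_simps)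
qed

lemma nedelec_mass:
  assumes h: "0 < h" and ab: "a < 4" "b < 4"
  shows "integral (cbox (0, 0) (h, h)) (\<lambda>p. nedelec_basis h a p \<bullet> nedelec_basis h b p) =
     (if a div 2 = b div 2 then if a = b then 1 / 3 else 1 / 6 else 0)"
proof -
  define p q where "p = (\<lambda>a::nat. of_bool (even a) / h)" and "q = (\<lambda>a::nat. (if even a then - 1 else 1) / h^2)"
  define g where "g = (\<lambda>a x. p a + q a * x)"
  define f where "f = (\<lambda>x. g a x * g b x)"
  define i where "i = (\<lambda>a::nat. a div 2)"
  have f: "continuous_on UNIV f" unfolding f_def g_def by (intro continuous_intros)
  let ?m = "p a * p b * h + (p a * q b + q a * p b) * h^2 / 2 + q a * q b * h^3 / 3"
  have m: "integral {0..h} f = ?m" unfolding f_def g_def by (rule integral_lin_prod[OF h])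
  have c: "continuous_on UNIV (\<lambda>_::real. 1::real)" by simp
  have c': "integral {0..h} (\<lambda>_. 1::real) = h" using h by simp
  have basis: "nedelec_basis h a = (\<lambda>(x, y).
      if i a = 0 then (g a y, 0) else (0, g a x))"
    if "a < 4" for a
  proof -
    have "a < 2 \<longleftrightarrow> i a = 0" unfolding i_def by presburger
    then show ?thesis by (simp add: nedelec_basis_affine[OF h that] g_def p_def q_def Let_def fun_eq_iff)
  qed
  have 1: "integral (cbox (0, 0) (h, h)) (\<lambda>p. nedelec_basis h a p \<bullet> nedelec_basis h b p) =
     (if i a = i b then h * ?m else 0)"
  proof -
    have "i a < 2" "i b < 2" using ab unfolding i_def by presburger+
    then consider "i a = 0" "i b = 0" | "i a = 1" "i b = 1" | "i a \<noteq> i b"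
      by linarith
    then show ?thesis
    proof cases
      case 1
      have "(\<lambda>p. nedelec_basis h a p \<bullet> nedelec_basis h b p) = (\<lambda>(x, y). 1 * f y)"
        by (simp add: basis[OF ab(1)] basis[OF ab(2)] 1 fun_eq_iff f_def)
      then show ?thesis using 1 integral_square[OF c f, of h] m c' by simp
    next
      case 2
      have "(\<lambda>p. nedelec_basis h a p \<bullet> nedelec_basis h b p) = (\<lambda>(x, y). f x * 1)"
        by (simp add: basis[OF ab(1)] basis[OF ab(2)] 2 fun_eq_iff f_def)
      then show ?thesis using 2 integral_square[OF f c, of h] m c' by simp
    next
      case 3
      have "(\<lambda>p. nedelec_basis h a p \<bullet> nedelec_basis h b p) = (\<lambda>_. 0)"
        using 3 \<open>i a < 2\<close> \<open>i b < 2\<close> by (simp add: basis[OF ab(1)] basis[OF ab(2)] fun_eq_iff)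
      then show ?thesis using 3 by simp
    qed
  qed
  have "h * ?m = (if even a \<longleftrightarrow> even b then 1 / 3 else 1 / 6)"
    unfolding p_def q_def ned_alg[OF h] by simp
  moreover have "a div 2 = b div 2 \<Longrightarrow> (a = b \<longleftrightarrow> (even a \<longleftrightarrow> even b))"
    by (metis div_mult_mod_eq even_iff_mod_2_eq_zero odd_iff_mod_2_eq_one)
  ultimately show ?thesis unfolding 1 i_def by simp
qed

lemma rt_mass:
  assumes h: "0 < h" and ab: "a < 6" "b < 6"
  shows "integral (cbox (0, 0, 0) (h, h, h)) (\<lambda>p. rt_basis h a p \<bullet> rt_basis h b p) =
     (if a div 2 = b div 2 then if a = b then 1 / (3 * h) else 1 / (6 * h) else 0)"
proof -
  define p q where "p = (\<lambda>a::nat. of_bool (even a) / h^2)" and "q = (\<lambda>a::nat. (if even a then - 1 else 1) / h^3)"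
  define g where "g = (\<lambda>a x. p a + q a * x)"
  define f where "f = (\<lambda>x. g a x * g b x)"
  define i where "i = (\<lambda>a::nat. a div 2)"
  have f: "continuous_on UNIV f" unfolding f_def g_def by (intro continuous_intros)
  let ?m = "p a * p b * h + (p a * q b + q a * p b) * h^2 / 2 + q a * q b * h^3 / 3"
  have m: "integral {0..h} f = ?m" unfolding f_def g_def by (rule integral_lin_prod[OF h])
  have c: "continuous_on UNIV (\<lambda>_::real. 1::real)" by simp
  have c': "integral {0..h} (\<lambda>_. 1::real) = h" using h by simp
  have basis: "rt_basis h a = (\<lambda>(x, y, z).
      if i a = 0 then (g a x, 0, 0) else if i a = 1 then (0, g a y, 0) else (0, 0, g a z))"
    if "a < 6" for a
  proof -
    have "a < 2 \<longleftrightarrow> i a = 0" "\<not> a < 2 \<Longrightarrow> a < 4 \<longleftrightarrow> i a = 1" unfolding i_def by presburger+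
    then show ?thesis by (simp add: rt_basis_affine[OF h that] g_def p_def q_def Let_def fun_eq_iff)
  qed
  have 1: "integral (cbox (0, 0, 0) (h, h, h)) (\<lambda>p. rt_basis h a p \<bullet> rt_basis h b p) =
     (if i a = i b then h * h * ?m else 0)"
  proof -
    have "i a < 3" "i b < 3" using ab unfolding i_def by presburger+
    then consider "i a = 0" "i b = 0" | "i a = 1" "i b = 1" | "i a = 2" "i b = 2" | "i a \<noteq> i b"
      by linarith
    then show ?thesis
    proof cases
      case 1
      have "(\<lambda>p. rt_basis h a p \<bullet> rt_basis h b p) = (\<lambda>(x, y, z). f x * 1 * 1)"
        by (simp add: basis[OF ab(1)] basis[OF ab(2)] 1 fun_eq_iff f_def)
      then show ?thesis using 1 integral_cube[OF f c c, of h] m c' by simp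
    next
      case 2
      have "(\<lambda>p. rt_basis h a p \<bullet> rt_basis h b p) = (\<lambda>(x, y, z). 1 * f y * 1)"
        by (simp add: basis[OF ab(1)] basis[OF ab(2)] 2 fun_eq_iff f_def)
      then show ?thesis using 2 integral_cube[OF c f c, of h] m c' by simp
    next
      case 3
      have "(\<lambda>p. rt_basis h a p \<bullet> rt_basis h b p) = (\<lambda>(x, y, z). 1 * 1 * f z)"
        by (simp add: basis[OF ab(1)] basis[OF ab(2)] 3 fun_eq_iff f_def)
      then show ?thesis using 3 integral_cube[OF c c f, of h] m c' by simp
    next
      case 4
      have "(\<lambda>p. rt_basis h a p \<bullet> rt_basis h b p) = (\<lambda>_. 0)"
        using 4 \<open>i a < 3\<close> \<open>i b < 3\<close> by (simp add: basis[OF ab(1)] basis[OF ab(2)] fun_eq_iff)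
      then show ?thesis using 4 by simp
    qed
  qed
  have "h * h * ?m = (if even a \<longleftrightarrow> even b then 1 / (3 * h) else 1 / (6 * h))"
    unfolding p_def q_def rt_alg[OF h] by simp
  moreover have "a div 2 = b div 2 \<Longrightarrow> (a = b \<longleftrightarrow> (even a \<longleftrightarrow> even b))"
    by (metis div_mult_mod_eq even_iff_mod_2_eq_zero odd_iff_mod_2_eq_one)
  ultimately show ?thesis unfolding 1 i_def by simp
qed

lemma nedelec_element_matrix_explicit:
  assumes "0 < \<alpha>" "0 < \<beta>" "0 < h" "a < 4" "b < 4"
  defines "e \<equiv> \<alpha> / \<beta> * h^2"
  shows "nedelec_element_matrix \<alpha> \<beta> h a b = \<beta> / (6 * h^2) *
     [[2 * e + 6, e - 6, - 6, 6],
      [e - 6, 2 * e + 6, 6, - 6],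
      [- 6, 6, 2 * e + 6, e - 6],
      [6, - 6, e - 6, 2 * e + 6]] ! a ! b"
proof -
  define m :: real where "m = (if a div 2 = b div 2 then if a = b then 1 / 3 else 1 / 6 else 0)"
  define s :: "nat \<Rightarrow> real" where "s = (\<lambda>a. if a = 0 \<or> a = 3 then 1 else - 1)"
  have ab: "curl2 (nedelec_basis h a) = (\<lambda>_. s a / h^2)" "curl2 (nedelec_basis h b) = (\<lambda>_. s b / h^2)"
    using assms(3-5) by (auto simp: curl2_nedelec s_def)
  have "nedelec_element_matrix \<alpha> \<beta> h a b = \<alpha> * m + \<beta> * (h * h * (s a / h^2 * (s b / h^2)))"
    using assms(3) unfolding nedelec_element_matrix_def curl_form_def
      nedelec_mass[OF assms(3-5)] ab
    by (simp add: m_def content_Pair)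
  also have "\<dots> = \<beta> / (6 * h^2) * (6 * m * e + 6 * s a * s b)"
    using assms(1-3) by (simp add: e_def field_simps power2_eq_square)
  finally have 1: "nedelec_element_matrix \<alpha> \<beta> h a b = \<beta> / (6 * h^2) * (6 * m * e + 6 * s a * s b)" .
  have "a \<in> {0,1,2,3}" "b \<in> {0,1,2,3}" using assms(4,5) by auto
  then show ?thesis unfolding 1 m_def s_def
    by (elim insertE emptyE; simp)
qed

lemma rt_element_matrix_explicit:
  assumes "0 < \<alpha>" "0 < \<beta>" "0 < h" "a < 6" "b < 6"
  defines "e \<equiv> \<alpha> / \<beta> * h^2"
  shows "rt_element_matrix \<alpha> \<beta> h a b = \<beta> / (6 * h^3) *
     [[2 * e + 6, e - 6, 6, - 6, 6, - 6],
      [e - 6, 2 * e + 6, - 6, 6, - 6, 6],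
      [6, - 6, 2 * e + 6, e - 6, 6, - 6],
      [- 6, 6, e - 6, 2 * e + 6, - 6, 6],
      [6, - 6, 6, - 6, 2 * e + 6, e - 6],
      [- 6, 6, - 6, 6, e - 6, 2 * e + 6]] ! a ! b"
proof -
  define m :: real where "m = (if a div 2 = b div 2 then if a = b then 1 / 3 else 1 / 6 else 0)"
  define s :: "nat \<Rightarrow> real" where "s = (\<lambda>a. if even a then - 1 else 1)"
  have ab: "div3 (rt_basis h a) = (\<lambda>_. s a / h^3)" "div3 (rt_basis h b) = (\<lambda>_. s b / h^3)"
    using assms(3-5) by (auto simp: div3_rt s_def)
  have "rt_element_matrix \<alpha> \<beta> h a b = \<alpha> * (m / h) + \<beta> * (h * h * h * (s a / h^3 * (s b / h^3)))"
    using assms(3) unfolding rt_element_matrix_def div_form_def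
      rt_mass[OF assms(3-5)] ab
    by (simp add: m_def content_Pair)
  also have "\<dots> = \<beta> / (6 * h^3) * (6 * m * e + 6 * s a * s b)"
    using assms(1-3) by (simp add: e_def field_simps power2_eq_square power3_eq_cube)
  finally have 1: "rt_element_matrix \<alpha> \<beta> h a b = \<beta> / (6 * h^3) * (6 * m * e + 6 * s a * s b)" .
  have "a \<in> {0,1,2,3,4,5}" "b \<in> {0,1,2,3,4,5}" using assms(4,5) by auto
  then show ?thesis unfolding 1 m_def s_def
    by (elim insertE emptyE; simp)
qed

end

theory Submission
  imports Defs
begin

text \<open>
  In the variables \<open>\<sigma> = u\<^sub>0 + u\<^sub>1\<close> and \<open>\<delta> = u\<^sub>1 - u\<^sub>0\<close> of the pairs of opposite facets, an element matrix is the form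
  \<open>a \<Sum> \<sigma>\<^sub>i\<^sup>2 + c \<Sum> \<delta>\<^sub>i\<^sup>2 + s \<Sum>\<^bsub>i\<noteq>j\<^esub> \<delta>\<^sub>i \<delta>\<^sub>j\<close> (up to the sign of \<open>\<delta>\<^sub>1\<close> for squares).  Normalised to \<open>s = 1\<close>, one coarsening step
  maps \<open>(a, c)\<close> to \<open>(4ac / (a + c), a + c)\<close> in both cases.  The reflections of a macro-element decouple its
  unknowns; only the sum of two opposite aggregates interacts with differences, namely with a single combination of
  them, so the macro-element constant is explicit:
  \<open>\<gamma>\<^sub>G\<^sup>2 = a / (c ((a + c)\<^sup>2 - 1))\<close> for squares and \<open>\<gamma>\<^sub>G\<^sup>2 = 2a / (c (a + c - 1) (a + c + 2))\<close> for cubes.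

  Summation over the macro-elements gives \<open>\<gamma> \<le> \<gamma>\<^sub>G\<close>.  Moreover the extremal vectors of neighbouring macro-elements
  fit together with alternating signs, so \<open>\<gamma> = \<gamma>\<^sub>G\<close>, and (b) reduces to the monotonicity of \<open>\<gamma>\<^sub>G\<close> under
  \<open>(a, c) \<mapsto> (4ac / (a + c), a + c)\<close>, starting from \<open>c = 1 + a / 3\<close>.
\<close>

section \<open>Block elimination for positive definite matrices\<close>

text \<open>The obstacle is the Schur complement: \<open>inverse_on\<close> is a choice, and on a
  global mesh no explicit inverse is at hand. So the inverse is never computed. A value of the form
  of the reduced matrix is rewritten as an energy of two fine-mesh vectors, one of which solves the
  interior equations while the other is an arbitrary extension of its differences or aggregates.
  Energies are additive over macro-elements, so every claim becomes finite algebra on a single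
  macro-element.

  Aggregates have an explicit solution of the interior equations, since each interior value depends
  only on the two opposite aggregates in its direction; this keeps the coarse element matrix in the
  same three-parameter family. Differences are extended explicitly only for the extremal vector; in
  the upper bound only their vanishing sums over the parts of a facet enter.

  Proving \<gamma> = \<gamma>_G rather than an inequality is what makes (b) accessible: upper bounds
  on the \<gamma> of the single levels would not order them.\<close>

lemma bilin_symmetric_solvable:
  fixes M :: "('i, 'i) matrix"
  assumes "finite I" and "\<And>i j. i \<in> I \<Longrightarrow> j \<in> I \<Longrightarrow> M i j = M j i"
    and "\<And>u. \<exists>i\<in>I. u i \<noteq> 0 \<Longrightarrow> 0 < bilin I I M u u"
  shows "\<exists>x. \<forall>i\<in>I. (\<Sum>j\<in>I. M i j * x j) = b i"
  using assms
proof (induction I arbitrary: M b rule: finite_induct)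
  case empty
  then show ?case by simp
next
  case (insert k I)
  note sym = insert.prems(1) and pos = insert.prems(2)
  have expand: "bilin (insert k I) (insert k I) M u u =
      M k k * (u k)\<^sup>2 + 2 * u k * (\<Sum>j\<in>I. M k j * u j) + bilin I I M u u" for u
  proof -
    have "(\<Sum>i\<in>I. u i * M i k * u k) = u k * (\<Sum>j\<in>I. M k j * u j)"
      unfolding sum_distrib_left using sym by (intro sum.cong) (auto simp: mult_ac)
    moreover have "(\<Sum>j\<in>I. u k * M k j * u j) = u k * (\<Sum>j\<in>I. M k j * u j)"
      unfolding sum_distrib_left by (simp add: mult_ac)
    ultimately show ?thesis using insert.hyps
      by (simp add: bilin_def sum.distrib power2_eq_square)
  qed
  have Mkk: "0 < M k k"
  proof -
    have "0 < bilin (insert k I) (insert k I) M (\<lambda>i. of_bool (i = k)) (\<lambda>i. of_bool (i = k))"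
      by (rule pos) auto
    moreover have "(\<Sum>j\<in>I. M k j * of_bool (j = k)) = 0" "bilin I I M (\<lambda>i. of_bool (i = k)) (\<lambda>i. of_bool (i = k)) = 0"
      unfolding bilin_def using insert.hyps by (intro sum.neutral ballI; auto)+
    ultimately show ?thesis unfolding expand by simp
  qed
  \<comment> \<open>One step of Gaussian elimination with the positive pivot \<open>M k k\<close>;
    the induction hypothesis is applied to the remaining matrix.\<close>
  define M' where "M' = (\<lambda>i j. M i j - M i k * M k j / M k k)"
  have M'_form: "bilin I I M' u u = bilin I I M u u - (\<Sum>j\<in>I. M k j * u j)\<^sup>2 / M k k" for u
  proof -
    have "bilin I I M' u u = bilin I I M u u - (\<Sum>i\<in>I. \<Sum>j\<in>I. (M k i * u i) * (M k j * u j) / M k k)"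
      unfolding bilin_def sum_subtractf[symmetric] M'_def
      by (intro sum.cong refl) (use sym in \<open>simp add: algebra_simps\<close>)
    also have "(\<Sum>i\<in>I. \<Sum>j\<in>I. (M k i * u i) * (M k j * u j) / M k k) = (\<Sum>j\<in>I. M k j * u j)\<^sup>2 / M k k"
      by (simp add: power2_eq_square sum_product sum_divide_distrib)
    finally show ?thesis .
  qed
  have "\<exists>x. \<forall>i\<in>I. (\<Sum>j\<in>I. M' i j * x j) = b i - M i k * b k / M k k"
  proof (rule insert.IH)
    show "M' i j = M' j i" if "i \<in> I" "j \<in> I" for i j
      using that sym by (simp add: M'_def)
    show "0 < bilin I I M' u u" if "\<exists>i\<in>I. u i \<noteq> 0" for u
    proof -
      define r where "r = (\<Sum>j\<in>I. M k j * u j)"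
      \<comment> \<open>The value at \<open>k\<close> that minimises the form of \<open>M\<close>
        over all extensions of \<open>u\<close>; the minimum is the form of \<open>M'\<close> at
        \<open>u\<close>, so positivity is inherited.\<close>
      define v where "v = u(k := - r / M k k)"
      have v: "j \<in> I \<Longrightarrow> v j = u j" for j using insert.hyps by (auto simp: v_def)
      have "0 < bilin (insert k I) (insert k I) M v v"
        using that v by (intro pos) auto
      also have "\<dots> = M k k * (v k)\<^sup>2 + 2 * v k * r + bilin I I M u u"
        unfolding expand r_def using v by (simp add: bilin_def)
      also have "\<dots> = bilin I I M' u u"
        unfolding M'_form r_def[symmetric] using Mkk by (simp add: v_def power2_eq_square field_simps)
      finally show ?thesis .
    qed
  qed
  then obtain x where x: "i \<in> I \<Longrightarrow> (\<Sum>j\<in>I. M' i j * x j) = b i - M i k * b k / M k k" for i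
    by blast
  define r where "r = (\<Sum>j\<in>I. M k j * x j)"
  define y where "y = x(k := (b k - r) / M k k)"
  have y_k: "y k = (b k - r) / M k k" by (simp add: y_def)
  have y: "(\<Sum>j\<in>I. M i j * y j) = (\<Sum>j\<in>I. M i j * x j)" for i
    using insert.hyps by (intro sum.cong) (auto simp: y_def)
  have "(\<Sum>j\<in>I. M i j * x j) = b i - M i k * b k / M k k + M i k * r / M k k" if "i \<in> I" for i
  proof -
    have "(\<Sum>j\<in>I. M i j * x j) = (\<Sum>j\<in>I. M' i j * x j) + M i k * r / M k k"
      unfolding M'_def r_def sum_distrib_left sum_divide_distrib sum.distrib[symmetric]
      by (intro sum.cong refl) (simp add: algebra_simps)
    then show ?thesis using x[OF that] by simp
  qed
  note rows = this
  have "(\<Sum>j\<in>insert k I. M i j * y j) = M i k * ((b k - r) / M k k) + (\<Sum>j\<in>I. M i j * x j)" for i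
    using insert.hyps by (simp add: y y_k)
  then have "\<forall>i\<in>insert k I. (\<Sum>j\<in>insert k I. M i j * y j) = b i"
    using Mkk by (auto simp: rows r_def[symmetric] diff_divide_distrib right_diff_distrib)
  then show ?case by blast
qed

text \<open>As \<open>inverse_on\<close> is a choice, an inverse has to be exhibited first. Solving
  for the unit vectors yields a right inverse; symmetry of \<open>M\<close> makes it symmetric,
  hence also a left inverse.\<close>

lemma inverse_on_correct:
  assumes I: "finite I" and sym: "\<And>i j. i \<in> I \<Longrightarrow> j \<in> I \<Longrightarrow> M i j = M j i"
    and pos: "\<And>u. \<exists>i\<in>I. u i \<noteq> 0 \<Longrightarrow> 0 < bilin I I M u u"
    and ij: "i \<in> I" "j \<in> I"
  shows "(\<Sum>k\<in>I. M i k * inverse_on I M k j) = of_bool (i = j)"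
    and "(\<Sum>k\<in>I. inverse_on I M i k * M k j) = of_bool (i = j)"
proof -
  have "\<exists>N. \<forall>j. \<forall>i\<in>I. (\<Sum>k\<in>I. M i k * N j k) = of_bool (i = j)"
    by (intro choice allI bilin_symmetric_solvable[OF I sym pos])
  then obtain N where N: "i \<in> I \<Longrightarrow> (\<Sum>k\<in>I. M i k * N j k) = of_bool (i = j)" for i j
    by blast
  \<comment> \<open>\<open>N i\<close> is the column of the inverse for the unit vector at
    \<open>i\<close>. Both sides are the form of \<open>M\<close> at the columns \<open>N i\<close>
    and \<open>N j\<close>.\<close>
  have N_sym: "N i j = N j i" if "i \<in> I" "j \<in> I" for i j
  proof -
    have "N i j = (\<Sum>k\<in>I. N i k * (\<Sum>l\<in>I. M k l * N j l))"
      using N I that by (simp add: sum.remove[of I j])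
    also have "\<dots> = (\<Sum>l\<in>I. \<Sum>k\<in>I. N i k * M k l * N j l)"
      unfolding sum_distrib_left by (subst sum.swap) (simp add: mult_ac)
    also have "\<dots> = (\<Sum>l\<in>I. (\<Sum>k\<in>I. M l k * N i k) * N j l)"
      unfolding sum_distrib_right by (intro sum.cong refl) (use sym in \<open>simp add: mult_ac\<close>)
    also have "\<dots> = N j i"
      using N I that by (simp add: sum.remove[of I i])
    finally show ?thesis .
  qed
  have "\<exists>N. \<forall>i\<in>I. \<forall>j\<in>I. (\<Sum>k\<in>I. M i k * N k j) = of_bool (i = j) \<and> (\<Sum>k\<in>I. N i k * M k j) = of_bool (i = j)"
  proof (intro exI[of _ "\<lambda>k j. N j k"] ballI conjI)
    fix i j assume ij: "i \<in> I" "j \<in> I"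
    show "(\<Sum>k\<in>I. M i k * N j k) = of_bool (i = j)" using N ij by simp
    have "(\<Sum>k\<in>I. N k i * M k j) = (\<Sum>k\<in>I. M j k * N i k)"
      by (intro sum.cong refl) (use ij N_sym sym in \<open>simp add: mult_ac\<close>)
    then show "(\<Sum>k\<in>I. N k i * M k j) = of_bool (i = j)" using N ij by auto
  qed
  from someI_ex[OF this] ij
  show "(\<Sum>k\<in>I. M i k * inverse_on I M k j) = of_bool (i = j)"
    and "(\<Sum>k\<in>I. inverse_on I M i k * M k j) = of_bool (i = j)"
    unfolding inverse_on_def by blast+
qed

text \<open>Eliminating the unknowns in \<open>I\<close> amounts to extending \<open>w\<close> so that the equations in \<open>I\<close> hold.\<close>

lemma bilin_schur_complement:
  assumes I: "finite I" and sym: "\<And>i j. i \<in> I \<Longrightarrow> j \<in> I \<Longrightarrow> M i j = M j i"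
    and pos: "\<And>u. \<exists>i\<in>I. u i \<noteq> 0 \<Longrightarrow> 0 < bilin I I M u u"
    and P: "finite P" "I \<inter> P = {}"
    and w: "\<And>i. i \<in> I \<Longrightarrow> (\<Sum>j\<in>I \<union> P. M i j * w j) = 0"
  shows "bilin Q P (schur_complement I M) v w = bilin Q (I \<union> P) M v w"
proof -
  let ?N = "inverse_on I M"
  \<comment> \<open>The equations in \<open>I\<close> say that the \<open>P\<close> part of the
    product of \<open>M\<close> and \<open>w\<close> is minus its \<open>I\<close> part; the left
    inverse then recovers \<open>- w k\<close>.\<close>
  have N: "(\<Sum>j\<in>P. \<Sum>i\<in>I. ?N k i * M i j * w j) = - w k" if k: "k \<in> I" for k
  proof -
    have "(\<Sum>j\<in>P. \<Sum>i\<in>I. ?N k i * M i j * w j) = (\<Sum>i\<in>I. ?N k i * (\<Sum>j\<in>P. M i j * w j))"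
      unfolding sum_distrib_left by (subst sum.swap) (simp add: mult_ac)
    also have "\<dots> = (\<Sum>i\<in>I. ?N k i * (- (\<Sum>j\<in>I. M i j * w j)))"
    proof (intro sum.cong refl)
      fix i assume "i \<in> I"
      from w[OF this] show "?N k i * (\<Sum>j\<in>P. M i j * w j) = ?N k i * (- (\<Sum>j\<in>I. M i j * w j))"
        using I P by (simp add: sum.union_disjoint add_eq_0_iff)
    qed
    also have "\<dots> = - (\<Sum>j\<in>I. (\<Sum>i\<in>I. ?N k i * M i j) * w j)"
      unfolding sum_distrib_left sum_distrib_right sum_negf mult_minus_right
      by (subst sum.swap) (simp add: mult_ac)
    also have "\<dots> = - w k"
      using inverse_on_correct(2)[OF I sym pos] k I by (simp add: sum.remove[of I k])
    finally show ?thesis .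
  qed
  have "(\<Sum>j\<in>P. v p * schur_complement I M p j * w j) = (\<Sum>j\<in>I \<union> P. v p * M p j * w j)" for p
  proof -
    have "(\<Sum>j\<in>P. v p * schur_complement I M p j * w j) =
        (\<Sum>j\<in>P. v p * M p j * w j) - (\<Sum>j\<in>P. \<Sum>k\<in>I. \<Sum>i\<in>I. v p * M p k * (?N k i * M i j * w j))"
      unfolding schur_complement_def sum_subtractf[symmetric]
      by (intro sum.cong refl) (simp add: sum_distrib_left sum_distrib_right algebra_simps)
    also have "(\<Sum>j\<in>P. \<Sum>k\<in>I. \<Sum>i\<in>I. v p * M p k * (?N k i * M i j * w j)) =
        (\<Sum>k\<in>I. v p * M p k * (\<Sum>j\<in>P. \<Sum>i\<in>I. ?N k i * M i j * w j))"
      unfolding sum_distrib_left by (subst sum.swap) simp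
    also have "\<dots> = - (\<Sum>k\<in>I. v p * M p k * w k)"
      by (simp add: N sum_negf)
    finally show ?thesis using I P by (simp add: sum.union_disjoint)
  qed
  then show ?thesis by (simp add: bilin_def)
qed

section \<open>Hierarchical splittings through energies of fine vectors\<close>

text \<open>Used twice: for the hierarchical change of basis and for the restrictions in the
  assembly.\<close>

lemma bilin_congruence:
  "bilin P Q (\<lambda>p q. \<Sum>f\<in>F. \<Sum>f'\<in>F'. T p f * M f f' * T' q f') x y =
     bilin F F' M (\<lambda>f. \<Sum>p\<in>P. x p * T p f) (\<lambda>f'. \<Sum>q\<in>Q. y q * T' q f')"
proof -
  have "bilin P Q (\<lambda>p q. \<Sum>f\<in>F. \<Sum>f'\<in>F'. T p f * M f f' * T' q f') x y =
      (\<Sum>p\<in>P. \<Sum>q\<in>Q. \<Sum>f\<in>F. \<Sum>f'\<in>F'. (x p * T p f) * M f f' * (y q * T' q f'))"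
    unfolding bilin_def sum_distrib_left sum_distrib_right by (simp add: mult_ac)
  also have "\<dots> = (\<Sum>p\<in>P. \<Sum>f\<in>F. \<Sum>q\<in>Q. \<Sum>f'\<in>F'. (x p * T p f) * M f f' * (y q * T' q f'))"
    by (intro sum.cong refl sum.swap)
  also have "\<dots> = (\<Sum>f\<in>F. \<Sum>p\<in>P. \<Sum>f'\<in>F'. \<Sum>q\<in>Q. (x p * T p f) * M f f' * (y q * T' q f'))"
    by (subst sum.swap) (intro sum.cong refl sum.swap)
  also have "\<dots> = (\<Sum>f\<in>F. \<Sum>f'\<in>F'. \<Sum>p\<in>P. \<Sum>q\<in>Q. (x p * T p f) * M f f' * (y q * T' q f'))"
    by (intro sum.cong refl sum.swap)
  also have "\<dots> = bilin F F' M (\<lambda>f. \<Sum>p\<in>P. x p * T p f) (\<lambda>f'. \<Sum>q\<in>Q. y q * T' q f')"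
    unfolding bilin_def
    by (intro sum.cong refl, subst sum.swap) (simp add: sum_distrib_left sum_distrib_right)
  finally show ?thesis .
qed

lemma bilin_cong:
  assumes "\<And>i. i \<in> I \<Longrightarrow> u i = u' i" "\<And>j. j \<in> J \<Longrightarrow> v j = v' j"
  shows "bilin I J M u v = bilin I J M u' v'"
  unfolding bilin_def using assms by (intro sum.cong) auto

definition spd_on :: "'i set \<Rightarrow> ('i, 'i) matrix \<Rightarrow> bool" where
  "spd_on I M \<longleftrightarrow> (\<forall>i\<in>I. \<forall>j\<in>I. M i j = M j i) \<and> (\<forall>u. (\<exists>i\<in>I. u i \<noteq> 0) \<longrightarrow> 0 < bilin I I M u u)"

lemma spd_on_nonneg:
  assumes "spd_on I M" shows "0 \<le> bilin I I M u u"
proof (cases "\<exists>i\<in>I. u i \<noteq> 0")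
  case True
  then show ?thesis using assms by (auto simp: spd_on_def less_imp_le)
next
  case False
  then show ?thesis by (simp add: bilin_def)
qed

text \<open>The assembled fine form written element by element. Vectors are total functions on
  facets, so one and the same vector can be evaluated on the whole mesh and on any single
  macro-element.\<close>

definition energy ::
    "('c, 'f) geometry \<Rightarrow> (nat, nat) matrix \<Rightarrow> 'c set \<Rightarrow> ('f \<Rightarrow> real) \<Rightarrow> ('f \<Rightarrow> real) \<Rightarrow> real" where
  "energy g A C u v =
     (\<Sum>K\<in>refine g C. bilin {..<ndof g} {..<ndof g} A (u \<circ> dof g K) (v \<circ> dof g K))"

text \<open>The transposed hierarchical transformation: it turns hierarchical coefficients into fine
  degrees of freedom.\<close>

definition synthesis :: "('c, 'f) geometry \<Rightarrow> 'f hdof set \<Rightarrow> ('f hdof \<Rightarrow> real) \<Rightarrow> 'f \<Rightarrow> real" where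
  "synthesis g P x f = (\<Sum>p\<in>P. x p * hier_transform g p f)"

definition part_facets :: "('c, 'f) geometry \<Rightarrow> 'c set \<Rightarrow> 'f set" where
  "part_facets g C = (\<Union>F\<in>facets g C. set (parts g F))"

text \<open>The equations of the eliminated interior unknowns in weak form: discrete harmonicity
  inside the macro-elements, tested with vectors that vanish on the skeleton
  \<open>part_facets g C\<close>.\<close>

definition harmonic :: "('c, 'f) geometry \<Rightarrow> (nat, nat) matrix \<Rightarrow> 'c set \<Rightarrow> ('f \<Rightarrow> real) \<Rightarrow> bool" where
  "harmonic g A C u \<longleftrightarrow> (\<forall>v. (\<forall>f\<in>part_facets g C. v f = 0) \<longrightarrow> energy g A C v u = 0)"

lemma energy_cong:
  assumes "\<And>f. f \<in> facets g (refine g C) \<Longrightarrow> u f = u' f"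
    "\<And>f. f \<in> facets g (refine g C) \<Longrightarrow> v f = v' f"
  shows "energy g A C u v = energy g A C u' v'"
  unfolding energy_def
  by (intro sum.cong refl bilin_cong) (use assms in \<open>auto simp: facets_def\<close>)

lemma energy_diff_left:
  "energy g A C (\<lambda>f. u f - v f) w = energy g A C u w - energy g A C v w"
  unfolding energy_def bilin_def sum_subtractf[symmetric] by (intro sum.cong refl) (simp add: algebra_simps)

lemma finite_facets: "finite C \<Longrightarrow> finite (facets g C)"
  by (simp add: facets_def)

text \<open>Two congruences: the hierarchical transformation turns coefficients into
  \<open>synthesis\<close>, and each restriction turns a fine vector into its composition with
  \<open>dof g K\<close>.\<close>

lemma bilin_hier_matrix:
  assumes "finite (refine g C)"
  shows "bilin P Q (hier_matrix g A C) x y = energy g A C (synthesis g P x) (synthesis g Q y)"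
proof -
  let ?F = "facets g (refine g C)"
  have restr: "(\<Sum>f\<in>?F. u f * of_bool (dof g K a = f)) = u (dof g K a)"
    if "K \<in> refine g C" "a < ndof g" for u :: "_ \<Rightarrow> real" and K a
  proof -
    have "dof g K a \<in> ?F" using that by (auto simp: facets_def)
    moreover have "(\<Sum>f\<in>?F. u f * of_bool (dof g K a = f)) = (\<Sum>f\<in>?F. if dof g K a = f then u f else 0)"
      by (intro sum.cong) auto
    ultimately show ?thesis using finite_facets[OF assms, of g] by simp
  qed
  have "bilin P Q (hier_matrix g A C) x y =
      bilin ?F ?F (assemble g A (refine g C)) (synthesis g P x) (synthesis g Q y)"
    unfolding hier_matrix_def synthesis_def by (rule bilin_congruence)
  also have "\<dots> = (\<Sum>K\<in>refine g C. bilin ?F ?F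
      (\<lambda>f f'. \<Sum>a<ndof g. \<Sum>b<ndof g. restriction g K a f * A a b * restriction g K b f')
      (synthesis g P x) (synthesis g Q y))"
  proof -
    have "bilin ?F ?F (\<lambda>f f'. \<Sum>K\<in>S. N K f f') u v = (\<Sum>K\<in>S. bilin ?F ?F (N K) u v)"
      for S :: "'a set" and N u v
    proof -
      have "bilin ?F ?F (\<lambda>f f'. \<Sum>K\<in>S. N K f f') u v = (\<Sum>f\<in>?F. \<Sum>f'\<in>?F. \<Sum>K\<in>S. u f * N K f f' * v f')"
        unfolding bilin_def sum_distrib_left sum_distrib_right ..
      also have "\<dots> = (\<Sum>f\<in>?F. \<Sum>K\<in>S. \<Sum>f'\<in>?F. u f * N K f f' * v f')"
        by (intro sum.cong refl sum.swap)
      also have "\<dots> = (\<Sum>K\<in>S. bilin ?F ?F (N K) u v)"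
        unfolding bilin_def by (rule sum.swap)
      finally show ?thesis .
    qed
    then show ?thesis by (simp add: assemble_def)
  qed
  also have "\<dots> = energy g A C (synthesis g P x) (synthesis g Q y)"
    unfolding energy_def
  proof (intro sum.cong refl)
    fix K assume K: "K \<in> refine g C"
    have "bilin ?F ?F (\<lambda>f f'. \<Sum>a<ndof g. \<Sum>b<ndof g. restriction g K a f * A a b * restriction g K b f')
        (synthesis g P x) (synthesis g Q y) = bilin {..<ndof g} {..<ndof g} A
          (\<lambda>a. \<Sum>f\<in>?F. synthesis g P x f * restriction g K a f)
          (\<lambda>a. \<Sum>f\<in>?F. synthesis g Q y f * restriction g K a f)"
      by (rule bilin_congruence)
    also have "\<dots> = bilin {..<ndof g} {..<ndof g} A (synthesis g P x \<circ> dof g K) (synthesis g Q y \<circ> dof g K)"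
      by (intro bilin_cong) (use K restr in \<open>auto simp: restriction_def\<close>)
    finally show "bilin ?F ?F (\<lambda>f f'. \<Sum>a<ndof g. \<Sum>b<ndof g. restriction g K a f * A a b * restriction g K b f')
        (synthesis g P x) (synthesis g Q y) = \<dots>" .
  qed
  finally show ?thesis .
qed

lemma hier_transform_eq_0:
  assumes "f \<notin> set (parts g F)"
  shows "hier_transform g (Diff m F) f = 0" "hier_transform g (Aggr F) f = 0"
proof -
  have "parts g F ! i \<noteq> f" if "i < length (parts g F)" for i
    using that assms by auto
  then show "hier_transform g (Diff m F) f = 0" "hier_transform g (Aggr F) f = 0" by simp_all
qed

text \<open>The combinatorics common to squares and cubes. \<open>parts_inj\<close> lets a
  synthesised vector be read off facet by facet; \<open>signs_sum\<close> makes every difference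
  orthogonal to the aggregate on its facet.\<close>

locale nested_geometry =
  fixes g :: "('c::zero, 'f) geometry" and n :: nat
  assumes finite_children: "finite (children g c)"
    and children_nonempty: "children g c \<noteq> {}"
    and children_disjoint: "c \<noteq> c' \<Longrightarrow> children g c \<inter> children g c' = {}"
    and dof_inj: "inj_on (dof g c) {..<ndof g}"
    and length_parts: "length (parts g F) = n"
    and n_pos: "0 < n"
    and parts_inj: "\<lbrakk>i < n; j < n; parts g F ! i = parts g F' ! j\<rbrakk> \<Longrightarrow> F = F' \<and> i = j"
    and signs_sum: "m < length (diff_signs g) \<Longrightarrow> (\<Sum>i<n. diff_signs g ! m ! i) = 0"
begin

lemma finite_refine: "finite C \<Longrightarrow> finite (refine g C)"
  by (simp add: refine_def finite_children)

lemma finite_level_macros: "finite C \<Longrightarrow> finite (level_macros g C k)"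
  unfolding level_macros_def by (induction k) (simp_all add: finite_refine)

lemma level_macros_nonempty: "C \<noteq> {} \<Longrightarrow> level_macros g C k \<noteq> {}"
  unfolding level_macros_def by (induction k) (auto simp: refine_def children_nonempty)

lemma energy_sum_macros:
  assumes "finite C"
  shows "energy g A C u v = (\<Sum>G\<in>C. energy g A {G} u v)"
  unfolding energy_def refine_def
  by (subst sum.UNION_disjoint) (use assms finite_children children_disjoint in auto)

lemma mem_part_facets_iff: "f \<in> part_facets g C \<longleftrightarrow> (\<exists>F\<in>facets g C. \<exists>i<n. f = parts g F ! i)"
  unfolding part_facets_def by (force simp: in_set_conv_nth length_parts)

lemma synthesis_outside:
  assumes "P \<subseteq> differences g C \<union> aggregates g C" "f \<notin> part_facets g C"
  shows "synthesis g P x f = 0"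
  unfolding synthesis_def
proof (intro sum.neutral ballI)
  fix p assume "p \<in> P"
  then obtain m F where "F \<in> facets g C" "p = Diff m F \<or> p = Aggr F"
    using assms(1) by (auto simp: differences_def aggregates_def)
  then show "x p * hier_transform g p f = 0"
    using assms(2) hier_transform_eq_0[of f g F] unfolding part_facets_def by auto
qed

lemma synthesis_inner:
  assumes "finite C" "I = inner_dofs g C"
  shows "synthesis g I x f = (if f \<in> facets g (refine g C) - part_facets g C then x (Inner f) else 0)"
proof -
  let ?N = "facets g (refine g C) - part_facets g C"
  have "synthesis g I x f = (\<Sum>f'\<in>?N. x (Inner f') * of_bool (f' = f))"
    unfolding synthesis_def assms(2) inner_dofs_def part_facets_def[symmetric]
    by (subst sum.reindex) (auto simp: inj_on_def)
  also have "\<dots> = (if f \<in> ?N then x (Inner f) else 0)"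
    using finite_facets[OF finite_refine[OF assms(1)], of g] by (simp add: sum.remove[of _ f])
  finally show ?thesis .
qed

lemma hier_transform_part:
  assumes "i < n"
  shows "hier_transform g (Diff m F) (parts g F' ! i) = of_bool (F = F') * (diff_signs g ! m ! i / real n)"
    and "hier_transform g (Aggr F) (parts g F' ! i) = of_bool (F = F') * (1 / real n)"
proof -
  have eq: "parts g F ! j = parts g F' ! i \<longleftrightarrow> F = F' \<and> j = i" if "j < n" for j
    using parts_inj[OF that assms, of F F'] by blast
  have *: "(\<Sum>j<n. c j * of_bool (parts g F ! j = parts g F' ! i)) = of_bool (F = F') * c i"
    for c :: "nat \<Rightarrow> real"
  proof -
    have "(\<Sum>j<n. c j * of_bool (parts g F ! j = parts g F' ! i)) =
        (\<Sum>j<n. if j = i then of_bool (F = F') * c i else 0)"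
      by (intro sum.cong refl) (use eq in auto)
    then show ?thesis using assms by simp
  qed
  show "hier_transform g (Diff m F) (parts g F' ! i) = of_bool (F = F') * (diff_signs g ! m ! i / real n)"
    and "hier_transform g (Aggr F) (parts g F' ! i) = of_bool (F = F') * (1 / real n)"
    using *[of "\<lambda>j. diff_signs g ! m ! j / real n"] *[of "\<lambda>j. 1 / real n"]
    by (simp_all add: length_parts)
qed

lemma synthesis_aggregates:
  assumes "finite C" "F \<in> facets g C" "i < n"
  shows "synthesis g (aggregates g C) x (parts g F ! i) = x (Aggr F) / real n"
proof -
  have "synthesis g (aggregates g C) x (parts g F ! i) =
      (\<Sum>F'\<in>facets g C. if F' = F then x (Aggr F) / real n else 0)"
    unfolding synthesis_def aggregates_def
    by (subst sum.reindex) (auto simp: inj_on_def hier_transform_part[OF assms(3)] simp del: hier_transform.simps intro!: sum.cong)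
  then show ?thesis using assms finite_facets[OF assms(1), of g] by simp
qed

lemma synthesis_differences:
  assumes "finite C" "F \<in> facets g C" "i < n"
  shows "synthesis g (differences g C) x (parts g F ! i) =
    (\<Sum>m<length (diff_signs g). diff_signs g ! m ! i / real n * x (Diff m F))"
proof -
  have "differences g C = (\<lambda>(m, F). Diff m F) ` ({..<length (diff_signs g)} \<times> facets g C)"
    unfolding differences_def by auto
  then have "synthesis g (differences g C) x (parts g F ! i) =
      (\<Sum>(m, F')\<in>{..<length (diff_signs g)} \<times> facets g C.
          if F' = F then diff_signs g ! m ! i / real n * x (Diff m F) else 0)"
    unfolding synthesis_def
    by (simp, subst sum.reindex)
      (auto simp: inj_on_def hier_transform_part[OF assms(3)] mult_ac simp del: hier_transform.simps intro!: sum.cong)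
  also have "\<dots> = (\<Sum>m<length (diff_signs g). diff_signs g ! m ! i / real n * x (Diff m F))"
    unfolding sum.cartesian_product[symmetric] using assms finite_facets[OF assms(1), of g] by simp
  finally show ?thesis .
qed

text \<open>The only property of the differences that the macro-element estimate will use.\<close>

lemma synthesis_differences_sum:
  assumes "finite C" "F \<in> facets g C"
  shows "(\<Sum>i<n. synthesis g (differences g C) x (parts g F ! i)) = 0"
proof -
  have "(\<Sum>i<n. synthesis g (differences g C) x (parts g F ! i)) =
      (\<Sum>m<length (diff_signs g). (\<Sum>i<n. diff_signs g ! m ! i) * x (Diff m F) / real n)"
    using assms by (simp add: synthesis_differences, subst sum.swap)
      (simp add: sum_distrib_right sum_divide_distrib)
  then show ?thesis by (simp add: signs_sum)
qed

lemma finite_dofs: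
  assumes "finite C"
  shows "finite (inner_dofs g C)" "finite (differences g C)" "finite (aggregates g C)"
proof -
  have "differences g C \<subseteq> (\<lambda>(m, F). Diff m F) ` ({..<length (diff_signs g)} \<times> facets g C)"
    unfolding differences_def by auto
  then show "finite (differences g C)"
    by (rule finite_subset) (simp add: finite_facets[OF assms])
  show "finite (inner_dofs g C)" "finite (aggregates g C)"
    by (simp_all add: inner_dofs_def aggregates_def finite_facets finite_refine assms)
qed

lemma inner_disjoint:
  assumes "P \<subseteq> differences g C \<union> aggregates g C"
  shows "inner_dofs g C \<inter> P = {}"
  using assms by (auto simp: inner_dofs_def differences_def aggregates_def)

lemma synthesis_Un:
  assumes "finite C" "P \<subseteq> differences g C \<union> aggregates g C"
  shows "synthesis g (inner_dofs g C \<union> P) x f = synthesis g (inner_dofs g C) x f + synthesis g P x f"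
proof -
  have "finite P" using finite_dofs[OF assms(1)] assms(2) by (meson finite_UnI finite_subset)
  then show ?thesis unfolding synthesis_def
    using finite_dofs[OF assms(1)] inner_disjoint[OF assms(2)] by (simp add: sum.union_disjoint)
qed

context
  fixes A :: "(nat, nat) matrix" and C :: "'c set"
  assumes C: "finite C" and A: "spd_on {..<ndof g} A"
begin

lemma hier_matrix_sym: "hier_matrix g A C p q = hier_matrix g A C q p"
proof -
  have "assemble g A (refine g C) f f' = assemble g A (refine g C) f' f" for f f'
    unfolding assemble_def
    by (rule sum.cong[OF refl], subst sum.swap, intro sum.cong refl)
      (use A in \<open>auto simp: spd_on_def mult_ac\<close>)
  then show ?thesis unfolding hier_matrix_def
    by (subst sum.swap) (simp add: mult_ac)
qed

lemma inner_pos: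
  assumes "\<exists>p\<in>inner_dofs g C. x p \<noteq> 0"
  shows "0 < bilin (inner_dofs g C) (inner_dofs g C) (hier_matrix g A C) x x"
proof -
  let ?u = "synthesis g (inner_dofs g C) x"
  obtain f where f: "f \<in> facets g (refine g C)" "f \<notin> part_facets g C" "x (Inner f) \<noteq> 0"
    using assms unfolding inner_dofs_def part_facets_def by auto
  then obtain K a where K: "K \<in> refine g C" "a < ndof g" "f = dof g K a"
    unfolding facets_def by auto
  have "?u f = x (Inner f)"
    using f synthesis_inner[OF C refl] by simp
  then have "0 < bilin {..<ndof g} {..<ndof g} A (?u \<circ> dof g K) (?u \<circ> dof g K)"
    using A K f(3) unfolding spd_on_def by (metis comp_apply lessThan_iff)
  then show ?thesis
    unfolding bilin_hier_matrix[OF finite_refine[OF C]] energy_def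
    using K(1) finite_refine[OF C] spd_on_nonneg[OF A] by (intro sum_pos2)
qed

text \<open>The bridge from Schur complements to energies. With \<open>u\<close> solving the
  interior equations, \<open>bilin_schur_complement\<close> removes the inverse. In the other
  argument any extension \<open>v\<close> will do, because two extensions differ by a vector
  vanishing on the skeleton, which a harmonic \<open>u\<close> does not see.\<close>

lemma bilin_reduced_matrix:
  assumes P: "P \<subseteq> differences g C \<union> aggregates g C" and Q: "Q \<subseteq> differences g C \<union> aggregates g C"
    and u: "harmonic g A C u" "\<And>f. f \<in> part_facets g C \<Longrightarrow> u f = synthesis g P x f"
    and v: "\<And>f. f \<in> part_facets g C \<Longrightarrow> v f = synthesis g Q y f"
  shows "bilin Q P (reduced_matrix g A C) y x = energy g A C v u"
proof -
  let ?I = "inner_dofs g C" and ?H = "hier_matrix g A C"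
  \<comment> \<open>The interior values of \<open>u\<close> serve as the eliminated unknowns, so
    that \<open>x'\<close> synthesises \<open>u\<close> itself.\<close>
  define x' where "x' p = (case p of Inner f \<Rightarrow> u f | _ \<Rightarrow> x p)" for p
  have finP: "finite P" using finite_dofs[OF C] P by (meson finite_UnI finite_subset)
  have x'_P: "x' p = x p" if "p \<in> P" for p
    using that P by (auto simp: x'_def differences_def aggregates_def)
  have synth: "synthesis g (?I \<union> P) x' f = u f" if "f \<in> facets g (refine g C)" for f
  proof -
    have "synthesis g P x' f = synthesis g P x f"
      unfolding synthesis_def using x'_P by simp
    then show ?thesis
      using that synthesis_outside[OF P, of f x] u(2)[of f]
      by (cases "f \<in> part_facets g C") (simp_all add: synthesis_Un[OF C P] synthesis_inner[OF C refl] x'_def)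
  qed
  have energy_left: "bilin Q' (?I \<union> P) ?H z x' = energy g A C (synthesis g Q' z) u" for Q' z
    unfolding bilin_hier_matrix[OF finite_refine[OF C]]
    using synth by (intro energy_cong) auto
  have "bilin Q P (reduced_matrix g A C) y x = bilin Q P (reduced_matrix g A C) y x'"
    using x'_P by (intro bilin_cong) auto
  also have "\<dots> = bilin Q (?I \<union> P) ?H y x'"
    unfolding reduced_matrix_def
  proof (rule bilin_schur_complement)
    show "finite ?I" "finite P" "?I \<inter> P = {}"
      using finite_dofs[OF C] finP inner_disjoint[OF P] by auto
    show "?H i j = ?H j i" for i j by (rule hier_matrix_sym)
    show "0 < bilin ?I ?I ?H z z" if "\<exists>i\<in>?I. z i \<noteq> 0" for z
      using that by (rule inner_pos)
    show "(\<Sum>j\<in>?I \<union> P. ?H i j * x' j) = 0" if "i \<in> ?I" for i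
    proof -
      have "(\<Sum>j\<in>?I \<union> P. ?H i j * x' j) = bilin {i} (?I \<union> P) ?H (\<lambda>_. 1) x'"
        by (simp add: bilin_def)
      also have "\<dots> = energy g A C (synthesis g {i} (\<lambda>_. 1)) u" by (rule energy_left)
      also have "\<dots> = 0"
      proof -
        have "\<forall>f\<in>part_facets g C. synthesis g {i} (\<lambda>_. 1) f = 0"
          using that by (auto simp: synthesis_def inner_dofs_def part_facets_def)
        with u(1) show ?thesis unfolding harmonic_def by blast
      qed
      finally show ?thesis .
    qed
  qed
  also have "\<dots> = energy g A C (synthesis g Q y) u" by (rule energy_left)
  also have "\<dots> = energy g A C v u"
  proof -
    have "energy g A C (\<lambda>f. synthesis g Q y f - v f) u = 0"
      using u(1) v unfolding harmonic_def by auto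
    then show ?thesis by (simp add: energy_diff_left)
  qed
  finally show ?thesis .
qed

text \<open>The interior block is positive definite, so the interior unknowns can be solved for with
  the skeleton values as data. This covers the differences, for which no explicit extension is given
  in general.\<close>

lemma ex_harmonic:
  assumes P: "P \<subseteq> differences g C \<union> aggregates g C"
  shows "\<exists>u. harmonic g A C u \<and> (\<forall>f\<in>part_facets g C. u f = synthesis g P x f)"
proof -
  let ?I = "inner_dofs g C" and ?H = "hier_matrix g A C"
  have finP: "finite P" using finite_dofs[OF C] P by (meson finite_UnI finite_subset)
  have "\<exists>w. \<forall>i\<in>?I. (\<Sum>j\<in>?I. ?H i j * w j) = - (\<Sum>j\<in>P. ?H i j * x j)"
    by (rule bilin_symmetric_solvable) (use finite_dofs[OF C] hier_matrix_sym inner_pos in auto)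
  then obtain w where w: "i \<in> ?I \<Longrightarrow> (\<Sum>j\<in>?I. ?H i j * w j) = - (\<Sum>j\<in>P. ?H i j * x j)" for i
    by blast
  define z where "z p = (if p \<in> P then x p else w p)" for p
  define u where "u = synthesis g (?I \<union> P) z"
  have z: "(\<Sum>j\<in>?I \<union> P. ?H i j * z j) = 0" if "i \<in> ?I" for i
  proof -
    have "(\<Sum>j\<in>?I \<union> P. ?H i j * z j) = (\<Sum>j\<in>?I. ?H i j * z j) + (\<Sum>j\<in>P. ?H i j * z j)"
      using finite_dofs[OF C] finP inner_disjoint[OF P] by (intro sum.union_disjoint) auto
    also have "(\<Sum>j\<in>?I. ?H i j * z j) = (\<Sum>j\<in>?I. ?H i j * w j)"
      using inner_disjoint[OF P] by (intro sum.cong) (auto simp: z_def)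
    also have "(\<Sum>j\<in>P. ?H i j * z j) = (\<Sum>j\<in>P. ?H i j * x j)"
      by (intro sum.cong) (auto simp: z_def)
    finally show ?thesis using w[OF that] by simp
  qed
  have "energy g A C v u = 0" if v: "\<forall>f\<in>part_facets g C. v f = 0" for v
  proof -
    define y where "y p = (case p of Inner f \<Rightarrow> v f | _ \<Rightarrow> 0)" for p
    have "energy g A C v u = energy g A C (synthesis g ?I y) u"
      using v by (intro energy_cong) (auto simp: synthesis_inner[OF C refl] y_def)
    also have "\<dots> = bilin ?I (?I \<union> P) ?H y z"
      unfolding u_def bilin_hier_matrix[OF finite_refine[OF C]] ..
    also have "\<dots> = (\<Sum>i\<in>?I. y i * (\<Sum>j\<in>?I \<union> P. ?H i j * z j))"
      by (simp add: bilin_def sum_distrib_left mult_ac)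
    also have "\<dots> = 0" using z by simp
    finally show ?thesis .
  qed
  moreover have "u f = synthesis g P x f" if "f \<in> part_facets g C" for f
  proof -
    have "synthesis g P z f = synthesis g P x f"
      unfolding synthesis_def by (intro sum.cong) (auto simp: z_def)
    then show ?thesis
      using that by (simp add: u_def synthesis_Un[OF C P] synthesis_inner[OF C refl])
  qed
  ultimately show ?thesis unfolding harmonic_def by blast
qed

text \<open>The interiors of different macro-elements do not interact: a vector vanishing on the
  whole skeleton vanishes on that of each macro-element. Harmonicity can thus be verified on one
  macro-element.\<close>

lemma harmonic_local:
  assumes "\<And>G v. (\<And>f. f \<in> part_facets g {G} \<Longrightarrow> v f = 0) \<Longrightarrow> energy g A {G} v u = 0"
  shows "harmonic g A C u"
proof -
  have "energy g A {G} v u = 0" if "\<forall>f\<in>part_facets g C. v f = 0" "G \<in> C" for v G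
    using that by (intro assms) (auto simp: part_facets_def facets_def)
  then show ?thesis by (simp add: harmonic_def energy_sum_macros[OF C])
qed

end

lemma energy_nonneg:
  assumes "spd_on {..<ndof g} A"
  shows "0 \<le> energy g A C u u"
  unfolding energy_def using spd_on_nonneg[OF assms] by (intro sum_nonneg)

text \<open>Reduces one recursion step to the energy of an explicit extension. The factor 1/n in
  \<open>ext\<close> is the weight of each part in an aggregate basis function.\<close>

lemma coarse_element_matrix_form:
  assumes A: "spd_on {..<ndof g} A"
    and ext: "\<And>U F i. i < n \<Longrightarrow> ext U (parts g F ! i) = U F / real n"
    and harm: "\<And>U v. (\<And>f. f \<in> part_facets g {0} \<Longrightarrow> v f = 0) \<Longrightarrow> energy g A {0} v (ext U) = 0"
  shows "bilin {..<ndof g} {..<ndof g} (coarse_element_matrix g A) (U \<circ> dof g 0) (V \<circ> dof g 0) =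
    energy g A {0} (ext U) (ext V)"
proof -
  let ?f = "\<lambda>a. Aggr (dof g 0 a)"
  let ?x = "\<lambda>U p. case p of Aggr F \<Rightarrow> U F | _ \<Rightarrow> (0 :: real)"
  have inj: "inj_on ?f {..<ndof g}"
    using dof_inj[of 0] by (auto simp: inj_on_def)
  have aggr: "aggregates g {0} = ?f ` {..<ndof g}"
    by (auto simp: aggregates_def facets_def)
  have part: "ext U f = synthesis g (aggregates g {0}) (?x U) f" if "f \<in> part_facets g {0}" for U f
    using that by (auto simp: mem_part_facets_iff synthesis_aggregates ext)
  have "bilin {..<ndof g} {..<ndof g} (coarse_element_matrix g A) (U \<circ> dof g 0) (V \<circ> dof g 0) =
      bilin (aggregates g {0}) (aggregates g {0}) (reduced_matrix g A {0}) (?x U) (?x V)"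
    unfolding bilin_def aggr coarse_element_matrix_def sum.reindex[OF inj] by simp
  also have "\<dots> = energy g A {0} (ext U) (ext V)"
    by (rule bilin_reduced_matrix[OF _ A])
      (use part harm in \<open>auto simp: harmonic_def\<close>)
  finally show ?thesis .
qed

text \<open>Upper bound: the macro-element estimates are summed by Cauchy-Schwarz over
  \<open>C\<close>. Lower bound: for \<open>w\<close> and \<open>ext U\<close> the three energies
  are the same on every macro-element and give local equality with the same sign, so nothing is lost
  in the summation. Since \<gamma> is chosen before \<open>C\<close> matters, single macro-elements
  and whole meshes get the same constant.\<close>

lemma splitting_constant_eqI:
  assumes C: "finite C" "C \<noteq> {}" and A: "spd_on {..<ndof g} A" and \<gamma>: "0 \<le> \<gamma>"
    and ext: "\<And>U F i. i < n \<Longrightarrow> ext U (parts g F ! i) = U F / real n"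
    and harm_ext: "\<And>G U v. (\<And>f. f \<in> part_facets g {G} \<Longrightarrow> v f = 0) \<Longrightarrow> energy g A {G} v (ext U) = 0"
    and bound: "\<And>G U w. (\<And>F. F \<in> facets g {G} \<Longrightarrow> (\<Sum>i<n. w (parts g F ! i)) = 0) \<Longrightarrow>
        (energy g A {G} w (ext U))\<^sup>2 \<le> \<gamma>\<^sup>2 * energy g A {G} w w * energy g A {G} (ext U) (ext U)"
    and w: "\<And>F i. i < n \<Longrightarrow>
        w (parts g F ! i) = (\<Sum>m<length (diff_signs g). diff_signs g ! m ! i / real n * d m F)"
    and harm_w: "\<And>G v. (\<And>f. f \<in> part_facets g {G} \<Longrightarrow> v f = 0) \<Longrightarrow> energy g A {G} v w = 0"
    and extremal: "\<And>G. energy g A {G} w w = e1" "\<And>G. energy g A {G} (ext U) (ext U) = e2"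
      "\<And>G. energy g A {G} w (ext U) = \<gamma> * (sqrt e1 * sqrt e2)" "0 < e1" "0 < e2"
  shows "splitting_constant g A C = \<gamma>"
proof -
  let ?D = "differences g C" and ?A = "aggregates g C" and ?B = "reduced_matrix g A C"
  let ?aggr = "\<lambda>U p. case p of Aggr F \<Rightarrow> U F | _ \<Rightarrow> (0 :: real)"
  have ext_part: "ext U f = synthesis g ?A x f"
    if "f \<in> part_facets g C" "\<And>F. F \<in> facets g C \<Longrightarrow> x (Aggr F) = U F" for U f x
    using that C by (auto simp: mem_part_facets_iff synthesis_aggregates ext)
  have ext_harmonic: "harmonic g A C (ext U)" for U
    by (rule harmonic_local[OF C(1) A]) (rule harm_ext)
  have upper: "(bilin ?D ?A ?B x y)\<^sup>2 \<le> \<gamma>\<^sup>2 * (bilin ?D ?D ?B x x * bilin ?A ?A ?B y y)"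
    and nonneg: "0 \<le> bilin ?D ?D ?B x x" "0 \<le> bilin ?A ?A ?B y y" for x y
  proof -
    define V where "V F = y (Aggr F)" for F
    obtain v where v: "harmonic g A C v" "\<And>f. f \<in> part_facets g C \<Longrightarrow> v f = synthesis g ?D x f"
      using ex_harmonic[OF C(1) A, of ?D x] by auto
    have part: "f \<in> part_facets g C \<Longrightarrow> ext V f = synthesis g ?A y f" for f
      by (rule ext_part) (simp_all add: V_def)
    have B: "bilin ?D ?A ?B x y = (\<Sum>G\<in>C. energy g A {G} v (ext V))"
      "bilin ?D ?D ?B x x = (\<Sum>G\<in>C. energy g A {G} v v)"
      "bilin ?A ?A ?B y y = (\<Sum>G\<in>C. energy g A {G} (ext V) (ext V))"
      unfolding energy_sum_macros[OF C(1), symmetric]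
      by (rule bilin_reduced_matrix[OF C(1) A]; use v ext_harmonic part in auto)+
    show nonneg: "0 \<le> bilin ?D ?D ?B x x" "0 \<le> bilin ?A ?A ?B y y"
      unfolding B by (intro sum_nonneg energy_nonneg[OF A])+
    have "(energy g A {G} v (ext V))\<^sup>2 \<le> \<gamma>\<^sup>2 * energy g A {G} v v * energy g A {G} (ext V) (ext V)"
      if "G \<in> C" for G
    proof (rule bound)
      fix F assume "F \<in> facets g {G}"
      then have F: "F \<in> facets g C" using that by (auto simp: facets_def)
      then have "(\<Sum>i<n. v (parts g F ! i)) = (\<Sum>i<n. synthesis g ?D x (parts g F ! i))"
        by (intro sum.cong refl v(2)) (auto simp: mem_part_facets_iff)
      then show "(\<Sum>i<n. v (parts g F ! i)) = 0"
        using synthesis_differences_sum[OF C(1) F] by simp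
    qed
    then have local: "\<bar>energy g A {G} v (ext V)\<bar> \<le>
        (\<gamma> * sqrt (energy g A {G} v v)) * sqrt (energy g A {G} (ext V) (ext V))" if "G \<in> C" for G
      using real_sqrt_le_mono that \<gamma> by (metis real_sqrt_abs real_sqrt_mult abs_of_nonneg)
    have abs: "\<bar>bilin ?D ?A ?B x y\<bar> \<le>
        (\<Sum>G\<in>C. (\<gamma> * sqrt (energy g A {G} v v)) * sqrt (energy g A {G} (ext V) (ext V)))"
      unfolding B by (rule order.trans[OF sum_abs], rule sum_mono, rule local)
    have "(bilin ?D ?A ?B x y)\<^sup>2 \<le>
        (\<Sum>G\<in>C. (\<gamma> * sqrt (energy g A {G} v v)) * sqrt (energy g A {G} (ext V) (ext V)))\<^sup>2"
      using power_mono[OF abs abs_ge_zero, of 2] by simp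
    also have "\<dots> \<le> (\<Sum>G\<in>C. (\<gamma> * sqrt (energy g A {G} v v))\<^sup>2) *
        (\<Sum>G\<in>C. (sqrt (energy g A {G} (ext V) (ext V)))\<^sup>2)"
      by (rule Cauchy_Schwarz_ineq_sum)
    also have "\<dots> = \<gamma>\<^sup>2 * (bilin ?D ?D ?B x x * bilin ?A ?A ?B y y)"
      unfolding B by (simp add: power_mult_distrib energy_nonneg[OF A] mult.assoc flip: sum_distrib_left)
    finally show "(bilin ?D ?A ?B x y)\<^sup>2 \<le> \<gamma>\<^sup>2 * (bilin ?D ?D ?B x x * bilin ?A ?A ?B y y)" .
  qed
  define x where "x p = (case p of Diff m F \<Rightarrow> d m F | _ \<Rightarrow> 0)" for p
  define y where "y = ?aggr U"
  have w_part: "f \<in> part_facets g C \<Longrightarrow> w f = synthesis g ?D x f" for f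
    using C by (auto simp: mem_part_facets_iff synthesis_differences w x_def)
  have U_part: "f \<in> part_facets g C \<Longrightarrow> ext U f = synthesis g ?A y f" for f
    by (rule ext_part) (simp_all add: y_def)
  have w_harmonic: "harmonic g A C w"
    by (rule harmonic_local[OF C(1) A]) (rule harm_w)
  have "bilin ?D ?A ?B x y = (\<Sum>G\<in>C. energy g A {G} w (ext U))"
    "bilin ?D ?D ?B x x = (\<Sum>G\<in>C. energy g A {G} w w)"
    "bilin ?A ?A ?B y y = (\<Sum>G\<in>C. energy g A {G} (ext U) (ext U))"
    unfolding energy_sum_macros[OF C(1), symmetric]
    by (rule bilin_reduced_matrix[OF C(1) A]; use w_part U_part w_harmonic ext_harmonic in auto)+
  then have B: "bilin ?D ?A ?B x y = real (card C) * (\<gamma> * (sqrt e1 * sqrt e2))"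
    "bilin ?D ?D ?B x x = real (card C) * e1" "bilin ?A ?A ?B y y = real (card C) * e2"
    by (simp_all add: extremal)
  have card: "0 < real (card C)" using C by (simp add: card_gt_0_iff)
  show ?thesis unfolding splitting_constant_def cbs_constant_def
  proof (rule cSup_eq_maximum)
    have "sqrt (real (card C) * e1) * sqrt (real (card C) * e2) = real (card C) * (sqrt e1 * sqrt e2)"
      by (simp add: real_sqrt_mult)
    then have "\<gamma> = bilin ?D ?A ?B x y / (sqrt (bilin ?D ?D ?B x x) * sqrt (bilin ?A ?A ?B y y))"
      unfolding B using card extremal(4,5) by simp
    moreover have "\<exists>i\<in>?D. x i \<noteq> 0"
    proof (rule ccontr)
      assume "\<not> (\<exists>i\<in>?D. x i \<noteq> 0)"
      then have "bilin ?D ?D ?B x x = 0" by (simp add: bilin_def)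
      then show False using B(2) card extremal(4) by simp
    qed
    moreover have "\<exists>i\<in>?A. y i \<noteq> 0"
    proof (rule ccontr)
      assume "\<not> (\<exists>i\<in>?A. y i \<noteq> 0)"
      then have "bilin ?A ?A ?B y y = 0" by (simp add: bilin_def)
      then show False using B(3) card extremal(5) by simp
    qed
    ultimately show "\<gamma> \<in> {bilin ?D ?A ?B u1 u2 / (sqrt (bilin ?D ?D ?B u1 u1) * sqrt (bilin ?A ?A ?B u2 u2)) | u1 u2.
        (\<exists>i\<in>?D. u1 i \<noteq> 0) \<and> (\<exists>i\<in>?A. u2 i \<noteq> 0)}" by blast
  next
    fix r assume "r \<in> {bilin ?D ?A ?B u1 u2 / (sqrt (bilin ?D ?D ?B u1 u1) * sqrt (bilin ?A ?A ?B u2 u2)) | u1 u2.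
        (\<exists>i\<in>?D. u1 i \<noteq> 0) \<and> (\<exists>i\<in>?A. u2 i \<noteq> 0)}"
    then obtain u1 u2 where r: "r = bilin ?D ?A ?B u1 u2 / sqrt (bilin ?D ?D ?B u1 u1 * bilin ?A ?A ?B u2 u2)"
      by (auto simp: real_sqrt_mult)
    let ?e = "bilin ?D ?D ?B u1 u1 * bilin ?A ?A ?B u2 u2"
    have "\<bar>bilin ?D ?A ?B u1 u2\<bar> \<le> \<gamma> * sqrt ?e"
      using real_sqrt_le_mono[OF upper[of u1 u2]] \<gamma> by (simp add: real_sqrt_mult)
    have "0 \<le> ?e" using nonneg by simp
    show "r \<le> \<gamma>"
    \<comment> \<open>Where the denominator vanishes the quotient is 0 by the convention for
      division, which is at most \<gamma>; otherwise the square root is positive and can be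
      cleared.\<close>
    proof (cases "?e = 0")
      case True
      then show ?thesis using \<gamma> unfolding r by (simp only: real_sqrt_zero div_by_0)
    next
      case False
      with \<open>0 \<le> ?e\<close> have "0 < ?e" by linarith
      then have "0 < sqrt ?e" by (rule real_sqrt_gt_zero)
      then show ?thesis
        using \<open>\<bar>bilin ?D ?A ?B u1 u2\<bar> \<le> \<gamma> * sqrt ?e\<close> unfolding r pos_divide_le_eq[OF \<open>0 < sqrt ?e\<close>] by linarith
    qed
  qed
qed

end

section \<open>The coefficient recursion\<close>

text \<open>Twice the harmonic mean, and the sum. The harmonic mean comes from eliminating the
  interior value between two opposite facets; the coarse coefficients are multiplied by 4 (squares)
  or 8 (cubes) to restore \<open>s = 1\<close>.\<close>

definition coarsen :: "real \<times> real \<Rightarrow> real \<times> real" where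
  "coarsen = (\<lambda>(a, c). (4 * a * c / (a + c), a + c))"

definition cbs_square :: "real \<Rightarrow> real \<Rightarrow> real" where
  "cbs_square a c = a / (c * ((a + c)\<^sup>2 - 1))"

definition cbs_cube :: "real \<Rightarrow> real \<Rightarrow> real" where
  "cbs_cube a c = 2 * a / (c * (a + c - 1) * (a + c + 2))"

text \<open>As \<open>a\<close> tends to \<open>0\<close> with \<open>c - 1 \<sim> a / 3\<close>, both constants tend to \<open>\<Theta>\<close>, so that their decrease is an effect
  of second order in \<open>a\<close>; the term \<open>4 * a\<^sup>2\<close> leaves room for it and makes the inequality invariant.\<close>

definition admissible :: "real \<times> real \<Rightarrow> bool" where
  "admissible = (\<lambda>(a, c). 0 < a \<and> 1 < c \<and> 3 * c * (c - 1) \<le> a * c + 4 * a\<^sup>2 \<and>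
     (a \<le> c \<or> 3 * (c - 1) = a))"

text \<open>The finest element satisfies \<open>3 * (c - 1) = a\<close> exactly. This alternative is
  kept in the invariant because \<open>a\<close> exceeds \<open>c\<close> there when
  \<open>e > 6\<close>.\<close>

lemma admissible_initial: "0 < e \<Longrightarrow> admissible (e / 4, 1 + e / 12)"
  using mult_pos_pos[of e e] by (simp add: admissible_def field_simps power2_eq_square)

text \<open>The arithmetic-geometric mean inequality places every coarsened pair in the alternative
  \<open>a \<le> c\<close>, so the other one only serves the starting point. The quadratic
  inequality for the new pair is proved separately in both alternatives, after multiplication by
  \<open>S\<^sup>2\<close>.\<close>

lemma coarsen_admissible:
  assumes "admissible p" shows "admissible (coarsen p)"
proof -
  obtain a c where p: "p = (a, c)" by fastforce
  define S where "S = a + c"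
  have ac: "0 < a" "1 < c" and inv: "3 * c * (c - 1) \<le> a * c + 4 * a\<^sup>2" "a \<le> c \<or> 3 * (c - 1) = a"
    using assms by (auto simp: admissible_def p)
  have S: "0 < S" "1 < S" using ac by (simp_all add: S_def)
  have 1: "4 * a * c / S \<le> S"
  proof -
    have "S * S - 4 * a * c = (a - c)\<^sup>2" by (simp add: S_def power2_eq_square algebra_simps)
    then have "4 * a * c \<le> S * S" using zero_le_power2[of "a - c"] by linarith
    then show ?thesis using S by (simp add: pos_divide_le_eq)
  qed
  have "3 * S ^ 3 * (S - 1) \<le> 4 * a * c * S\<^sup>2 + 64 * a\<^sup>2 * c\<^sup>2"
    using inv(2)
  proof
    assume le: "a \<le> c"
    have "3 * c * (S - 1) \<le> 4 * a * c + 4 * a\<^sup>2"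
      using inv(1) by (simp add: S_def algebra_simps)
    then have "c * (3 * S ^ 3 * (S - 1)) \<le> S ^ 3 * (4 * a * c + 4 * a\<^sup>2)"
      using S mult_left_mono[of "3 * c * (S - 1)" "4 * a * c + 4 * a\<^sup>2" "S ^ 3"]
      by (simp add: algebra_simps)
    also have "\<dots> = 4 * a * S\<^sup>2 * S\<^sup>2"
      by (simp add: S_def algebra_simps power2_eq_square power3_eq_cube)
    also have "\<dots> \<le> c * (4 * a * c * S\<^sup>2 + 64 * a\<^sup>2 * c\<^sup>2)"
    proof -
      \<comment> \<open>Here \<open>a \<le> c\<close> is essential, as the left side grows like the
        fourth power of \<open>a\<close>. Each negative monomial of the difference is at most
        \<open>a * c ^ 3\<close> in size, and 14 - 5 - 4 - 1 is still positive.\<close>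
      have "S\<^sup>2 * S\<^sup>2 \<le> c\<^sup>2 * S\<^sup>2 + 16 * a * c ^ 3"
      proof -
        have "0 \<le> a * c * a * (c - a)" "0 \<le> a * a * a * (c - a)" "0 \<le> a * c * c * (c - a)" "0 < a * c ^ 3"
          using ac le by simp_all
        then have "a\<^sup>2 * c\<^sup>2 \<le> a * c ^ 3" "a ^ 3 * c \<le> a\<^sup>2 * c\<^sup>2" "a ^ 4 \<le> a ^ 3 * c" "0 < a * c ^ 3"
          by (simp_all add: algebra_simps eval_nat_numeral)
        moreover have "c\<^sup>2 * S\<^sup>2 + 16 * a * c ^ 3 - S\<^sup>2 * S\<^sup>2 =
            14 * (a * c ^ 3) - 5 * (a\<^sup>2 * c\<^sup>2) - 4 * (a ^ 3 * c) - a ^ 4"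
          by (simp add: S_def algebra_simps eval_nat_numeral)
        ultimately show ?thesis by linarith
      qed
      then show ?thesis
        using mult_left_mono[of "S\<^sup>2 * S\<^sup>2" "c\<^sup>2 * S\<^sup>2 + 16 * a * c ^ 3" "4 * a"] ac
        by (simp add: algebra_simps power2_eq_square power3_eq_cube)
    qed
    finally show ?thesis using ac by simp
  next
    assume a: "3 * (c - 1) = a"
    have "3 * (S - 1) = 4 * a" using a by (simp add: S_def)
    then have "3 * S ^ 3 * (S - 1) = 4 * a * S\<^sup>2 * S"
      by (simp add: power2_eq_square power3_eq_cube)
    also have "\<dots> = 4 * a * c * S\<^sup>2 + 4 * a\<^sup>2 * S\<^sup>2"
      by (simp add: S_def algebra_simps power2_eq_square)
    \<comment> \<open>On the initial line \<open>S = 4 * c - 3\<close>.\<close>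
    also have "S\<^sup>2 \<le> (4 * c)\<^sup>2"
      using S ac a by (intro power_mono) (auto simp: S_def)
    then have "4 * a * c * S\<^sup>2 + 4 * a\<^sup>2 * S\<^sup>2 \<le> 4 * a * c * S\<^sup>2 + 4 * a\<^sup>2 * (4 * c)\<^sup>2"
      by (intro add_left_mono mult_left_mono) auto
    finally show ?thesis by (simp add: power_mult_distrib)
  qed
  then have "3 * S * (S - 1) \<le> 4 * a * c / S * S + 4 * (4 * a * c / S)\<^sup>2"
    using S by (simp add: field_simps power2_eq_square power3_eq_cube)
  then show ?thesis
    using ac S 1 by (simp add: admissible_def coarsen_def p S_def[symmetric])
qed

lemma admissible_coarsen_pow: "admissible p \<Longrightarrow> admissible ((coarsen ^^ n) p)"
  by (induction n) (simp_all add: coarsen_admissible)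

text \<open>After clearing denominators both claims are polynomial inequalities whose only critical
  part is a multiple of \<open>3 * c * (c - 1)\<close>; the invariant bounds it by terms containing
  \<open>a\<close>, which the positive monomials dominate.\<close>

lemma cbs_decreasing:
  assumes "admissible (a, c)"
  defines "S \<equiv> a + c"
  shows "cbs_square (4 * a * c / S) S < cbs_square a c" and "cbs_cube (4 * a * c / S) S < cbs_cube a c"
proof -
  \<comment> \<open>\<open>T / S\<close> is the sum of the two coefficients after the coarsening
    step.\<close>
  define T where "T = S\<^sup>2 + 4 * a * c"
  have ac: "0 < a" "1 < c" and inv: "3 * c * (c - 1) \<le> a * c + 4 * a\<^sup>2"
    using assms by (auto simp: admissible_def)
  have S: "0 < S" "1 < S" and T: "S\<^sup>2 < T" using ac by (simp_all add: S_def T_def)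
  have S2: "1 < S\<^sup>2" using S by (simp add: one_less_power)
  have ST: "S < T"
    using T S by (metis less_trans mult_1 mult_strict_right_mono power2_eq_square)
  have sq: "4 * a * c / S + S = T / S"
    using S by (simp add: T_def field_simps power2_eq_square)
  have mono: "x \<le> x * c" if "0 \<le> x" for x
    using mult_left_mono[of 1 c x] that ac by simp
  have c_pow: "a * c \<le> a * c\<^sup>2" "a * c\<^sup>2 \<le> a * c ^ 3" "a\<^sup>2 * c \<le> a\<^sup>2 * c\<^sup>2" "a\<^sup>2 \<le> a\<^sup>2 * c" "a * c < a * c ^ 3"
  proof -
    show "a * c \<le> a * c\<^sup>2" "a * c\<^sup>2 \<le> a * c ^ 3" "a\<^sup>2 * c \<le> a\<^sup>2 * c\<^sup>2" "a\<^sup>2 \<le> a\<^sup>2 * c"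
      using mono[of "a * c"] mono[of "a * c\<^sup>2"] mono[of "a\<^sup>2 * c"] mono[of "a\<^sup>2"] ac
      by (simp_all add: power2_eq_square power3_eq_cube mult_ac)
    have "c ^ 1 < c ^ 3" using ac by (intro power_strict_increasing) auto
    then show "a * c < a * c ^ 3" using ac by simp
  qed
  have pos: "0 < a ^ 4" "0 < a ^ 3 * c" "0 < a\<^sup>2 * c\<^sup>2" "0 < a ^ 3" using ac by simp_all
  have square: "4 * c\<^sup>2 * (S\<^sup>2 - 1) < T\<^sup>2 - S\<^sup>2"
  proof -
    \<comment> \<open>The factor turns the left side into \<open>3 * c ^ 4 - 3 * c\<^sup>2\<close>,
      exactly the critical part below; the cube needs \<open>c * (c + 2)\<close> for the same
      reason.\<close>
    have "3 * c * (c - 1) * (c * (c + 1)) \<le> (a * c + 4 * a\<^sup>2) * (c * (c + 1))"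
      using ac inv by (intro mult_right_mono) auto
    then have "3 * c ^ 4 - 3 * c\<^sup>2 \<le> a * c ^ 3 + a * c\<^sup>2 + 4 * (a\<^sup>2 * c\<^sup>2) + 4 * (a\<^sup>2 * c)"
      by (simp add: algebra_simps eval_nat_numeral)
    moreover have "T\<^sup>2 - S\<^sup>2 - 4 * c\<^sup>2 * (S\<^sup>2 - 1) =
        a ^ 4 + 12 * (a ^ 3 * c) + 34 * (a\<^sup>2 * c\<^sup>2) + 4 * (a * c ^ 3) - (3 * c ^ 4 - 3 * c\<^sup>2) - a\<^sup>2 - 2 * (a * c)"
      by (simp add: S_def T_def algebra_simps eval_nat_numeral)
    ultimately show ?thesis using c_pow pos by linarith
  qed
  have cube: "4 * c\<^sup>2 * ((S - 1) * (S + 2)) < (T - S) * (T + 2 * S)"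
  proof -
    have "3 * c * (c - 1) * (c * (c + 2)) \<le> (a * c + 4 * a\<^sup>2) * (c * (c + 2))"
      using ac inv by (intro mult_right_mono) auto
    then have "3 * c ^ 4 + 3 * c ^ 3 - 6 * c\<^sup>2 \<le> a * c ^ 3 + 2 * (a * c\<^sup>2) + 4 * (a\<^sup>2 * c\<^sup>2) + 8 * (a\<^sup>2 * c)"
      by (simp add: algebra_simps eval_nat_numeral)
    moreover have "(T - S) * (T + 2 * S) - 4 * c\<^sup>2 * ((S - 1) * (S + 2)) =
        a ^ 4 + 12 * (a ^ 3 * c) + 34 * (a\<^sup>2 * c\<^sup>2) + 4 * (a * c ^ 3) - (3 * c ^ 4 + 3 * c ^ 3 - 6 * c\<^sup>2)
        + a ^ 3 + 7 * (a\<^sup>2 * c) + 3 * (a * c\<^sup>2) - 2 * a\<^sup>2 - 4 * (a * c)"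
      by (simp add: S_def T_def algebra_simps eval_nat_numeral)
    ultimately show ?thesis using c_pow pos by linarith
  qed
  have "S * ((T / S)\<^sup>2 - 1) = (T\<^sup>2 - S\<^sup>2) / S"
    using S by (simp add: field_simps power2_eq_square)
  then have "cbs_square (4 * a * c / S) S = 4 * a * c / (T\<^sup>2 - S\<^sup>2)"
    unfolding cbs_square_def sq using S by simp
  also have "\<dots> < a / (c * (S\<^sup>2 - 1))"
  proof -
    have "0 < 4 * c\<^sup>2 * (S\<^sup>2 - 1)" using ac S2 by simp
    then have "a * (4 * c\<^sup>2 * (S\<^sup>2 - 1)) < a * (T\<^sup>2 - S\<^sup>2)" "0 < T\<^sup>2 - S\<^sup>2"
      using square ac by simp_all
    then show ?thesis using ac S2 by (simp add: field_simps power2_eq_square)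
  qed
  finally show "cbs_square (4 * a * c / S) S < cbs_square a c"
    by (simp add: cbs_square_def S_def)
  have "S * (T / S - 1) * (T / S + 2) = (T - S) * (T + 2 * S) / S"
    using S by (simp add: field_simps power2_eq_square)
  then have "cbs_cube (4 * a * c / S) S = 8 * a * c / ((T - S) * (T + 2 * S))"
    unfolding cbs_cube_def sq using S by simp
  also have "\<dots> < 2 * a / (c * (S - 1) * (S + 2))"
  proof -
    have frac: "8 * a * c / R < 2 * a / (c * P)" if "0 < P" "0 < R" "4 * c\<^sup>2 * P < R" for P R
      using ac that mult_strict_left_mono[OF that(3), of a] by (simp add: field_simps power2_eq_square)
    show ?thesis
      using frac[OF _ _ cube] S ST by (simp add: mult.assoc)
  qed
  finally show "cbs_cube (4 * a * c / S) S < cbs_cube a c"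
    by (simp add: cbs_cube_def S_def)
qed

text \<open>With \<open>m = e / 12\<close> the sum of the coefficients is \<open>1 + 4 * m\<close>,
  so numerator and denominator share the factor \<open>m\<close>. After cancellation \<Theta> is
  visible as the value at \<open>m = 0\<close>, and the remaining denominator grows with
  \<open>m\<close>.\<close>

lemma cbs_initial:
  assumes "0 < e"
  shows "cbs_square (e / 4) (1 + e / 12) < 3 / 8" and "cbs_cube (e / 4) (1 + e / 12) < 1 / 2"
proof -
  define m where "m = e / 12"
  have m: "0 < m" "e / 4 = 3 * m" "e / 12 = m" using assms by (simp_all add: m_def)
  have "cbs_square (3 * m) (1 + m) = 3 * m / (8 * m * ((1 + m) * (1 + 2 * m)))"
    unfolding cbs_square_def by (simp add: algebra_simps power2_eq_square)
  also have "\<dots> = 3 / 8 / ((1 + m) * (1 + 2 * m))" using m by simp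
  also have "\<dots> < 3 / 8"
    using m by (simp add: pos_divide_less_eq algebra_simps add_pos_pos)
  finally show "cbs_square (e / 4) (1 + e / 12) < 3 / 8" unfolding m .
  have "cbs_cube (3 * m) (1 + m) = 6 * m / (4 * m * ((1 + m) * (3 + 4 * m)))"
    unfolding cbs_cube_def by (simp add: algebra_simps power2_eq_square)
  also have "\<dots> = 3 / 2 / ((1 + m) * (3 + 4 * m))" using m by simp
  also have "\<dots> < 1 / 2"
    using m by (simp add: pos_divide_less_eq algebra_simps add_pos_pos)
  finally show "cbs_cube (e / 4) (1 + e / 12) < 1 / 2" unfolding m .
qed

section \<open>Squares\<close>

text \<open>Final step of the macro-element estimates for squares and cubes: \<open>x\<close> and
  \<open>y\<close> are squared norms of the interacting differences and aggregate sums,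
  \<open>z\<close> is their inner product, and \<open>p\<close>, \<open>q\<close> are the constants
  in the energy bounds from below.\<close>

lemma local_cbs:
  fixes x y z p q k :: real
  assumes "z\<^sup>2 \<le> x * y" "p * x \<le> e1" "q * y \<le> e2" "k\<^sup>2 = g * (p * q)" "0 \<le> x" "0 \<le> y" "0 < p" "0 < q" "0 \<le> g"
  shows "(k * z)\<^sup>2 \<le> g * e1 * e2"
proof -
  have "(k * z)\<^sup>2 \<le> g * (p * q) * (x * y)"
    using assms(1,4,7-9) by (simp add: power_mult_distrib mult_left_mono)
  also have "\<dots> = g * ((p * x) * (q * y))" by (simp add: mult_ac)
  also have "\<dots> \<le> g * (e1 * e2)"
  proof (intro mult_left_mono mult_mono assms)
    show "0 \<le> e1" using assms(2,5,7) mult_nonneg_nonneg[of p x] by linarith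
  qed (use assms in auto)
  finally show ?thesis by (simp add: mult.assoc)
qed

interpretation square: nested_geometry square_geometry 2
proof
  fix c c' :: "int \<times> int" and F F' :: edge and i j m :: nat
  obtain x y x' y' where c: "c = (x, y)" "c' = (x', y')" by fastforce
  show "finite (children square_geometry c)" "children square_geometry c \<noteq> {}"
    by (simp_all add: square_geometry_def c)
  show "children square_geometry c \<inter> children square_geometry c' = {}" if "c \<noteq> c'"
    using that by (auto simp: square_geometry_def c)
  show "inj_on (dof square_geometry c) {..<ndof square_geometry}"
    by (auto simp: square_geometry_def c inj_on_def numeral_eq_Suc less_Suc_eq)
  show "length (parts square_geometry F) = 2"
    by (cases F) (simp_all add: square_geometry_def)
  show "F = F' \<and> i = j" if "i < 2" "j < 2" "parts square_geometry F ! i = parts square_geometry F' ! j"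
  proof -
    have "2 * p \<noteq> 2 * q + 1" "2 * p + 1 \<noteq> 2 * q" for p q :: int by presburger+
    moreover have "i = 0 \<or> i = 1" "j = 0 \<or> j = 1" using that by auto
    ultimately show ?thesis using that(3)
      by (cases F; cases F') (auto simp: square_geometry_def)
  qed
  show "(\<Sum>i<2. diff_signs square_geometry ! m ! i) = 0" if "m < length (diff_signs square_geometry)"
    using that by (simp add: square_geometry_def numeral_2_eq_2)
qed simp

text \<open>The differences \<open>u 0 - u 1\<close> and \<open>u 3 - u 2\<close> are oriented as
  the two contributions to the circulation around the square, which makes the coupling
  \<open>s\<close> positive.\<close>

definition square_form :: "real \<Rightarrow> real \<Rightarrow> real \<Rightarrow> (nat \<Rightarrow> real) \<Rightarrow> (nat \<Rightarrow> real) \<Rightarrow> real" where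
  "square_form a c s u v =
     a * ((u 0 + u 1) * (v 0 + v 1) + (u 2 + u 3) * (v 2 + v 3)) +
     c * ((u 0 - u 1) * (v 0 - v 1) + (u 3 - u 2) * (v 3 - v 2)) +
     s * ((u 0 - u 1) * (v 3 - v 2) + (u 3 - u 2) * (v 0 - v 1))"

lemma square_form_spd:
  assumes A: "bilin {..<4} {..<4} A = square_form a c s" and acs: "0 < a" "0 < s" "s < c"
  shows "spd_on {..<4} A"
proof -
  let ?e = "\<lambda>i j. of_bool (j = i) :: real"
  have "A i j = A j i" if "i < 4" "j < 4" for i j
  proof -
    have entry: "A i j = bilin {..<4} {..<4} A (?e i) (?e j)" if "i < 4" "j < 4" for i j
      using that by (simp add: bilin_def sum.remove[of _ i] sum.remove[of _ j])
    show ?thesis using that entry[of i j] entry[of j i]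
      unfolding A square_form_def by (simp add: mult_ac add_ac)
  qed
  moreover have "0 < bilin {..<4} {..<4} A u u" if nz: "\<exists>i<4. u i \<noteq> 0" for u
  proof -
    define p q r t where pq: "p = u 0 + u 1" "q = u 2 + u 3" "r = u 0 - u 1" "t = u 3 - u 2"
    have form: "bilin {..<4} {..<4} A u u = a * (p\<^sup>2 + q\<^sup>2) + ((c - s) * (r\<^sup>2 + t\<^sup>2) + s * (r + t)\<^sup>2)"
      unfolding A square_form_def pq by (simp add: algebra_simps power2_eq_square)
    have "p \<noteq> 0 \<or> q \<noteq> 0 \<or> r \<noteq> 0 \<or> t \<noteq> 0"
      using nz unfolding pq by (auto simp: numeral_eq_Suc less_Suc_eq)
    then consider "0 < p\<^sup>2 + q\<^sup>2" | "0 < r\<^sup>2 + t\<^sup>2"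
      by (auto simp: sum_power2_gt_zero_iff)
    then show ?thesis
    proof cases
      case 1
      then have "0 < a * (p\<^sup>2 + q\<^sup>2)" using acs by simp
      then show ?thesis unfolding form using acs by (simp add: add_pos_nonneg)
    next
      case 2
      then have "0 < (c - s) * (r\<^sup>2 + t\<^sup>2)" using acs by simp
      moreover have "0 \<le> a * (p\<^sup>2 + q\<^sup>2)" "0 \<le> s * (r + t)\<^sup>2" using acs by simp_all
      ultimately show ?thesis unfolding form by linarith
    qed
  qed
  ultimately show ?thesis unfolding spd_on_def by auto
qed

lemma square_energy:
  assumes A: "bilin {..<4} {..<4} A = square_form a c s"
  shows "energy square_geometry A {(X, Y)} u v =
    square_form a c s
      ((!) [u (HEdge (2 * X) (2 * Y)), u (HEdge (2 * X) (2 * Y + 1)),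
            u (VEdge (2 * X) (2 * Y)), u (VEdge (2 * X + 1) (2 * Y))])
      ((!) [v (HEdge (2 * X) (2 * Y)), v (HEdge (2 * X) (2 * Y + 1)),
            v (VEdge (2 * X) (2 * Y)), v (VEdge (2 * X + 1) (2 * Y))]) +
    square_form a c s
      ((!) [u (HEdge (2 * X + 1) (2 * Y)), u (HEdge (2 * X + 1) (2 * Y + 1)),
            u (VEdge (2 * X + 1) (2 * Y)), u (VEdge (2 * X + 2) (2 * Y))])
      ((!) [v (HEdge (2 * X + 1) (2 * Y)), v (HEdge (2 * X + 1) (2 * Y + 1)),
            v (VEdge (2 * X + 1) (2 * Y)), v (VEdge (2 * X + 2) (2 * Y))]) +
    square_form a c s
      ((!) [u (HEdge (2 * X) (2 * Y + 1)), u (HEdge (2 * X) (2 * Y + 2)),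
            u (VEdge (2 * X) (2 * Y + 1)), u (VEdge (2 * X + 1) (2 * Y + 1))])
      ((!) [v (HEdge (2 * X) (2 * Y + 1)), v (HEdge (2 * X) (2 * Y + 2)),
            v (VEdge (2 * X) (2 * Y + 1)), v (VEdge (2 * X + 1) (2 * Y + 1))]) +
    square_form a c s
      ((!) [u (HEdge (2 * X + 1) (2 * Y + 1)), u (HEdge (2 * X + 1) (2 * Y + 2)),
            u (VEdge (2 * X + 1) (2 * Y + 1)), u (VEdge (2 * X + 2) (2 * Y + 1))])
      ((!) [v (HEdge (2 * X + 1) (2 * Y + 1)), v (HEdge (2 * X + 1) (2 * Y + 2)),
            v (VEdge (2 * X + 1) (2 * Y + 1)), v (VEdge (2 * X + 2) (2 * Y + 1))])"
proof -
  have "refine square_geometry {(X, Y)} =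
      {(2 * X, 2 * Y), (2 * X + 1, 2 * Y), (2 * X, 2 * Y + 1), (2 * X + 1, 2 * Y + 1)}"
    by (auto simp: refine_def square_geometry_def)
  moreover have "2 * z + 1 + 1 = 2 * z + 2" for z :: int by simp
  moreover have "u \<circ> square_dof (x, y) =
      (\<lambda>i. u ([HEdge x y, HEdge x (y + 1), VEdge x y, VEdge (x + 1) y] ! i))" for u :: "edge \<Rightarrow> real" and x y
    by auto
  ultimately show ?thesis
    unfolding energy_def by (simp add: square_geometry_def A square_form_def add.assoc)
qed

lemma square_facets:
  "facets square_geometry {(X, Y)} = {HEdge X Y, HEdge X (Y + 1), VEdge X Y, VEdge (X + 1) Y}"
proof -
  have "{..<4} = {0, 1, 2, 3 :: nat}" by auto
  then show ?thesis by (simp add: facets_def square_geometry_def)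
qed

lemma square_part_facets:
  "part_facets square_geometry {(X, Y)} =
     {HEdge (2 * X) (2 * Y), HEdge (2 * X + 1) (2 * Y),
      HEdge (2 * X) (2 * Y + 2), HEdge (2 * X + 1) (2 * Y + 2),
      VEdge (2 * X) (2 * Y), VEdge (2 * X) (2 * Y + 1),
      VEdge (2 * X + 2) (2 * Y), VEdge (2 * X + 2) (2 * Y + 1)}"
  unfolding part_facets_def square_facets by (simp add: square_geometry_def insert_commute)

lemma double_div: "(2 * z + 2) div 2 = z + 1" "(2 * z + 1) div 2 = z" for z :: int
  by simp_all

text \<open>The interior value \<open>l\<close> times the sum of the opposite aggregates makes the extension harmonic
  for \<open>l = (c - a) / (4 * (a + c))\<close>.\<close>

fun square_ext :: "real \<Rightarrow> (edge \<Rightarrow> real) \<Rightarrow> edge \<Rightarrow> real" where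
  "square_ext l U (HEdge x y) = (if even y then U (HEdge (x div 2) (y div 2)) / 2
     else l * (U (HEdge (x div 2) (y div 2)) + U (HEdge (x div 2) (y div 2 + 1))))"
| "square_ext l U (VEdge x y) = (if even x then U (VEdge (x div 2) (y div 2)) / 2
     else l * (U (VEdge (x div 2) (y div 2)) + U (VEdge (x div 2 + 1) (y div 2))))"

lemma square_ext_parts: "i < 2 \<Longrightarrow> square_ext l U (parts square_geometry F ! i) = U F / real 2"
  by (cases F) (auto simp: square_geometry_def less_2_cases_iff)

lemma square_ext_simps:
  "square_ext l U (HEdge (2 * X) (2 * Y)) = U (HEdge X Y) / 2"
  "square_ext l U (HEdge (2 * X + 1) (2 * Y)) = U (HEdge X Y) / 2"
  "square_ext l U (HEdge (2 * X) (2 * Y + 2)) = U (HEdge X (Y + 1)) / 2"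
  "square_ext l U (HEdge (2 * X + 1) (2 * Y + 2)) = U (HEdge X (Y + 1)) / 2"
  "square_ext l U (HEdge (2 * X) (2 * Y + 1)) = l * (U (HEdge X Y) + U (HEdge X (Y + 1)))"
  "square_ext l U (HEdge (2 * X + 1) (2 * Y + 1)) = l * (U (HEdge X Y) + U (HEdge X (Y + 1)))"
  "square_ext l U (VEdge (2 * X) (2 * Y)) = U (VEdge X Y) / 2"
  "square_ext l U (VEdge (2 * X) (2 * Y + 1)) = U (VEdge X Y) / 2"
  "square_ext l U (VEdge (2 * X + 2) (2 * Y)) = U (VEdge (X + 1) Y) / 2"
  "square_ext l U (VEdge (2 * X + 2) (2 * Y + 1)) = U (VEdge (X + 1) Y) / 2"
  "square_ext l U (VEdge (2 * X + 1) (2 * Y)) = l * (U (VEdge X Y) + U (VEdge (X + 1) Y))"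
  "square_ext l U (VEdge (2 * X + 1) (2 * Y + 1)) = l * (U (VEdge X Y) + U (VEdge (X + 1) Y))"
  by (simp_all add: double_div)

lemma square_dof_comp:
  "(u \<circ> square_dof (x, y)) 0 = u (HEdge x y)" "(u \<circ> square_dof (x, y)) 1 = u (HEdge x (y + 1))"
  "(u \<circ> square_dof (x, y)) 2 = u (VEdge x y)" "(u \<circ> square_dof (x, y)) 3 = u (VEdge (x + 1) y)"
  by simp_all

context
  fixes A :: "(nat, nat) matrix" and a c s S l :: real
  assumes A: "bilin {..<4} {..<4} A = square_form a c s" and acs: "0 < a" "0 < s" "s < c"
  defines "S \<equiv> a + c" and "l \<equiv> (c - a) / (4 * S)"
begin

text \<open>In terms of \<open>S\<close> and \<open>l\<close> the identities for the extension
  become polynomial.\<close>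

lemma square_a_c: "a = S / 2 - 2 * S * l" "c = S / 2 + 2 * S * l" "0 < S"
  using acs unfolding l_def by (simp_all add: S_def field_simps)

text \<open>An interior edge is shared by two children as opposite edges, and the extension has the
  same transverse difference in both; so the coupling terms with \<open>s\<close> cancel. With
  \<sigma> the sum of the opposite aggregates and x the interior value, the rest is a (\<sigma>/2 +
  2x) + c (2x - \<sigma>/2) = 0, which determines \<open>l\<close>.\<close>

lemma square_ext_harmonic:
  assumes "\<And>f. f \<in> part_facets square_geometry {G} \<Longrightarrow> v f = 0"
  shows "energy square_geometry A {G} v (square_ext l U) = 0"
proof -
  obtain X Y where G: "G = (X, Y)" by fastforce
  show ?thesis
    using assms unfolding G square_part_facets square_energy[OF A]
    by (simp add: square_form_def square_dof_comp square_ext_simps algebra_simps del: square_ext.simps)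
      (simp add: square_a_c field_simps)
qed

lemma square_ext_energy:
  "energy square_geometry A {G} (square_ext l U) (square_ext l V) =
     square_form (a * c / S) (S / 4) (s / 4) (U \<circ> square_dof G) (V \<circ> square_dof G)"
proof -
  obtain X Y where G: "G = (X, Y)" by fastforce
  have "a * c / S = S / 4 - 4 * S * l\<^sup>2"
    unfolding square_a_c(1,2) using square_a_c(3) by (simp add: field_simps power2_eq_square)
  then show ?thesis
    unfolding G square_energy[OF A]
    by (simp add: square_form_def square_dof_comp square_ext_simps del: square_ext.simps)
      (simp add: square_a_c field_simps power2_eq_square)
qed

end

section \<open>Extremal vectors and the CBS constant on squares\<close>

definition alt :: "int \<Rightarrow> real" where
  "alt i = (if even i then 1 else - 1)"

lemma alt_simps: "alt (2 * i) = 1" "alt (2 * i + 1) = - 1" "alt (i + 1) = - alt i" "alt i * alt i = 1"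
  "alt i * (alt i * x) = x"
  by (auto simp: alt_def)

text \<open>Since every macro-element carries the same pattern up to sign, this vector attains the
  macro-element constant on all of them simultaneously.\<close>

fun square_extremal :: "real \<Rightarrow> edge \<Rightarrow> real" where
  "square_extremal r (HEdge x y) = (if even y then - alt x * alt (y div 2) else 0)"
| "square_extremal r (VEdge x y) = (if even x then 0 else r * alt (y div 2))"

text \<open>The aggregate partner of \<open>square_extremal\<close>. It is equal on the two vertical
  edges of a macro-element, so only their sum is excited. The sign alternates with the row because
  neighbouring rows share horizontal edges, on which the difference vector is antisymmetric between
  bottom and top.\<close>

fun square_aggregate :: "edge \<Rightarrow> real" where
  "square_aggregate (HEdge x y) = 0"
| "square_aggregate (VEdge x y) = alt y"

lemma square_extremal_simps:
  "square_extremal r (HEdge (2 * X) (2 * Y)) = - alt Y"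
  "square_extremal r (HEdge (2 * X + 1) (2 * Y)) = alt Y"
  "square_extremal r (HEdge (2 * X) (2 * Y + 2)) = alt Y"
  "square_extremal r (HEdge (2 * X + 1) (2 * Y + 2)) = - alt Y"
  "square_extremal r (HEdge (2 * X) (2 * Y + 1)) = 0"
  "square_extremal r (HEdge (2 * X + 1) (2 * Y + 1)) = 0"
  "square_extremal r (VEdge (2 * X) (2 * Y)) = 0"
  "square_extremal r (VEdge (2 * X) (2 * Y + 1)) = 0"
  "square_extremal r (VEdge (2 * X + 2) (2 * Y)) = 0"
  "square_extremal r (VEdge (2 * X + 2) (2 * Y + 1)) = 0"
  "square_extremal r (VEdge (2 * X + 1) (2 * Y)) = r * alt Y"
  "square_extremal r (VEdge (2 * X + 1) (2 * Y + 1)) = r * alt Y"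
  by (simp_all add: double_div alt_simps)

lemma square_extremal_parts:
  assumes "i < 2"
  shows "square_extremal r (parts square_geometry F ! i) = (\<Sum>m<length (diff_signs square_geometry).
    diff_signs square_geometry ! m ! i / real 2 * (2 * square_extremal r (parts square_geometry F ! 0)))"
  using assms by (cases F) (auto simp: square_geometry_def less_2_cases_iff alt_simps)

context
  fixes A :: "(nat, nat) matrix" and a c s S l :: real
  assumes A: "bilin {..<4} {..<4} A = square_form a c s" and acs: "0 < a" "0 < s" "s < c"
  defines "S \<equiv> a + c" and "l \<equiv> (c - a) / (4 * S)"
begin

private lemmas a_c = square_a_c[OF A acs, folded S_def, folded l_def]

lemma square_S_s: "0 < S\<^sup>2 - s\<^sup>2"
  using acs by (simp add: S_def power_strict_mono)

lemma square_cbs_nonneg: "0 \<le> a * s\<^sup>2 / (c * (S\<^sup>2 - s\<^sup>2))"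
  using acs square_S_s by (intro divide_nonneg_pos mult_pos_pos) auto

text \<open>The discarded terms involve only differences of opposite aggregates, which do not enter
  the cross energy in \<open>square_bound\<close>.\<close>

lemma square_ext_energy_ge:
  "a * c / S * ((U (HEdge X Y) + U (HEdge X (Y + 1)))\<^sup>2 + (U (VEdge X Y) + U (VEdge (X + 1) Y))\<^sup>2) \<le>
     energy square_geometry A {(X, Y)} (square_ext l U) (square_ext l U)"
proof -
  define d where "d = U (HEdge X Y) - U (HEdge X (Y + 1))"
  define e where "e = U (VEdge (X + 1) Y) - U (VEdge X Y)"
  have "energy square_geometry A {(X, Y)} (square_ext l U) (square_ext l U) =
      a * c / S * ((U (HEdge X Y) + U (HEdge X (Y + 1)))\<^sup>2 + (U (VEdge X Y) + U (VEdge (X + 1) Y))\<^sup>2)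
      + (S - s) / 4 * (d\<^sup>2 + e\<^sup>2) + s / 4 * (d + e)\<^sup>2"
    unfolding l_def S_def square_ext_energy[OF A acs]
    by (simp add: square_form_def square_dof_comp d_def e_def) (simp add: field_simps power2_eq_square)
  moreover have "0 \<le> (S - s) / 4 * (d\<^sup>2 + e\<^sup>2)" "0 \<le> s / 4 * (d + e)\<^sup>2"
    using acs by (simp_all add: S_def)
  ultimately show ?thesis by linarith
qed

text \<open>The sum \<tau> of the vertical aggregates meets only \<open>b - t\<close>, the sum
  \<sigma> of the horizontal ones only \<open>p - q\<close>. In each of these two sectors a single
  interior combination is left to eliminate; all other combinations add nonnegative energy.\<close>

lemma square_bound:
  assumes "\<And>F. F \<in> facets square_geometry {G} \<Longrightarrow> (\<Sum>i<2. w (parts square_geometry F ! i)) = 0"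
  shows "(energy square_geometry A {G} w (square_ext l U))\<^sup>2 \<le>
    a * s\<^sup>2 / (c * (S\<^sup>2 - s\<^sup>2)) * energy square_geometry A {G} w w *
      energy square_geometry A {G} (square_ext l U) (square_ext l U)"
proof -
  obtain X Y where G: "G = (X, Y)" by fastforce
  let ?E = "energy square_geometry A {G}"
  define b where "b = w (HEdge (2 * X) (2 * Y))"
  define t where "t = w (HEdge (2 * X) (2 * Y + 2))"
  define p where "p = w (VEdge (2 * X) (2 * Y))"
  define q where "q = w (VEdge (2 * X + 2) (2 * Y))"
  have w: "w (HEdge (2 * X + 1) (2 * Y)) = - b" "w (HEdge (2 * X + 1) (2 * Y + 2)) = - t"
    "w (VEdge (2 * X) (2 * Y + 1)) = - p" "w (VEdge (2 * X + 2) (2 * Y + 1)) = - q"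
    using assms[of "HEdge X Y"] assms[of "HEdge X (Y + 1)"] assms[of "VEdge X Y"] assms[of "VEdge (X + 1) Y"]
    unfolding G square_facets
    by (simp_all add: square_geometry_def numeral_2_eq_2 b_def t_def p_def q_def eq_neg_iff_add_eq_0 add_ac)
  define h where "h = w (HEdge (2 * X) (2 * Y + 1))"
  define h' where "h' = w (HEdge (2 * X + 1) (2 * Y + 1))"
  define v where "v = w (VEdge (2 * X + 1) (2 * Y))"
  define v' where "v' = w (VEdge (2 * X + 1) (2 * Y + 1))"
  note defs = b_def[symmetric] t_def[symmetric] p_def[symmetric] q_def[symmetric]
    h_def[symmetric] h'_def[symmetric] v_def[symmetric] v'_def[symmetric]
  define \<sigma> where "\<sigma> = U (HEdge X Y) + U (HEdge X (Y + 1))"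
  define \<tau> where "\<tau> = U (VEdge X Y) + U (VEdge (X + 1) Y)"
  have cross: "?E w (square_ext l U) = - (a * s / S) * ((b - t) * \<tau> + (p - q) * \<sigma>)"
  proof -
    have "a * s / S = s / 2 - 2 * s * l"
      unfolding a_c(1) using a_c(3) by (simp add: field_simps)
    show ?thesis
      unfolding \<open>a * s / S = s / 2 - 2 * s * l\<close> G square_energy[OF A] \<sigma>_def \<tau>_def
      by (simp add: square_form_def square_dof_comp square_ext_simps w defs del: square_ext.simps)
        (simp add: a_c(1,2) field_simps)
  qed
  have diag: "(S\<^sup>2 - s\<^sup>2) / S * ((b - t)\<^sup>2 + (p - q)\<^sup>2) \<le> ?E w w"
  proof -
    \<comment> \<open>The combinations of the opposite reflection symmetry; they decouple and are
      collected in \<open>r\<close>.\<close>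
    define b1 t1 p1 v1 where half: "b1 = (b + t) / 2" "t1 = (h - h') / 2" "p1 = (p + q) / 2" "v1 = (v - v') / 2"
    define r where "r = 4 * (a * (b1 + t1)\<^sup>2 + a * (p1 + v1)\<^sup>2 + (c - s) * ((b1 - t1)\<^sup>2 + (v1 - p1)\<^sup>2)
            + s * (b1 - t1 + v1 - p1)\<^sup>2)"
    have E: "?E w w = S * ((b - t)\<^sup>2 + (p - q)\<^sup>2) + S * ((v + v')\<^sup>2 + (h + h')\<^sup>2)
        + 2 * s * ((b - t) * (v + v') + (p - q) * (h + h')) + r"
      unfolding G square_energy[OF A] half S_def r_def
      by (simp add: square_form_def square_dof_comp w defs) (simp add: field_simps power2_eq_square)
    \<comment> \<open>Completing the square in the interior sums \<open>v + v'\<close> and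
      \<open>h + h'\<close>.\<close>
    have "S * ?E w w = (S\<^sup>2 - s\<^sup>2) * ((b - t)\<^sup>2 + (p - q)\<^sup>2)
        + (S * (v + v') + s * (b - t))\<^sup>2 + (S * (h + h') + s * (p - q))\<^sup>2 + S * r"
      unfolding E by (simp add: algebra_simps power2_eq_square)
    moreover have "0 \<le> S * r"
      using acs by (simp add: S_def r_def)
    ultimately have "(S\<^sup>2 - s\<^sup>2) * ((b - t)\<^sup>2 + (p - q)\<^sup>2) \<le> S * ?E w w"
      using zero_le_power2[of "S * (v + v') + s * (b - t)"] zero_le_power2[of "S * (h + h') + s * (p - q)"]
      by linarith
    then show ?thesis using a_c(3) by (simp add: pos_divide_le_eq mult.commute)
  qed
  show ?thesis unfolding cross
  proof (rule local_cbs[OF _ diag])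
    show "((b - t) * \<tau> + (p - q) * \<sigma>)\<^sup>2 \<le> ((b - t)\<^sup>2 + (p - q)\<^sup>2) * (\<sigma>\<^sup>2 + \<tau>\<^sup>2)"
      using zero_le_power2[of "(b - t) * \<sigma> - (p - q) * \<tau>"] by (simp add: algebra_simps power2_eq_square)
    show "a * c / S * (\<sigma>\<^sup>2 + \<tau>\<^sup>2) \<le> ?E (square_ext l U) (square_ext l U)"
      unfolding G \<sigma>_def \<tau>_def by (rule square_ext_energy_ge)
    show "(- (a * s / S))\<^sup>2 = a * s\<^sup>2 / (c * (S\<^sup>2 - s\<^sup>2)) * ((S\<^sup>2 - s\<^sup>2) / S * (a * c / S))"
      using a_c(3) acs square_S_s by (simp add: power2_eq_square)
  qed (use acs a_c(3) square_S_s square_cbs_nonneg in auto)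
qed

text \<open>The right side does not depend on \<open>C\<close>; this is the equality \<gamma> =
  \<gamma>_G.\<close>

lemma square_splitting_constant:
  assumes C: "finite C" "C \<noteq> {}"
  shows "splitting_constant square_geometry A C = sqrt (a * s\<^sup>2 / (c * (S\<^sup>2 - s\<^sup>2)))"
proof (rule square.splitting_constant_eqI[OF C])
  \<comment> \<open>The interior value \<open>s / S\<close> annihilates the square
    \<open>S * (v + v') + s * (b - t)\<close> in \<open>square_bound\<close>.\<close>
  let ?g = "sqrt (a * s\<^sup>2 / (c * (S\<^sup>2 - s\<^sup>2)))" and ?w = "square_extremal (s / S)"
  note simps = square_form_def square_dof_comp square_ext_simps square_extremal_simps alt_simps
  show "spd_on {..<ndof square_geometry} A"
    using square_form_spd[OF A acs] by (simp add: square_geometry_def)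
  show g: "0 \<le> ?g" using square_cbs_nonneg by simp
  show "square_ext l U (parts square_geometry F ! i) = U F / real 2" if "i < 2" for U F i
    using that by (rule square_ext_parts)
  show "energy square_geometry A {G} v (square_ext l U) = 0"
    if "\<And>f. f \<in> part_facets square_geometry {G} \<Longrightarrow> v f = 0" for G U v
    using square_ext_harmonic[OF A acs] that unfolding l_def S_def by blast
  show "(energy square_geometry A {G} w (square_ext l U))\<^sup>2 \<le>
      ?g\<^sup>2 * energy square_geometry A {G} w w * energy square_geometry A {G} (square_ext l U) (square_ext l U)"
    if "\<And>F. F \<in> facets square_geometry {G} \<Longrightarrow> (\<Sum>i<2. w (parts square_geometry F ! i)) = 0" for G U w
    using square_bound[of G w U] that g by simp
  show "?w (parts square_geometry F ! i) = (\<Sum>m<length (diff_signs square_geometry).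
      diff_signs square_geometry ! m ! i / real 2 * (2 * ?w (parts square_geometry F ! 0)))" if "i < 2" for F i
    using that by (rule square_extremal_parts)
  show "energy square_geometry A {G} v ?w = 0"
    if "\<And>f. f \<in> part_facets square_geometry {G} \<Longrightarrow> v f = 0" for G v
  proof -
    obtain X Y where G: "G = (X, Y)" by fastforce
    have v: "\<forall>f\<in>part_facets square_geometry {(X, Y)}. v f = 0" using that G by blast
    have c: "c = S - a" by (simp add: S_def)
    show ?thesis
      unfolding G square_energy[OF A]
      by (simp add: simps v[unfolded square_part_facets, simplified] del: square_extremal.simps)
        (use a_c(3) in \<open>simp add: c field_simps\<close>)
  qed
  \<comment> \<open>The bounds of \<open>square_bound\<close> with equality: \<open>b - t\<close>
    and \<tau> both have absolute value 2, while \<open>p - q\<close> and \<sigma> vanish.\<close>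
  show "0 < 4 * (S\<^sup>2 - s\<^sup>2) / S" "0 < 4 * a * c / S"
    using acs a_c(3) square_S_s by simp_all
  fix G :: "int \<times> int"
  obtain X Y where G: "G = (X, Y)" by fastforce
  have c: "c = S - a" by (simp add: S_def)
  show "energy square_geometry A {G} ?w ?w = 4 * (S\<^sup>2 - s\<^sup>2) / S"
    using a_c(3) unfolding G square_energy[OF A]
    by (simp add: simps del: square_extremal.simps) (simp add: c field_simps power2_eq_square alt_simps)
  show "energy square_geometry A {G} (square_ext l square_aggregate) (square_ext l square_aggregate) = 4 * a * c / S"
    unfolding l_def S_def square_ext_energy[OF A acs] G
    by (simp add: simps)
  have cross: "energy square_geometry A {G} ?w (square_ext l square_aggregate) = 4 * a * s / S"
    using a_c(3) unfolding G square_energy[OF A]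
    by (simp add: simps del: square_extremal.simps square_ext.simps)
      (simp add: a_c(1,2) field_simps power2_eq_square alt_simps)
  have "a * s\<^sup>2 / (c * D) * (4 * D / S * (4 * a * c / S)) = (4 * a * s / S)\<^sup>2" if "0 < D" for D
    using that acs by (simp add: power2_eq_square)
  from this[OF square_S_s] have "?g * (sqrt (4 * (S\<^sup>2 - s\<^sup>2) / S) * sqrt (4 * a * c / S)) = sqrt ((4 * a * s / S)\<^sup>2)"
    by (simp only: real_sqrt_mult[symmetric])
  also have "\<dots> = 4 * a * s / S" using acs a_c(3) by simp
  finally show "energy square_geometry A {G} ?w (square_ext l square_aggregate) =
      ?g * (sqrt (4 * (S\<^sup>2 - s\<^sup>2) / S) * sqrt (4 * a * c / S))"
    using cross by simp
qed

lemma square_coarse: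
  "bilin {..<4} {..<4} (coarse_element_matrix square_geometry A) = square_form (a * c / S) (S / 4) (s / 4)"
proof (intro ext)
  fix u v :: "nat \<Rightarrow> real"
  \<comment> \<open>Transports a local vector to the facets of the macro-element at the
    origin.\<close>
  define U where "U = (\<lambda>u :: nat \<Rightarrow> real. u \<circ> the_inv_into {..<4} (square_dof 0))"
  have U: "(U u \<circ> square_dof 0) i = u i" if "i < 4" for u i
    using square.dof_inj[of 0] that by (simp add: U_def square_geometry_def the_inv_into_f_f)
  have "bilin {..<4} {..<4} (coarse_element_matrix square_geometry A) u v =
      bilin {..<4} {..<4} (coarse_element_matrix square_geometry A) (U u \<circ> square_dof 0) (U v \<circ> square_dof 0)"
    using U by (intro bilin_cong) auto
  also have "\<dots> = energy square_geometry A {0} (square_ext l (U u)) (square_ext l (U v))"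
    using square.coarse_element_matrix_form[of A "square_ext l" "U u" "U v"]
      square_form_spd[OF A acs] square_ext_parts square_ext_harmonic[OF A acs]
    unfolding l_def S_def by (simp add: square_geometry_def)
  also have "\<dots> = square_form (a * c / S) (S / 4) (s / 4) (U u \<circ> square_dof 0) (U v \<circ> square_dof 0)"
    unfolding l_def S_def by (rule square_ext_energy[OF A acs])
  also have "\<dots> = square_form (a * c / S) (S / 4) (s / 4) u v"
    using U unfolding square_form_def by simp
  finally show "bilin {..<4} {..<4} (coarse_element_matrix square_geometry A) u v =
      square_form (a * c / S) (S / 4) (s / 4) u v" .
qed

end

section \<open>Cubes\<close>

interpretation cube: nested_geometry cube_geometry 4
proof
  fix c c' :: "int \<times> int \<times> int" and F F' :: face and i j m :: nat
  obtain x y z x' y' z' where c: "c = (x, y, z)" "c' = (x', y', z')" by (metis prod.exhaust)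
  show "finite (children cube_geometry c)" "children cube_geometry c \<noteq> {}"
    by (simp_all add: cube_geometry_def c)
  show "children cube_geometry c \<inter> children cube_geometry c' = {}" if "c \<noteq> c'"
    using that by (auto simp: cube_geometry_def c)
  show "inj_on (dof cube_geometry c) {..<ndof cube_geometry}"
    by (auto simp: cube_geometry_def c inj_on_def numeral_eq_Suc less_Suc_eq)
  show "length (parts cube_geometry F) = 4"
    by (cases F) (simp_all add: cube_geometry_def)
  show "F = F' \<and> i = j" if "i < 4" "j < 4" "parts cube_geometry F ! i = parts cube_geometry F' ! j"
  proof -
    have "2 * p \<noteq> 2 * q + 1" "2 * p + 1 \<noteq> 2 * q" for p q :: int by presburger+
    moreover have "i \<in> {0, 1, 2, 3}" "j \<in> {0, 1, 2, 3}" using that by auto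
    ultimately show ?thesis using that(3)
      by (cases F; cases F') (auto simp: cube_geometry_def)
  qed
  have "m < 3 \<Longrightarrow> m = 0 \<or> m = 1 \<or> m = 2" by auto
  then show "(\<Sum>i<4. diff_signs cube_geometry ! m ! i) = 0" if "m < length (diff_signs cube_geometry)"
    using that by (auto simp: cube_geometry_def numeral_eq_Suc)
qed simp

text \<open>The part with \<open>s\<close> is the product of the net outward fluxes. Splitting
  \<open>c\<close> into \<open>c - s\<close> and \<open>s\<close> exhibits positive
  definiteness.\<close>

definition cube_form :: "real \<Rightarrow> real \<Rightarrow> real \<Rightarrow> (nat \<Rightarrow> real) \<Rightarrow> (nat \<Rightarrow> real) \<Rightarrow> real" where
  "cube_form a c s u v =
     a * ((u 0 + u 1) * (v 0 + v 1) + (u 2 + u 3) * (v 2 + v 3) + (u 4 + u 5) * (v 4 + v 5)) +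
     (c - s) * ((u 1 - u 0) * (v 1 - v 0) + (u 3 - u 2) * (v 3 - v 2) + (u 5 - u 4) * (v 5 - v 4)) +
     s * ((u 1 - u 0 + (u 3 - u 2) + (u 5 - u 4)) * (v 1 - v 0 + (v 3 - v 2) + (v 5 - v 4)))"

lemma cube_form_spd:
  assumes A: "bilin {..<6} {..<6} A = cube_form a c s" and acs: "0 < a" "0 < s" "s < c"
  shows "spd_on {..<6} A"
proof -
  let ?e = "\<lambda>i j. of_bool (j = i) :: real"
  have "A i j = A j i" if "i < 6" "j < 6" for i j
  proof -
    have entry: "A i j = bilin {..<6} {..<6} A (?e i) (?e j)" if "i < 6" "j < 6" for i j
      using that by (simp add: bilin_def sum.remove[of _ i] sum.remove[of _ j])
    show ?thesis using that entry[of i j] entry[of j i]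
      unfolding A cube_form_def by (simp add: mult_ac add_ac)
  qed
  moreover have "0 < bilin {..<6} {..<6} A u u" if nz: "\<exists>i<6. u i \<noteq> 0" for u
  proof -
    define p q r where pq: "p = u 0 + u 1" "q = u 2 + u 3" "r = u 4 + u 5"
    define x y z where xy: "x = u 1 - u 0" "y = u 3 - u 2" "z = u 5 - u 4"
    have form: "bilin {..<6} {..<6} A u u =
        a * (p\<^sup>2 + q\<^sup>2 + r\<^sup>2) + ((c - s) * (x\<^sup>2 + y\<^sup>2 + z\<^sup>2) + s * (x + y + z)\<^sup>2)"
      unfolding A cube_form_def pq xy by (simp add: power2_eq_square)
    have "p \<noteq> 0 \<or> q \<noteq> 0 \<or> r \<noteq> 0 \<or> x \<noteq> 0 \<or> y \<noteq> 0 \<or> z \<noteq> 0"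
      using nz unfolding pq xy by (auto simp: numeral_eq_Suc less_Suc_eq)
    then consider "0 < p\<^sup>2 + q\<^sup>2 + r\<^sup>2" | "0 < x\<^sup>2 + y\<^sup>2 + z\<^sup>2"
      by (metis add_pos_nonneg add_nonneg_pos zero_le_power2 zero_less_power2 add_nonneg_nonneg)
    then show ?thesis
    proof cases
      case 1
      then have "0 < a * (p\<^sup>2 + q\<^sup>2 + r\<^sup>2)" using acs by simp
      then show ?thesis unfolding form using acs by (simp add: add_pos_nonneg)
    next
      case 2
      then have "0 < (c - s) * (x\<^sup>2 + y\<^sup>2 + z\<^sup>2)" using acs by simp
      moreover have "0 \<le> a * (p\<^sup>2 + q\<^sup>2 + r\<^sup>2)" "0 \<le> s * (x + y + z)\<^sup>2" using acs by simp_all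
      ultimately show ?thesis unfolding form by linarith
    qed
  qed
  ultimately show ?thesis unfolding spd_on_def by auto
qed

text \<open>\<open>lo X i\<close> and \<open>hi X i\<close> are the coordinates between which the lower (\<open>\<not> i\<close>) or upper (\<open>i\<close>)
  children of a macro-element at \<open>X\<close> lie.\<close>

definition lo :: "int \<Rightarrow> bool \<Rightarrow> int" where "lo X i = (if i then 2 * X + 1 else 2 * X)"
definition hi :: "int \<Rightarrow> bool \<Rightarrow> int" where "hi X i = (if i then 2 * X + 2 else 2 * X + 1)"

lemma lo_hi_simps:
  "lo X False = 2 * X" "lo X True = 2 * X + 1" "hi X False = 2 * X + 1" "hi X True = 2 * X + 2"
  "lo X i div 2 = X" "hi X i div 2 = (if i then X + 1 else X)" "even (lo X i) \<longleftrightarrow> \<not> i" "even (hi X i) \<longleftrightarrow> i"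
  by (auto simp: lo_def hi_def)

type_synonym octants = "bool \<Rightarrow> bool \<Rightarrow> bool \<Rightarrow> real"

text \<open>Sums and differences of opposite faces as functions on the eight children. The
  reflections act on these by flipping booleans, so a Walsh transform can replace the expansion in
  all 36 unknowns.\<close>

definition xsum :: "(face \<Rightarrow> real) \<Rightarrow> int \<times> int \<times> int \<Rightarrow> octants" where
  "xsum u = (\<lambda>(X, Y, Z) i j k. u (XFace (lo X i) (lo Y j) (lo Z k)) + u (XFace (hi X i) (lo Y j) (lo Z k)))"
definition ysum :: "(face \<Rightarrow> real) \<Rightarrow> int \<times> int \<times> int \<Rightarrow> octants" where
  "ysum u = (\<lambda>(X, Y, Z) i j k. u (YFace (lo X i) (lo Y j) (lo Z k)) + u (YFace (lo X i) (hi Y j) (lo Z k)))"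
definition zsum :: "(face \<Rightarrow> real) \<Rightarrow> int \<times> int \<times> int \<Rightarrow> octants" where
  "zsum u = (\<lambda>(X, Y, Z) i j k. u (ZFace (lo X i) (lo Y j) (lo Z k)) + u (ZFace (lo X i) (lo Y j) (hi Z k)))"
definition xdiff :: "(face \<Rightarrow> real) \<Rightarrow> int \<times> int \<times> int \<Rightarrow> octants" where
  "xdiff u = (\<lambda>(X, Y, Z) i j k. u (XFace (hi X i) (lo Y j) (lo Z k)) - u (XFace (lo X i) (lo Y j) (lo Z k)))"
definition ydiff :: "(face \<Rightarrow> real) \<Rightarrow> int \<times> int \<times> int \<Rightarrow> octants" where
  "ydiff u = (\<lambda>(X, Y, Z) i j k. u (YFace (lo X i) (hi Y j) (lo Z k)) - u (YFace (lo X i) (lo Y j) (lo Z k)))"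
definition zdiff :: "(face \<Rightarrow> real) \<Rightarrow> int \<times> int \<times> int \<Rightarrow> octants" where
  "zdiff u = (\<lambda>(X, Y, Z) i j k. u (ZFace (lo X i) (lo Y j) (hi Z k)) - u (ZFace (lo X i) (lo Y j) (lo Z k)))"

lemmas octant_defs = xsum_def ysum_def zsum_def xdiff_def ydiff_def zdiff_def

lemma cube_energy:
  assumes A: "bilin {..<6} {..<6} A = cube_form a c s"
  shows "energy cube_geometry A {G} u v = (\<Sum>i\<in>UNIV. \<Sum>j\<in>UNIV. \<Sum>k\<in>UNIV.
    a * (xsum u G i j k * xsum v G i j k + ysum u G i j k * ysum v G i j k + zsum u G i j k * zsum v G i j k) +
    (c - s) * (xdiff u G i j k * xdiff v G i j k + ydiff u G i j k * ydiff v G i j k + zdiff u G i j k * zdiff v G i j k) +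
    s * ((xdiff u G i j k + ydiff u G i j k + zdiff u G i j k) * (xdiff v G i j k + ydiff v G i j k + zdiff v G i j k)))"
proof -
  obtain X Y Z where G: "G = (X, Y, Z)" by (metis prod.exhaust)
  have bools: "{2 * X, 2 * X + 1} = lo X ` UNIV" "inj (lo X)" for X
    by (auto simp: UNIV_bool lo_def inj_def split: if_splits)
  have hi: "lo X i + 1 = hi X i" for X i by (simp add: lo_def hi_def)
  have "refine cube_geometry {(X, Y, Z)} = lo X ` UNIV \<times> lo Y ` UNIV \<times> lo Z ` UNIV"
    by (simp add: refine_def cube_geometry_def bools(1))
  then have "energy cube_geometry A {(X, Y, Z)} u v =
      (\<Sum>x\<in>lo X ` UNIV. \<Sum>y\<in>lo Y ` UNIV. \<Sum>z\<in>lo Z ` UNIV.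
         cube_form a c s (u \<circ> cube_dof (x, y, z)) (v \<circ> cube_dof (x, y, z)))"
    unfolding energy_def by (simp add: cube_geometry_def A sum.cartesian_product)
  also have "\<dots> = (\<Sum>i\<in>UNIV. \<Sum>j\<in>UNIV. \<Sum>k\<in>UNIV.
      cube_form a c s (u \<circ> cube_dof (lo X i, lo Y j, lo Z k)) (v \<circ> cube_dof (lo X i, lo Y j, lo Z k)))"
    by (simp add: sum.reindex bools(2))
  finally show ?thesis
    unfolding G by (simp add: cube_form_def octant_defs hi)
qed

lemma cube_facets:
  "facets cube_geometry {(X, Y, Z)} =
     {XFace X Y Z, XFace (X + 1) Y Z, YFace X Y Z, YFace X (Y + 1) Z, ZFace X Y Z, ZFace X Y (Z + 1)}"
proof -
  have "{..<6} = {0, 1, 2, 3, 4, 5 :: nat}" by auto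
  then show ?thesis by (simp add: facets_def cube_geometry_def)
qed

text \<open>Analogue of \<open>square_ext\<close>. Since a part now carries a quarter of the
  aggregate, the harmonic choice is \<open>l = (c - a) / (8 * S)\<close>.\<close>

fun cube_ext :: "real \<Rightarrow> (face \<Rightarrow> real) \<Rightarrow> face \<Rightarrow> real" where
  "cube_ext l U (XFace x y z) = (if even x then U (XFace (x div 2) (y div 2) (z div 2)) / 4
     else l * (U (XFace (x div 2) (y div 2) (z div 2)) + U (XFace (x div 2 + 1) (y div 2) (z div 2))))"
| "cube_ext l U (YFace x y z) = (if even y then U (YFace (x div 2) (y div 2) (z div 2)) / 4
     else l * (U (YFace (x div 2) (y div 2) (z div 2)) + U (YFace (x div 2) (y div 2 + 1) (z div 2))))"
| "cube_ext l U (ZFace x y z) = (if even z then U (ZFace (x div 2) (y div 2) (z div 2)) / 4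
     else l * (U (ZFace (x div 2) (y div 2) (z div 2)) + U (ZFace (x div 2) (y div 2) (z div 2 + 1))))"

lemma less_4_cases: "i < 4 \<Longrightarrow> i = 0 \<or> i = 1 \<or> i = 2 \<or> i = (3 :: nat)"
  by auto

lemma cube_ext_parts: "i < 4 \<Longrightarrow> cube_ext l U (parts cube_geometry F ! i) = U F / real 4"
  by (cases F) (auto simp: cube_geometry_def dest!: less_4_cases)

section \<open>Walsh transform on the children of a cube\<close>

definition sgn_bool :: "bool \<Rightarrow> real" where
  "sgn_bool b = (if b then - 1 else 1)"

text \<open>Unnormalised Walsh-Hadamard transform on the group of the three reflections; the
  booleans select the character.\<close>

definition walsh :: "octants \<Rightarrow> bool \<Rightarrow> bool \<Rightarrow> bool \<Rightarrow> real" where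
  "walsh f \<alpha> \<beta> \<gamma> = (\<Sum>i\<in>UNIV. \<Sum>j\<in>UNIV. \<Sum>k\<in>UNIV.
     (if \<alpha> then sgn_bool i else 1) * (if \<beta> then sgn_bool j else 1) * (if \<gamma> then sgn_bool k else 1) * f i j k)"

lemma walsh_parseval:
  "(\<Sum>\<alpha>\<in>UNIV. \<Sum>\<beta>\<in>UNIV. \<Sum>\<gamma>\<in>UNIV. (walsh f \<alpha> \<beta> \<gamma>)\<^sup>2) =
     8 * (\<Sum>i\<in>UNIV. \<Sum>j\<in>UNIV. \<Sum>k\<in>UNIV. (f i j k)\<^sup>2)"
  unfolding walsh_def sgn_bool_def UNIV_bool by (simp add: algebra_simps power2_eq_square)

lemma walsh_add: "walsh (\<lambda>i j k. f i j k + g i j k) \<alpha> \<beta> \<gamma> = walsh f \<alpha> \<beta> \<gamma> + walsh g \<alpha> \<beta> \<gamma>"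
  unfolding walsh_def by (simp add: distrib_left sum.distrib)

text \<open>Bessel's inequality for three characters, one per coordinate direction in the
  application.\<close>

lemma walsh_bessel3:
  assumes "(\<alpha>, \<beta>, \<gamma>) \<noteq> (\<alpha>', \<beta>', \<gamma>')" "(\<alpha>, \<beta>, \<gamma>) \<noteq> (\<alpha>'', \<beta>'', \<gamma>'')" "(\<alpha>', \<beta>', \<gamma>') \<noteq> (\<alpha>'', \<beta>'', \<gamma>'')"
  shows "(walsh f \<alpha> \<beta> \<gamma>)\<^sup>2 + (walsh f \<alpha>' \<beta>' \<gamma>')\<^sup>2 + (walsh f \<alpha>'' \<beta>'' \<gamma>'')\<^sup>2 \<le>
    8 * (\<Sum>i\<in>UNIV. \<Sum>j\<in>UNIV. \<Sum>k\<in>UNIV. (f i j k)\<^sup>2)"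
proof -
  let ?W = "\<lambda>(\<alpha>, \<beta>, \<gamma>). (walsh f \<alpha> \<beta> \<gamma>)\<^sup>2"
  have "sum ?W {(\<alpha>, \<beta>, \<gamma>), (\<alpha>', \<beta>', \<gamma>'), (\<alpha>'', \<beta>'', \<gamma>'')} \<le> sum ?W (UNIV \<times> UNIV \<times> UNIV)"
    by (rule sum_mono2) auto
  then show ?thesis
    using assms unfolding walsh_parseval[symmetric] by (simp add: add.assoc sum.cartesian_product)
qed

lemma cube_part_facets:
  "XFace (2 * X) (lo Y j) (lo Z k) \<in> part_facets cube_geometry {(X, Y, Z)}"
  "XFace (2 * X + 2) (lo Y j) (lo Z k) \<in> part_facets cube_geometry {(X, Y, Z)}"
  "YFace (lo X i) (2 * Y) (lo Z k) \<in> part_facets cube_geometry {(X, Y, Z)}"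
  "YFace (lo X i) (2 * Y + 2) (lo Z k) \<in> part_facets cube_geometry {(X, Y, Z)}"
  "ZFace (lo X i) (lo Y j) (2 * Z) \<in> part_facets cube_geometry {(X, Y, Z)}"
  "ZFace (lo X i) (lo Y j) (2 * Z + 2) \<in> part_facets cube_geometry {(X, Y, Z)}"
  unfolding part_facets_def cube_facets by (auto simp: cube_geometry_def lo_def)

text \<open>What a vector of differences, with whatever interior values, satisfies on one
  macro-element.\<close>

definition zero_aggregates :: "int \<times> int \<times> int \<Rightarrow> (face \<Rightarrow> real) \<Rightarrow> bool" where
  "zero_aggregates G u \<longleftrightarrow> (\<forall>F\<in>facets cube_geometry {G}. (\<Sum>i<4. u (parts cube_geometry F ! i)) = 0)"

lemma zero_aggregatesD:
  assumes "zero_aggregates (X, Y, Z) u"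
  shows "(\<Sum>j\<in>UNIV. \<Sum>k\<in>UNIV. u (XFace (2 * X) (lo Y j) (lo Z k))) = 0"
    "(\<Sum>j\<in>UNIV. \<Sum>k\<in>UNIV. u (XFace (2 * X + 2) (lo Y j) (lo Z k))) = 0"
    "(\<Sum>i\<in>UNIV. \<Sum>k\<in>UNIV. u (YFace (lo X i) (2 * Y) (lo Z k))) = 0"
    "(\<Sum>i\<in>UNIV. \<Sum>k\<in>UNIV. u (YFace (lo X i) (2 * Y + 2) (lo Z k))) = 0"
    "(\<Sum>i\<in>UNIV. \<Sum>j\<in>UNIV. u (ZFace (lo X i) (lo Y j) (2 * Z))) = 0"
    "(\<Sum>i\<in>UNIV. \<Sum>j\<in>UNIV. u (ZFace (lo X i) (lo Y j) (2 * Z + 2))) = 0"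
  using assms unfolding zero_aggregates_def cube_facets
  by (simp_all add: cube_geometry_def numeral_eq_Suc UNIV_bool lo_def algebra_simps)

text \<open>The outer faces of a layer sum to zero, so only its four interior faces remain. They are
  the upper faces of the lower children and the lower faces of the upper ones, whence the
  sign.\<close>

lemma zero_aggregates_moments:
  assumes "zero_aggregates G u"
  shows "\<exists>\<xi>. \<forall>i. (\<Sum>j\<in>UNIV. \<Sum>k\<in>UNIV. xsum u G i j k) = \<xi> \<and> (\<Sum>j\<in>UNIV. \<Sum>k\<in>UNIV. xdiff u G i j k) = sgn_bool i * \<xi>"
    and "\<exists>\<eta>. \<forall>j. (\<Sum>i\<in>UNIV. \<Sum>k\<in>UNIV. ysum u G i j k) = \<eta> \<and> (\<Sum>i\<in>UNIV. \<Sum>k\<in>UNIV. ydiff u G i j k) = sgn_bool j * \<eta>"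
    and "\<exists>\<zeta>. \<forall>k. (\<Sum>i\<in>UNIV. \<Sum>j\<in>UNIV. zsum u G i j k) = \<zeta> \<and> (\<Sum>i\<in>UNIV. \<Sum>j\<in>UNIV. zdiff u G i j k) = sgn_bool k * \<zeta>"
proof -
  obtain X Y Z where G: "G = (X, Y, Z)" by (metis prod.exhaust)
  note zero = zero_aggregatesD[OF assms[unfolded G]]
  show "\<exists>\<xi>. \<forall>i. (\<Sum>j\<in>UNIV. \<Sum>k\<in>UNIV. xsum u G i j k) = \<xi> \<and> (\<Sum>j\<in>UNIV. \<Sum>k\<in>UNIV. xdiff u G i j k) = sgn_bool i * \<xi>"
    using zero
    by (intro exI[of _ "\<Sum>j\<in>UNIV. \<Sum>k\<in>UNIV. u (XFace (2 * X + 1) (lo Y j) (lo Z k))"])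
      (simp add: G octant_defs all_bool_eq sum.distrib sum_subtractf lo_hi_simps(1-4) sgn_bool_def)
  show "\<exists>\<eta>. \<forall>j. (\<Sum>i\<in>UNIV. \<Sum>k\<in>UNIV. ysum u G i j k) = \<eta> \<and> (\<Sum>i\<in>UNIV. \<Sum>k\<in>UNIV. ydiff u G i j k) = sgn_bool j * \<eta>"
    using zero
    by (intro exI[of _ "\<Sum>i\<in>UNIV. \<Sum>k\<in>UNIV. u (YFace (lo X i) (2 * Y + 1) (lo Z k))"])
      (simp add: G octant_defs all_bool_eq sum.distrib sum_subtractf lo_hi_simps(1-4) sgn_bool_def)
  show "\<exists>\<zeta>. \<forall>k. (\<Sum>i\<in>UNIV. \<Sum>j\<in>UNIV. zsum u G i j k) = \<zeta> \<and> (\<Sum>i\<in>UNIV. \<Sum>j\<in>UNIV. zdiff u G i j k) = sgn_bool k * \<zeta>"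
    using zero
    by (intro exI[of _ "\<Sum>i\<in>UNIV. \<Sum>j\<in>UNIV. u (ZFace (lo X i) (lo Y j) (2 * Z + 1))"])
      (simp add: G octant_defs all_bool_eq sum.distrib sum_subtractf lo_hi_simps(1-4) sgn_bool_def)
qed

lemma walsh_zero_aggregates:
  assumes "zero_aggregates G u"
  shows "walsh (xsum u G) False False False = walsh (xdiff u G) True False False"
    and "walsh (ysum u G) False False False = walsh (ydiff u G) False True False"
    and "walsh (zsum u G) False False False = walsh (zdiff u G) False False True"
  using zero_aggregates_moments[OF assms] unfolding walsh_def
  by (auto simp: UNIV_bool sgn_bool_def all_bool_eq)

text \<open>In the direction of the faces the interior values cancel on both sides, and the same
  outer values are left.\<close>

lemma walsh_sum_diff:
  "walsh (ysum u G) True True False = - walsh (ydiff u G) True False False"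
  "walsh (zsum u G) True False True = - walsh (zdiff u G) True False False"
  "walsh (xsum u G) True True False = - walsh (xdiff u G) False True False"
  "walsh (zsum u G) False True True = - walsh (zdiff u G) False True False"
  "walsh (xsum u G) True False True = - walsh (xdiff u G) False False True"
  "walsh (ysum u G) False True True = - walsh (ydiff u G) False False True"
  by (cases G; simp add: walsh_def UNIV_bool sgn_bool_def octant_defs lo_hi_simps(1-4))+

text \<open>The combination of differences that interacts with the sum of the two aggregates in direction \<open>d\<close>.\<close>

definition sector_amplitude :: "(face \<Rightarrow> real) \<Rightarrow> int \<times> int \<times> int \<Rightarrow> nat \<Rightarrow> real" where
  "sector_amplitude u G d = [walsh (ydiff u G) True False False + walsh (zdiff u G) True False False,
     walsh (xdiff u G) False True False + walsh (zdiff u G) False True False,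
     walsh (xdiff u G) False False True + walsh (ydiff u G) False False True] ! d"

text \<open>The remaining unknown \<open>p\<close> of a sector is eliminated by completing the square.\<close>

lemma sector_bound:
  fixes a c s p q r :: real
  assumes "0 < a" "0 < s" "s < c"
  defines "S \<equiv> a + c"
  shows "(S - s) * (S + 2 * s) / (2 * S) * (q + r)\<^sup>2 \<le>
    a * (p\<^sup>2 + q\<^sup>2 + r\<^sup>2) + (c - s) * (p\<^sup>2 + q\<^sup>2 + r\<^sup>2) + s * (p + q + r)\<^sup>2"
proof -
  have S: "0 < S" "c = S - a" using assms by (simp_all add: S_def)
  have "2 * S * (a * (p\<^sup>2 + q\<^sup>2 + r\<^sup>2) + (c - s) * (p\<^sup>2 + q\<^sup>2 + r\<^sup>2) + s * (p + q + r)\<^sup>2) =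
      (S - s) * (S + 2 * s) * (q + r)\<^sup>2 + 2 * (S * p + s * (q + r))\<^sup>2 + S * (S - s) * (q - r)\<^sup>2"
    unfolding S(2) by (simp add: algebra_simps power2_eq_square)
  moreover have "0 \<le> S * (S - s) * (q - r)\<^sup>2"
    using assms by (simp add: S_def)
  ultimately have "(S - s) * (S + 2 * s) * (q + r)\<^sup>2 \<le>
      2 * S * (a * (p\<^sup>2 + q\<^sup>2 + r\<^sup>2) + (c - s) * (p\<^sup>2 + q\<^sup>2 + r\<^sup>2) + s * (p + q + r)\<^sup>2)"
    using zero_le_power2[of "S * p + s * (q + r)"] by linarith
  then show ?thesis using S(1) by (simp add: pos_divide_le_eq mult.commute)
qed

text \<open>Tailored to a second argument whose components depend only on their own coordinate, as
  \<open>cube_ext\<close> does: only layer sums of the first argument survive.\<close>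

lemma product_sum:
  fixes f g h x y z :: octants and p q r x' y' z' :: "bool \<Rightarrow> real"
  shows "(\<Sum>i\<in>UNIV. \<Sum>j\<in>UNIV. \<Sum>k\<in>UNIV. a * (f i j k * p i + g i j k * q j + h i j k * r k) +
      (c - s) * (x i j k * x' i + y i j k * y' j + z i j k * z' k) +
      s * ((x i j k + y i j k + z i j k) * (x' i + y' j + z' k))) =
    (\<Sum>i\<in>UNIV. a * p i * (\<Sum>j\<in>UNIV. \<Sum>k\<in>UNIV. f i j k) + c * x' i * (\<Sum>j\<in>UNIV. \<Sum>k\<in>UNIV. x i j k)) +
    (\<Sum>j\<in>UNIV. a * q j * (\<Sum>i\<in>UNIV. \<Sum>k\<in>UNIV. g i j k) + c * y' j * (\<Sum>i\<in>UNIV. \<Sum>k\<in>UNIV. y i j k)) +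
    (\<Sum>k\<in>UNIV. a * r k * (\<Sum>i\<in>UNIV. \<Sum>j\<in>UNIV. h i j k) + c * z' k * (\<Sum>i\<in>UNIV. \<Sum>j\<in>UNIV. z i j k)) +
    s * ((\<Sum>i\<in>UNIV. x' i * (\<Sum>j\<in>UNIV. \<Sum>k\<in>UNIV. y i j k + z i j k)) +
      (\<Sum>j\<in>UNIV. y' j * (\<Sum>i\<in>UNIV. \<Sum>k\<in>UNIV. x i j k + z i j k)) +
      (\<Sum>k\<in>UNIV. z' k * (\<Sum>i\<in>UNIV. \<Sum>j\<in>UNIV. x i j k + y i j k)))"
  unfolding UNIV_bool by (simp add: algebra_simps)

text \<open>The total over all children vanishes, so the two layer sums are opposite and each is
  half of the Walsh coefficient up to sign.\<close>

lemma half_sums: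
  assumes "zero_aggregates G u"
  shows "(\<Sum>j\<in>UNIV. \<Sum>k\<in>UNIV. ydiff u G i j k) = sgn_bool i * walsh (ydiff u G) True False False / 2" (is ?thesis1)
    and "(\<Sum>j\<in>UNIV. \<Sum>k\<in>UNIV. zdiff u G i j k) = sgn_bool i * walsh (zdiff u G) True False False / 2" (is ?thesis2)
    and "(\<Sum>i\<in>UNIV. \<Sum>k\<in>UNIV. xdiff u G i j k) = sgn_bool j * walsh (xdiff u G) False True False / 2" (is ?thesis3)
    and "(\<Sum>i\<in>UNIV. \<Sum>k\<in>UNIV. zdiff u G i j k) = sgn_bool j * walsh (zdiff u G) False True False / 2" (is ?thesis4)
    and "(\<Sum>i\<in>UNIV. \<Sum>j\<in>UNIV. xdiff u G i j k) = sgn_bool k * walsh (xdiff u G) False False True / 2" (is ?thesis5)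
    and "(\<Sum>i\<in>UNIV. \<Sum>j\<in>UNIV. ydiff u G i j k) = sgn_bool k * walsh (ydiff u G) False False True / 2" (is ?thesis6)
proof -
  have "(\<Sum>i\<in>UNIV. \<Sum>j\<in>UNIV. \<Sum>k\<in>UNIV. xdiff u G i j k) = 0"
    "(\<Sum>i\<in>UNIV. \<Sum>j\<in>UNIV. \<Sum>k\<in>UNIV. ydiff u G i j k) = 0"
    "(\<Sum>i\<in>UNIV. \<Sum>j\<in>UNIV. \<Sum>k\<in>UNIV. zdiff u G i j k) = 0"
    using zero_aggregates_moments[OF assms] by (auto simp: UNIV_bool sgn_bool_def all_bool_eq)
  then show ?thesis1 ?thesis2 ?thesis3 ?thesis4 ?thesis5 ?thesis6
    by (cases i; cases j; cases k; simp add: walsh_def UNIV_bool sgn_bool_def)+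
qed

lemma inner_zero_aggregates:
  assumes "\<And>f. f \<in> part_facets cube_geometry {G} \<Longrightarrow> v f = 0"
  shows "zero_aggregates G v"
  unfolding zero_aggregates_def
  using assms by (intro ballI sum.neutral) (auto simp: cube.mem_part_facets_iff)

text \<open>These coefficients telescope to values on outer faces, hence vanish for vectors living
  on interior faces.\<close>

lemma inner_walsh:
  assumes "\<And>f. f \<in> part_facets cube_geometry {G} \<Longrightarrow> v f = 0"
  shows "walsh (ydiff v G) True False False = 0" (is ?thesis1) "walsh (zdiff v G) True False False = 0" (is ?thesis2)
    "walsh (xdiff v G) False True False = 0" (is ?thesis3) "walsh (zdiff v G) False True False = 0" (is ?thesis4)
    "walsh (xdiff v G) False False True = 0" (is ?thesis5) "walsh (ydiff v G) False False True = 0" (is ?thesis6)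
proof -
  obtain X Y Z where G: "G = (X, Y, Z)" by (metis prod.exhaust)
  have "v (XFace (2 * X) (lo Y j) (lo Z k)) = 0" "v (XFace (2 * X + 2) (lo Y j) (lo Z k)) = 0"
    "v (YFace (lo X i) (2 * Y) (lo Z k)) = 0" "v (YFace (lo X i) (2 * Y + 2) (lo Z k)) = 0"
    "v (ZFace (lo X i) (lo Y j) (2 * Z)) = 0" "v (ZFace (lo X i) (lo Y j) (2 * Z + 2)) = 0" for i j k
    by (rule assms[unfolded G], rule cube_part_facets)+
  then have v: "\<forall>j k. v (XFace (2 * X) (lo Y j) (lo Z k)) = 0 \<and> v (XFace (2 * X + 2) (lo Y j) (lo Z k)) = 0"
    "\<forall>i k. v (YFace (lo X i) (2 * Y) (lo Z k)) = 0 \<and> v (YFace (lo X i) (2 * Y + 2) (lo Z k)) = 0"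
    "\<forall>i j. v (ZFace (lo X i) (lo Y j) (2 * Z)) = 0 \<and> v (ZFace (lo X i) (lo Y j) (2 * Z + 2)) = 0"
    by simp_all
  show ?thesis1 ?thesis2 ?thesis3 ?thesis4 ?thesis5 ?thesis6
    using v unfolding G walsh_def octant_defs UNIV_bool
    by (simp_all add: all_bool_eq lo_hi_simps(1-4) sgn_bool_def)
qed

section \<open>Aggregate extension and extremal vectors on cubes\<close>

lemma cube_ext_octants:
  fixes U :: "face \<Rightarrow> real" and X Y Z :: int
  defines "x0 \<equiv> U (XFace X Y Z)" and "x1 \<equiv> U (XFace (X + 1) Y Z)"
    and "y0 \<equiv> U (YFace X Y Z)" and "y1 \<equiv> U (YFace X (Y + 1) Z)"
    and "z0 \<equiv> U (ZFace X Y Z)" and "z1 \<equiv> U (ZFace X Y (Z + 1))"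
  shows "xsum (cube_ext l U) (X, Y, Z) = (\<lambda>i j k. (if i then x1 else x0) / 4 + l * (x0 + x1))"
    "ysum (cube_ext l U) (X, Y, Z) = (\<lambda>i j k. (if j then y1 else y0) / 4 + l * (y0 + y1))"
    "zsum (cube_ext l U) (X, Y, Z) = (\<lambda>i j k. (if k then z1 else z0) / 4 + l * (z0 + z1))"
    "xdiff (cube_ext l U) (X, Y, Z) = (\<lambda>i j k. sgn_bool i * (l * (x0 + x1) - (if i then x1 else x0) / 4))"
    "ydiff (cube_ext l U) (X, Y, Z) = (\<lambda>i j k. sgn_bool j * (l * (y0 + y1) - (if j then y1 else y0) / 4))"
    "zdiff (cube_ext l U) (X, Y, Z) = (\<lambda>i j k. sgn_bool k * (l * (z0 + z1) - (if k then z1 else z0) / 4))"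
  unfolding octant_defs by (auto simp: fun_eq_iff lo_hi_simps sgn_bool_def x0_def x1_def y0_def y1_def z0_def z1_def)

text \<open>Alternates in x across the parts of y- and z-faces, with signs flipping between
  macro-elements in y and z so that shared faces agree. The parameter \<open>r\<close> is the
  response of the interior x-faces.\<close>

fun cube_extremal :: "real \<Rightarrow> face \<Rightarrow> real" where
  "cube_extremal r (XFace x y z) = (if even x then 0 else r * (alt (y div 2) * alt (z div 2)))"
| "cube_extremal r (YFace x y z) = (if even y then alt x * (alt (y div 2) * alt (z div 2)) else 0)"
| "cube_extremal r (ZFace x y z) = (if even z then alt x * (alt (y div 2) * alt (z div 2)) else 0)"

fun cube_aggregate :: "face \<Rightarrow> real" where
  "cube_aggregate (XFace x y z) = alt y * alt z"
| "cube_aggregate (YFace x y z) = 0"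
| "cube_aggregate (ZFace x y z) = 0"

lemma alt_lo: "alt (lo X i) = sgn_bool i"
  by (simp add: lo_def alt_def sgn_bool_def)

lemma cube_extremal_octants:
  "xsum (cube_extremal r) (X, Y, Z) = (\<lambda>i j k. r * (alt Y * alt Z))"
  "ysum (cube_extremal r) (X, Y, Z) = (\<lambda>i j k. sgn_bool i * sgn_bool j * (alt Y * alt Z))"
  "zsum (cube_extremal r) (X, Y, Z) = (\<lambda>i j k. sgn_bool i * sgn_bool k * (alt Y * alt Z))"
  "xdiff (cube_extremal r) (X, Y, Z) = (\<lambda>i j k. sgn_bool i * r * (alt Y * alt Z))"
  "ydiff (cube_extremal r) (X, Y, Z) = (\<lambda>i j k. - sgn_bool i * (alt Y * alt Z))"
  "zdiff (cube_extremal r) (X, Y, Z) = (\<lambda>i j k. - sgn_bool i * (alt Y * alt Z))"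
  unfolding octant_defs by (auto simp: fun_eq_iff lo_hi_simps alt_lo alt_simps sgn_bool_def)

text \<open>On y- and z-faces the parts are listed with x running fastest, so the alternation in x
  is exactly the first sign pattern.\<close>

lemma cube_extremal_parts:
  assumes "i < 4"
  shows "cube_extremal r (parts cube_geometry F ! i) = (\<Sum>m<length (diff_signs cube_geometry).
    diff_signs cube_geometry ! m ! i / real 4 *
      (if m = 0 then 4 * cube_extremal r (parts cube_geometry F ! 0) else 0))"
  using less_4_cases[OF assms]
  by (cases F) (auto simp: cube_geometry_def numeral_3_eq_3 alt_simps)

lemma cube_extremal_zero_aggregates: "zero_aggregates G (cube_extremal r)"
proof -
  have "(\<Sum>i<4. cube_extremal r (parts cube_geometry F ! i)) = 0" for F
    by (cases F) (simp_all add: cube_geometry_def numeral_eq_Suc alt_def)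
  then show ?thesis by (simp add: zero_aggregates_def)
qed

context
  fixes A :: "(nat, nat) matrix" and a c s S l :: real
  assumes A: "bilin {..<6} {..<6} A = cube_form a c s" and acs: "0 < a" "0 < s" "s < c"
  defines "S \<equiv> a + c" and "l \<equiv> (c - a) / (8 * S)"
begin

lemma cube_S_l: "0 < S" "a * (1 / 4 + 2 * l) + c * (2 * l - 1 / 4) = 0" "2 * l - 1 / 4 = - a / (2 * S)"
  "1 / 4 + 2 * l = c / (2 * S)"
  using acs unfolding l_def by (simp_all add: S_def field_simps)

text \<open>The sums \<xi>, \<eta>, \<zeta> over interior faces carry the factor
  \<open>a * (1 / 4 + 2 * l) + c * (2 * l - 1 / 4)\<close>, which the choice of \<open>l\<close>
  annihilates. Only the coupling through \<open>s\<close> remains, so vectors on interior faces,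
  whose amplitudes are zero, give harmonicity as a special case.\<close>

lemma cube_cross_energy:
  assumes w: "zero_aggregates (X, Y, Z) w"
  shows "energy cube_geometry A {(X, Y, Z)} w (cube_ext l U) = - (a * s / (4 * S)) *
    (sector_amplitude w (X, Y, Z) 0 * (U (XFace X Y Z) + U (XFace (X + 1) Y Z)) +
     sector_amplitude w (X, Y, Z) 1 * (U (YFace X Y Z) + U (YFace X (Y + 1) Z)) +
     sector_amplitude w (X, Y, Z) 2 * (U (ZFace X Y Z) + U (ZFace X Y (Z + 1))))"
proof -
  obtain \<xi> where \<xi>: "\<forall>i. (\<Sum>j\<in>UNIV. \<Sum>k\<in>UNIV. xsum w (X, Y, Z) i j k) = \<xi> \<and>
      (\<Sum>j\<in>UNIV. \<Sum>k\<in>UNIV. xdiff w (X, Y, Z) i j k) = sgn_bool i * \<xi>"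
    using zero_aggregates_moments(1)[OF w] by (rule exE)
  obtain \<eta> where \<eta>: "\<forall>j. (\<Sum>i\<in>UNIV. \<Sum>k\<in>UNIV. ysum w (X, Y, Z) i j k) = \<eta> \<and>
      (\<Sum>i\<in>UNIV. \<Sum>k\<in>UNIV. ydiff w (X, Y, Z) i j k) = sgn_bool j * \<eta>"
    using zero_aggregates_moments(2)[OF w] by (rule exE)
  obtain \<zeta> where \<zeta>: "\<forall>k. (\<Sum>i\<in>UNIV. \<Sum>j\<in>UNIV. zsum w (X, Y, Z) i j k) = \<zeta> \<and>
      (\<Sum>i\<in>UNIV. \<Sum>j\<in>UNIV. zdiff w (X, Y, Z) i j k) = sgn_bool k * \<zeta>"
    using zero_aggregates_moments(3)[OF w] by (rule exE)
  note sums = \<xi>[rule_format, THEN conjunct1] \<xi>[rule_format, THEN conjunct2]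
    \<eta>[rule_format, THEN conjunct1] \<eta>[rule_format, THEN conjunct2]
    \<zeta>[rule_format, THEN conjunct1] \<zeta>[rule_format, THEN conjunct2] half_sums[OF w] sum.distrib
  have "energy cube_geometry A {(X, Y, Z)} w (cube_ext l U) =
      (a * (1 / 4 + 2 * l) + c * (2 * l - 1 / 4)) *
        (\<xi> * (U (XFace X Y Z) + U (XFace (X + 1) Y Z)) + \<eta> * (U (YFace X Y Z) + U (YFace X (Y + 1) Z))
         + \<zeta> * (U (ZFace X Y Z) + U (ZFace X Y (Z + 1)))) +
      s / 2 * (2 * l - 1 / 4) *
      (sector_amplitude w (X, Y, Z) 0 * (U (XFace X Y Z) + U (XFace (X + 1) Y Z)) +
       sector_amplitude w (X, Y, Z) 1 * (U (YFace X Y Z) + U (YFace X (Y + 1) Z)) +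
       sector_amplitude w (X, Y, Z) 2 * (U (ZFace X Y Z) + U (ZFace X Y (Z + 1))))"
    unfolding cube_energy[OF A] cube_ext_octants
    by (subst product_sum, simp only: sum.distrib sums, simp add: UNIV_bool sgn_bool_def sector_amplitude_def)
      (simp add: field_simps)
  then show ?thesis unfolding cube_S_l(2) unfolding cube_S_l(3) by simp
qed

lemma cube_ext_harmonic:
  assumes v: "\<And>f. f \<in> part_facets cube_geometry {G} \<Longrightarrow> v f = 0"
  shows "energy cube_geometry A {G} v (cube_ext l U) = 0"
proof -
  obtain X Y Z where G: "G = (X, Y, Z)" by (metis prod.exhaust)
  show ?thesis
    using inner_walsh[of "(X, Y, Z)" v] cube_cross_energy[of X Y Z v U] inner_zero_aggregates[of "(X, Y, Z)" v] v
    unfolding G by (simp add: sector_amplitude_def)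
qed

lemma cube_ext_energy:
  "energy cube_geometry A {G} (cube_ext l U) (cube_ext l V) =
     cube_form (a * c / (2 * S)) (S / 8) (s / 8) (U \<circ> cube_dof G) (V \<circ> cube_dof G)"
proof -
  obtain X Y Z where G: "G = (X, Y, Z)" by (metis prod.exhaust)
  define k where "k = a * c / (2 * S)"
  \<comment> \<open>The contribution of one coordinate direction; distinct directions meet only
    through \<open>s\<close>.\<close>
  define q where "q = (\<lambda>u0 u1 v0 v1.
      4 * (a * ((u0 / 4 + l * (u0 + u1)) * (v0 / 4 + l * (v0 + v1)) + (u1 / 4 + l * (u0 + u1)) * (v1 / 4 + l * (v0 + v1)))
      + c * ((l * (u0 + u1) - u0 / 4) * (l * (v0 + v1) - v0 / 4) + (l * (u0 + u1) - u1 / 4) * (l * (v0 + v1) - v1 / 4))))"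
  have q: "q u0 u1 v0 v1 = a * c / (2 * S) * ((u0 + u1) * (v0 + v1)) + S / 8 * ((u1 - u0) * (v1 - v0))" for u0 u1 v0 v1
  proof -
    have "q u0 u1 v0 v1 =
      (a * (1 / 4 + 2 * l)\<^sup>2 + c * (2 * l - 1 / 4)\<^sup>2) * 2 * ((u0 + u1) * (v0 + v1)) + (a + c) / 8 * ((u1 - u0) * (v1 - v0))"
      unfolding q_def by (simp add: field_simps power2_eq_square)
    also have "(a * (1 / 4 + 2 * l)\<^sup>2 + c * (2 * l - 1 / 4)\<^sup>2) * 2 = a * c / (2 * S)"
    proof -
      have "(a * (c / (2 * S))\<^sup>2 + c * (- a / (2 * S))\<^sup>2) * 2 = a * c * (a + c) / (2 * S * S)"
        by (simp add: field_simps power2_eq_square add_divide_distrib)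
      then show ?thesis
        unfolding cube_S_l(3,4) using cube_S_l(1) by (simp flip: S_def)
    qed
    finally show ?thesis by (simp add: S_def)
  qed
  define d where "d = (\<lambda>U :: face \<Rightarrow> real. \<lambda>f f'. U f' - U f)"
  have "energy cube_geometry A {(X, Y, Z)} (cube_ext l U) (cube_ext l V) =
      q (U (XFace X Y Z)) (U (XFace (X + 1) Y Z)) (V (XFace X Y Z)) (V (XFace (X + 1) Y Z)) +
      q (U (YFace X Y Z)) (U (YFace X (Y + 1) Z)) (V (YFace X Y Z)) (V (YFace X (Y + 1) Z)) +
      q (U (ZFace X Y Z)) (U (ZFace X Y (Z + 1))) (V (ZFace X Y Z)) (V (ZFace X Y (Z + 1))) +
      s / 8 * (d V (XFace X Y Z) (XFace (X + 1) Y Z) * (d U (YFace X Y Z) (YFace X (Y + 1) Z) + d U (ZFace X Y Z) (ZFace X Y (Z + 1)))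
       + d V (YFace X Y Z) (YFace X (Y + 1) Z) * (d U (XFace X Y Z) (XFace (X + 1) Y Z) + d U (ZFace X Y Z) (ZFace X Y (Z + 1)))
       + d V (ZFace X Y Z) (ZFace X Y (Z + 1)) * (d U (XFace X Y Z) (XFace (X + 1) Y Z) + d U (YFace X Y Z) (YFace X (Y + 1) Z)))"
    unfolding cube_energy[OF A] cube_ext_octants
    by (subst product_sum, simp add: UNIV_bool sgn_bool_def) (simp add: q_def d_def field_simps)
  then show ?thesis
    unfolding G q d_def k_def[symmetric] by (simp add: cube_form_def) (simp add: field_simps)
qed

lemma cube_ext_energy_ge:
  "a * c / (2 * S) * ((U (XFace X Y Z) + U (XFace (X + 1) Y Z))\<^sup>2 + (U (YFace X Y Z) + U (YFace X (Y + 1) Z))\<^sup>2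
      + (U (ZFace X Y Z) + U (ZFace X Y (Z + 1)))\<^sup>2) \<le>
     energy cube_geometry A {(X, Y, Z)} (cube_ext l U) (cube_ext l U)"
proof -
  define x where "x = U (XFace (X + 1) Y Z) - U (XFace X Y Z)"
  define y where "y = U (YFace X (Y + 1) Z) - U (YFace X Y Z)"
  define z where "z = U (ZFace X Y (Z + 1)) - U (ZFace X Y Z)"
  have "energy cube_geometry A {(X, Y, Z)} (cube_ext l U) (cube_ext l U) =
      a * c / (2 * S) * ((U (XFace X Y Z) + U (XFace (X + 1) Y Z))\<^sup>2 + (U (YFace X Y Z) + U (YFace X (Y + 1) Z))\<^sup>2
        + (U (ZFace X Y Z) + U (ZFace X Y (Z + 1)))\<^sup>2)
      + (S - s) / 8 * (x\<^sup>2 + y\<^sup>2 + z\<^sup>2) + s / 8 * (x + y + z)\<^sup>2"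
    unfolding cube_ext_energy by (simp add: cube_form_def x_def y_def z_def power2_eq_square diff_divide_distrib)
  moreover have "0 \<le> (S - s) / 8 * (x\<^sup>2 + y\<^sup>2 + z\<^sup>2)" "0 \<le> s / 8 * (x + y + z)\<^sup>2"
    using acs by (simp_all add: S_def)
  ultimately show ?thesis by linarith
qed

text \<open>For each direction, three Walsh coefficients form a sector governed by
  \<open>sector_bound\<close>. Under vanishing aggregates the face sums have, up to sign, the same
  three coefficients as the face differences, so Bessel's inequality bounds both parts of the energy
  from below. The factor 8 from Parseval turns 2 into 16 in the denominator.\<close>

lemma cube_energy_ge:
  assumes w: "zero_aggregates G w"
  shows "(S - s) * (S + 2 * s) / (16 * S) *
      ((sector_amplitude w G 0)\<^sup>2 + (sector_amplitude w G 1)\<^sup>2 + (sector_amplitude w G 2)\<^sup>2) \<le>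
    energy cube_geometry A {G} w w"
proof -
  let ?n = "\<lambda>f :: octants. \<Sum>i\<in>UNIV. \<Sum>j\<in>UNIV. \<Sum>k\<in>UNIV. (f i j k)\<^sup>2"
  let ?x = "walsh (xdiff w G)" and ?y = "walsh (ydiff w G)" and ?z = "walsh (zdiff w G)"
  let ?t = "\<lambda>i j k. xdiff w G i j k + ydiff w G i j k + zdiff w G i j k"
  have E: "energy cube_geometry A {G} w w =
      a * (?n (xsum w G) + ?n (ysum w G) + ?n (zsum w G)) +
      (c - s) * (?n (xdiff w G) + ?n (ydiff w G) + ?n (zdiff w G)) + s * ?n ?t"
    unfolding cube_energy[OF A] by (simp add: sum.distrib sum_distrib_left distrib_left power2_eq_square)
  have sums: "(?x True False False)\<^sup>2 + (?x False True False)\<^sup>2 + (?x False False True)\<^sup>2 \<le> 8 * ?n (xsum w G)"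
    "(?y True False False)\<^sup>2 + (?y False True False)\<^sup>2 + (?y False False True)\<^sup>2 \<le> 8 * ?n (ysum w G)"
    "(?z True False False)\<^sup>2 + (?z False True False)\<^sup>2 + (?z False False True)\<^sup>2 \<le> 8 * ?n (zsum w G)"
    using walsh_bessel3[of False False False True True False True False True "xsum w G"]
      walsh_bessel3[of True True False False False False False True True "ysum w G"]
      walsh_bessel3[of True False True False True True False False False "zsum w G"]
    by (simp_all add: walsh_zero_aggregates[OF w] walsh_sum_diff)
  have diffs: "(walsh f True False False)\<^sup>2 + (walsh f False True False)\<^sup>2 + (walsh f False False True)\<^sup>2 \<le> 8 * ?n f" for f
    by (rule walsh_bessel3) simp_all
  define \<kappa> where "\<kappa> = (S - s) * (S + 2 * s) / (2 * S)"
  have sector: "\<kappa> * (q + r)\<^sup>2 \<le> a * (p\<^sup>2 + q\<^sup>2 + r\<^sup>2) + (c - s) * (p\<^sup>2 + q\<^sup>2 + r\<^sup>2) + s * (p + q + r)\<^sup>2" for p q r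
    unfolding \<kappa>_def S_def by (rule sector_bound[OF acs])
  have "\<kappa> * ((sector_amplitude w G 0)\<^sup>2 + (sector_amplitude w G 1)\<^sup>2 + (sector_amplitude w G 2)\<^sup>2) \<le>
      a * ((?x True False False)\<^sup>2 + (?x False True False)\<^sup>2 + (?x False False True)\<^sup>2
        + ((?y True False False)\<^sup>2 + (?y False True False)\<^sup>2 + (?y False False True)\<^sup>2)
        + ((?z True False False)\<^sup>2 + (?z False True False)\<^sup>2 + (?z False False True)\<^sup>2)) +
      (c - s) * ((?x True False False)\<^sup>2 + (?x False True False)\<^sup>2 + (?x False False True)\<^sup>2
        + ((?y True False False)\<^sup>2 + (?y False True False)\<^sup>2 + (?y False False True)\<^sup>2)
        + ((?z True False False)\<^sup>2 + (?z False True False)\<^sup>2 + (?z False False True)\<^sup>2)) +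
      s * ((walsh ?t True False False)\<^sup>2 + (walsh ?t False True False)\<^sup>2 + (walsh ?t False False True)\<^sup>2)"
    using sector[of "?y True False False" "?z True False False" "?x True False False"]
      sector[of "?x False True False" "?z False True False" "?y False True False"]
      sector[of "?x False False True" "?y False False True" "?z False False True"]
    unfolding walsh_add sector_amplitude_def by (simp add: algebra_simps)
  also have "\<dots> \<le> a * (8 * ?n (xsum w G) + 8 * ?n (ysum w G) + 8 * ?n (zsum w G)) +
      (c - s) * (8 * ?n (xdiff w G) + 8 * ?n (ydiff w G) + 8 * ?n (zdiff w G)) + s * (8 * ?n ?t)"
    using acs by (intro add_mono mult_left_mono sums diffs) auto
  also have "\<dots> = 8 * energy cube_geometry A {G} w w"
    unfolding E by (simp add: algebra_simps)
  finally show ?thesis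
    by (simp add: \<kappa>_def field_simps)
qed

end

context
  fixes A :: "(nat, nat) matrix" and a c s S l :: real
  assumes A: "bilin {..<6} {..<6} A = cube_form a c s" and acs: "0 < a" "0 < s" "s < c"
  defines "S \<equiv> a + c" and "l \<equiv> (c - a) / (8 * S)"
begin

private lemmas S_l = cube_S_l[OF A acs, folded S_def, folded l_def]
private lemmas ext_harmonic = cube_ext_harmonic[OF A acs, folded S_def, folded l_def]
private lemmas ext_energy = cube_ext_energy[OF A acs, folded S_def, folded l_def]
private lemmas ext_energy_ge = cube_ext_energy_ge[OF A acs, folded S_def, folded l_def]
private lemmas energy_ge = cube_energy_ge[OF A acs, folded S_def]
private lemmas cross_energy = cube_cross_energy[OF A acs, folded S_def, folded l_def]

lemma cube_cbs_pos: "0 < (S - s) * (S + 2 * s)" "0 \<le> 2 * a * s\<^sup>2 / (c * ((S - s) * (S + 2 * s)))"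
proof -
  show "0 < (S - s) * (S + 2 * s)" using acs by (intro mult_pos_pos) (simp_all add: S_def)
  then show "0 \<le> 2 * a * s\<^sup>2 / (c * ((S - s) * (S + 2 * s)))"
    using acs by (intro divide_nonneg_pos mult_pos_pos[of c]) simp_all
qed

lemma cube_bound:
  assumes w: "zero_aggregates G w"
  shows "(energy cube_geometry A {G} w (cube_ext l U))\<^sup>2 \<le>
    2 * a * s\<^sup>2 / (c * ((S - s) * (S + 2 * s))) * energy cube_geometry A {G} w w *
      energy cube_geometry A {G} (cube_ext l U) (cube_ext l U)"
proof -
  obtain X Y Z where G: "G = (X, Y, Z)" by (metis prod.exhaust)
  define p q r where "p = sector_amplitude w (X, Y, Z) 0" "q = sector_amplitude w (X, Y, Z) 1"
    "r = sector_amplitude w (X, Y, Z) 2"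
  define x y z where "x = U (XFace X Y Z) + U (XFace (X + 1) Y Z)" "y = U (YFace X Y Z) + U (YFace X (Y + 1) Z)"
    "z = U (ZFace X Y Z) + U (ZFace X Y (Z + 1))"
  note defs = p_q_r_def[symmetric] x_y_z_def[symmetric]
  show ?thesis
    unfolding G cross_energy[OF w[unfolded G]] defs
  proof (rule local_cbs)
    \<comment> \<open>Lagrange's identity.\<close>
    have "(p\<^sup>2 + q\<^sup>2 + r\<^sup>2) * (x\<^sup>2 + y\<^sup>2 + z\<^sup>2) - (p * x + q * y + r * z)\<^sup>2 =
        (p * y - q * x)\<^sup>2 + (p * z - r * x)\<^sup>2 + (q * z - r * y)\<^sup>2"
      by (simp add: algebra_simps power2_eq_square)
    then show "(p * x + q * y + r * z)\<^sup>2 \<le> (p\<^sup>2 + q\<^sup>2 + r\<^sup>2) * (x\<^sup>2 + y\<^sup>2 + z\<^sup>2)"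
      using zero_le_power2[of "p * y - q * x"] zero_le_power2[of "p * z - r * x"] zero_le_power2[of "q * z - r * y"]
      by linarith
    show "(S - s) * (S + 2 * s) / (16 * S) * (p\<^sup>2 + q\<^sup>2 + r\<^sup>2) \<le> energy cube_geometry A {(X, Y, Z)} w w"
      unfolding p_q_r_def by (rule energy_ge[OF w[unfolded G]])
    show "a * c / (2 * S) * (x\<^sup>2 + y\<^sup>2 + z\<^sup>2) \<le> energy cube_geometry A {(X, Y, Z)} (cube_ext l U) (cube_ext l U)"
      unfolding x_y_z_def by (rule ext_energy_ge)
    have "(- (a * s / (4 * S)))\<^sup>2 = 2 * a * s\<^sup>2 / (c * D) * (D / (16 * S) * (a * c / (2 * S)))" if "0 < D" for D
      using that acs S_l(1) by (simp add: power2_eq_square)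
    from this[OF cube_cbs_pos(1)]
    show "(- (a * s / (4 * S)))\<^sup>2 = 2 * a * s\<^sup>2 / (c * ((S - s) * (S + 2 * s))) *
        ((S - s) * (S + 2 * s) / (16 * S) * (a * c / (2 * S)))" .
    show "0 < (S - s) * (S + 2 * s) / (16 * S)" "0 < a * c / (2 * S)"
      using cube_cbs_pos(1) acs S_l(1) by simp_all
    show "0 \<le> 2 * a * s\<^sup>2 / (c * ((S - s) * (S + 2 * s)))" by (rule cube_cbs_pos(2))
  qed simp_all
qed

text \<open>Tested with a vector on interior faces, only the coefficient of its x-differences
  survives, with factor \<open>S * r - 2 * s\<close>; this is the origin of
  \<open>r = 2 * s / S\<close>.\<close>

lemma cube_extremal_harmonic:
  assumes v: "\<And>f. f \<in> part_facets cube_geometry {G} \<Longrightarrow> v f = 0"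
  shows "energy cube_geometry A {G} v (cube_extremal (2 * s / S)) = 0"
proof -
  obtain X Y Z where G: "G = (X, Y, Z)" by (metis prod.exhaust)
  define e where "e = alt Y * alt Z"
  define r where "r = 2 * s / S"
  have "energy cube_geometry A {(X, Y, Z)} v (cube_extremal r) = e *
     (a * (r * walsh (xsum v (X, Y, Z)) False False False + walsh (ysum v (X, Y, Z)) True True False
        + walsh (zsum v (X, Y, Z)) True False True)
      + (c - s) * (r * walsh (xdiff v (X, Y, Z)) True False False - walsh (ydiff v (X, Y, Z)) True False False
        - walsh (zdiff v (X, Y, Z)) True False False)
      + s * (r - 2) * (walsh (xdiff v (X, Y, Z)) True False False + walsh (ydiff v (X, Y, Z)) True False False
        + walsh (zdiff v (X, Y, Z)) True False False))"
    unfolding cube_energy[OF A] cube_extremal_octants e_def[symmetric] walsh_def UNIV_bool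
    by (simp add: sgn_bool_def) (simp add: algebra_simps)
  also have "\<dots> = e * walsh (xdiff v (X, Y, Z)) True False False * (S * r - 2 * s)"
    using inner_walsh[of "(X, Y, Z)" v] walsh_zero_aggregates(1)[OF inner_zero_aggregates, of "(X, Y, Z)" v] v
    unfolding G walsh_sum_diff by (simp add: S_def) (simp add: algebra_simps)
  also have "S * r - 2 * s = 0" using S_l(1) by (simp add: r_def)
  finally show ?thesis unfolding G r_def by simp
qed

lemma cube_splitting_constant:
  assumes C: "finite C" "C \<noteq> {}"
  shows "splitting_constant cube_geometry A C = sqrt (2 * a * s\<^sup>2 / (c * ((S - s) * (S + 2 * s))))"
proof (rule cube.splitting_constant_eqI[OF C])
  let ?g = "sqrt (2 * a * s\<^sup>2 / (c * ((S - s) * (S + 2 * s))))" and ?w = "cube_extremal (2 * s / S)"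
  \<comment> \<open>The energy bounds with equality: the first sector amplitude has absolute value
    16, the sum of the two x-aggregates 2, and the other directions vanish.\<close>
  let ?e1 = "16 * ((S - s) * (S + 2 * s)) / S" and ?e2 = "2 * a * c / S"
  show "spd_on {..<ndof cube_geometry} A"
    using cube_form_spd[OF A acs] by (simp add: cube_geometry_def)
  show g: "0 \<le> ?g" using cube_cbs_pos by simp
  show "cube_ext l U (parts cube_geometry F ! i) = U F / real 4" if "i < 4" for U F i
    using that by (rule cube_ext_parts)
  show "energy cube_geometry A {G} v (cube_ext l U) = 0"
    if "\<And>f. f \<in> part_facets cube_geometry {G} \<Longrightarrow> v f = 0" for G U v
    using that by (rule ext_harmonic)
  show "(energy cube_geometry A {G} w (cube_ext l U))\<^sup>2 \<le>
      ?g\<^sup>2 * energy cube_geometry A {G} w w * energy cube_geometry A {G} (cube_ext l U) (cube_ext l U)"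
    if "\<And>F. F \<in> facets cube_geometry {G} \<Longrightarrow> (\<Sum>i<4. w (parts cube_geometry F ! i)) = 0" for G U w
  proof -
    have "zero_aggregates G w" using that by (simp add: zero_aggregates_def)
    from cube_bound[OF this, of U] show ?thesis using cube_cbs_pos(2) by simp
  qed
  show "?w (parts cube_geometry F ! i) = (\<Sum>m<length (diff_signs cube_geometry).
      diff_signs cube_geometry ! m ! i / real 4 * (if m = 0 then 4 * ?w (parts cube_geometry F ! 0) else 0))"
    if "i < 4" for F i
    using that by (rule cube_extremal_parts)
  show "energy cube_geometry A {G} v ?w = 0"
    if "\<And>f. f \<in> part_facets cube_geometry {G} \<Longrightarrow> v f = 0" for G v
    using that by (rule cube_extremal_harmonic)
  show "0 < ?e1" "0 < ?e2"
    using acs S_l(1) cube_cbs_pos by simp_all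
  fix G :: "int \<times> int \<times> int"
  obtain X Y Z where G: "G = (X, Y, Z)" by (metis prod.exhaust)
  define e where "e = alt Y * alt Z"
  have e: "e * e = 1" "e * (e * x) = x" for x by (auto simp: e_def alt_def)
  show "energy cube_geometry A {G} ?w ?w = ?e1"
  proof -
    define r where "r = 2 * s / S"
    have "energy cube_geometry A {(X, Y, Z)} (cube_extremal r) (cube_extremal r) =
        8 * (S * (r\<^sup>2 + 2) - 4 * s * r + 2 * s) * (e * e)"
      unfolding cube_energy[OF A] cube_extremal_octants e_def[symmetric] S_def
      by (simp add: UNIV_bool sgn_bool_def) (simp add: algebra_simps power2_eq_square)
    also have "S * (r\<^sup>2 + 2) - 4 * s * r + 2 * s = 2 * ((S - s) * (S + 2 * s)) / S"
      using S_l(1) by (simp add: r_def field_simps power2_eq_square)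
    finally show ?thesis unfolding G r_def e by simp
  qed
  show "energy cube_geometry A {G} (cube_ext l cube_aggregate) (cube_ext l cube_aggregate) = ?e2"
    unfolding ext_energy G by (simp add: cube_form_def e_def[symmetric] e)
  have cross: "energy cube_geometry A {G} ?w (cube_ext l cube_aggregate) = 8 * a * s / S"
    unfolding G cross_energy[OF cube_extremal_zero_aggregates] sector_amplitude_def cube_extremal_octants walsh_def
    by (simp add: UNIV_bool sgn_bool_def e_def[symmetric] e)
  have "2 * a * s\<^sup>2 / (c * D) * (16 * D / S * ?e2) = (8 * a * s / S)\<^sup>2" if "0 < D" for D
    using that acs by (simp add: power2_eq_square)
  from this[OF cube_cbs_pos(1)] have "?g * (sqrt ?e1 * sqrt ?e2) = sqrt ((8 * a * s / S)\<^sup>2)"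
    by (simp only: real_sqrt_mult[symmetric])
  also have "\<dots> = 8 * a * s / S" using acs S_l(1) by simp
  finally show "energy cube_geometry A {G} ?w (cube_ext l cube_aggregate) = ?g * (sqrt ?e1 * sqrt ?e2)"
    using cross by simp
qed

lemma cube_coarse:
  "bilin {..<6} {..<6} (coarse_element_matrix cube_geometry A) = cube_form (a * c / (2 * S)) (S / 8) (s / 8)"
proof (intro ext)
  fix u v :: "nat \<Rightarrow> real"
  define U where "U = (\<lambda>u :: nat \<Rightarrow> real. u \<circ> the_inv_into {..<6} (cube_dof 0))"
  have U: "(U u \<circ> cube_dof 0) i = u i" if "i < 6" for u i
    using cube.dof_inj[of 0] that by (simp add: U_def cube_geometry_def the_inv_into_f_f)
  have "bilin {..<6} {..<6} (coarse_element_matrix cube_geometry A) u v =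
      bilin {..<6} {..<6} (coarse_element_matrix cube_geometry A) (U u \<circ> cube_dof 0) (U v \<circ> cube_dof 0)"
    using U by (intro bilin_cong) auto
  also have "\<dots> = energy cube_geometry A {0} (cube_ext l (U u)) (cube_ext l (U v))"
    using cube.coarse_element_matrix_form[of A "cube_ext l" "U u" "U v"]
      cube_form_spd[OF A acs] cube_ext_parts ext_harmonic
    by (simp add: cube_geometry_def)
  also have "\<dots> = cube_form (a * c / (2 * S)) (S / 8) (s / 8) (U u \<circ> cube_dof 0) (U v \<circ> cube_dof 0)"
    by (rule ext_energy)
  also have "\<dots> = cube_form (a * c / (2 * S)) (S / 8) (s / 8) u v"
    using U unfolding cube_form_def by simp
  finally show "bilin {..<6} {..<6} (coarse_element_matrix cube_geometry A) u v =
      cube_form (a * c / (2 * S)) (S / 8) (s / 8) u v" .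
qed

end

section \<open>All levels\<close>

text \<open>The common factor of the form is left existential, because CBS constants are invariant
  under scaling of the matrix.\<close>

lemma square_levels:
  assumes A: "bilin {..<4} {..<4} A = square_form (t * a) (t * c) t" and t: "0 < t" and adm: "admissible (a, c)"
  shows "\<exists>t'>0. bilin {..<4} {..<4} ((coarse_element_matrix square_geometry ^^ n) A) =
    square_form (t' * fst ((coarsen ^^ n) (a, c))) (t' * snd ((coarsen ^^ n) (a, c))) t'"
proof (induction n)
  case 0
  then show ?case using A t by auto
next
  case (Suc n)
  obtain a' c' where p: "(coarsen ^^ n) (a, c) = (a', c')" by fastforce
  have ac: "0 < a'" "1 < c'" using admissible_coarsen_pow[OF adm, of n] by (simp_all add: p admissible_def)
  from Suc obtain t' where t': "0 < t'"
    "bilin {..<4} {..<4} ((coarse_element_matrix square_geometry ^^ n) A) = square_form (t' * a') (t' * c') t'"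
    by (auto simp: p)
  have "bilin {..<4} {..<4} ((coarse_element_matrix square_geometry ^^ Suc n) A) =
      square_form (t' * a' * (t' * c') / (t' * a' + t' * c')) ((t' * a' + t' * c') / 4) (t' / 4)"
    using square_coarse[OF t'(2)] t'(1) ac by simp
  also have "t' * a' * (t' * c') / (t' * a' + t' * c') = t' / 4 * (4 * a' * c' / (a' + c'))"
    using t'(1) by (simp flip: distrib_left)
  finally have "bilin {..<4} {..<4} ((coarse_element_matrix square_geometry ^^ Suc n) A) =
      square_form (t' / 4 * (4 * a' * c' / (a' + c'))) (t' / 4 * (a' + c')) (t' / 4)"
    by (simp add: distrib_left add_divide_distrib)
  moreover have "(coarsen ^^ Suc n) (a, c) = (4 * a' * c' / (a' + c'), a' + c')"
    by (simp add: p) (simp add: coarsen_def)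
  ultimately show ?case
    using t'(1) by (intro exI[of _ "t' / 4"]) simp
qed

lemma square_level_constant:
  assumes "0 < \<alpha>" "0 < \<beta>" "0 < h" "finite C" "C \<noteq> {}"
  shows "splitting_constant square_geometry (level_element_matrix square_geometry (nedelec_element_matrix \<alpha> \<beta> h) L k) C =
    sqrt (case_prod cbs_square ((coarsen ^^ (L - k)) (\<alpha> / \<beta> * h\<^sup>2 / 4, 1 + \<alpha> / \<beta> * h\<^sup>2 / 12)))"
proof -
  define e where "e = \<alpha> / \<beta> * h\<^sup>2"
  define t where "t = \<beta> / h\<^sup>2"
  have e: "0 < e" and t: "0 < t" using assms by (simp_all add: e_def t_def)
  let ?A = "nedelec_element_matrix \<alpha> \<beta> h"
  have "bilin {..<4} {..<4} ?A = square_form (t * (e / 4)) (t * (1 + e / 12)) t"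
  proof (intro HOL.ext)
    fix u v :: "nat \<Rightarrow> real"
    note entry = nedelec_element_matrix_explicit[OF assms(1-3), folded e_def]
    have lt: "{..<4} = {0, 1, 2, 3 :: nat}" by auto
    have k: "\<beta> / (6 * h\<^sup>2) = t / 6" by (simp add: t_def)
    have "bilin {..<4} {..<4} ?A u v = t / 6 * (bilin {..<4} {..<4} (\<lambda>a b.
     [[2 * e + 6, e - 6, - 6, 6],
      [e - 6, 2 * e + 6, 6, - 6],
      [- 6, 6, 2 * e + 6, e - 6],
      [6, - 6, e - 6, 2 * e + 6]] ! a ! b) u v)"
      unfolding bilin_def sum_distrib_left
      by (intro sum.cong refl) (use entry in \<open>simp add: k\<close>)
    also have "\<dots> = square_form (t * (e / 4)) (t * (1 + e / 12)) t u v"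
      unfolding bilin_def lt square_form_def by (simp) (simp add: field_simps)
    finally show "bilin {..<4} {..<4} ?A u v = square_form (t * (e / 4)) (t * (1 + e / 12)) t u v" .
  qed
  from square_levels[OF this t admissible_initial[OF e], of "L - k"]
  obtain t' a c where "0 < t'" and ac: "(coarsen ^^ (L - k)) (e / 4, 1 + e / 12) = (a, c)"
    and form: "bilin {..<4} {..<4} (level_element_matrix square_geometry ?A L k) = square_form (t' * a) (t' * c) t'"
    by (metis prod.collapse level_element_matrix_def)
  have pos: "0 < a" "1 < c" using admissible_coarsen_pow[OF admissible_initial[OF e], of "L - k"]
    by (simp_all add: ac admissible_def)
  have "t' * a * t'\<^sup>2 / (t' * c * ((t' * a + t' * c)\<^sup>2 - t'\<^sup>2)) = cbs_square a c"
  proof -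
    have "t' * c * ((t' * a + t' * c)\<^sup>2 - t'\<^sup>2) = t' ^ 3 * (c * ((a + c)\<^sup>2 - 1))"
      by (simp add: algebra_simps power2_eq_square power3_eq_cube)
    moreover have "t' * a * t'\<^sup>2 = t' ^ 3 * a" by (simp add: power2_eq_square power3_eq_cube)
    ultimately show ?thesis
      using \<open>0 < t'\<close> by (simp only: cbs_square_def) simp
  qed
  then show ?thesis
    using square_splitting_constant[OF form _ \<open>0 < t'\<close> _ assms(4,5)] pos \<open>0 < t'\<close>
    unfolding e_def[symmetric] ac by simp
qed

lemma cube_levels:
  assumes A: "bilin {..<6} {..<6} A = cube_form (t * a) (t * c) t" and t: "0 < t" and adm: "admissible (a, c)"
  shows "\<exists>t'>0. bilin {..<6} {..<6} ((coarse_element_matrix cube_geometry ^^ n) A) =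
    cube_form (t' * fst ((coarsen ^^ n) (a, c))) (t' * snd ((coarsen ^^ n) (a, c))) t'"
proof (induction n)
  case 0
  then show ?case using A t by auto
next
  case (Suc n)
  obtain a' c' where p: "(coarsen ^^ n) (a, c) = (a', c')" by fastforce
  have ac: "0 < a'" "1 < c'" using admissible_coarsen_pow[OF adm, of n] by (simp_all add: p admissible_def)
  from Suc obtain t' where t': "0 < t'"
    "bilin {..<6} {..<6} ((coarse_element_matrix cube_geometry ^^ n) A) = cube_form (t' * a') (t' * c') t'"
    by (auto simp: p)
  have "bilin {..<6} {..<6} ((coarse_element_matrix cube_geometry ^^ Suc n) A) =
      cube_form (t' * a' * (t' * c') / (2 * (t' * a' + t' * c'))) ((t' * a' + t' * c') / 8) (t' / 8)"
    using cube_coarse[OF t'(2)] t'(1) ac by simp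
  also have "t' * a' * (t' * c') / (2 * (t' * a' + t' * c')) = t' / 8 * (4 * a' * c' / (a' + c'))"
    unfolding distrib_left[symmetric, of t' a' c'] using t'(1) by simp
  finally have "bilin {..<6} {..<6} ((coarse_element_matrix cube_geometry ^^ Suc n) A) =
      cube_form (t' / 8 * (4 * a' * c' / (a' + c'))) (t' / 8 * (a' + c')) (t' / 8)"
    by (simp add: distrib_left add_divide_distrib)
  moreover have "(coarsen ^^ Suc n) (a, c) = (4 * a' * c' / (a' + c'), a' + c')"
    by (simp add: p) (simp add: coarsen_def)
  ultimately show ?case
    using t'(1) by (intro exI[of _ "t' / 8"]) simp
qed

lemma cube_level_constant:
  assumes "0 < \<alpha>" "0 < \<beta>" "0 < h" "finite C" "C \<noteq> {}"
  shows "splitting_constant cube_geometry (level_element_matrix cube_geometry (rt_element_matrix \<alpha> \<beta> h) L k) C =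
    sqrt (case_prod cbs_cube ((coarsen ^^ (L - k)) (\<alpha> / \<beta> * h\<^sup>2 / 4, 1 + \<alpha> / \<beta> * h\<^sup>2 / 12)))"
proof -
  define e where "e = \<alpha> / \<beta> * h\<^sup>2"
  define t where "t = \<beta> / h ^ 3"
  have e: "0 < e" and t: "0 < t" using assms by (simp_all add: e_def t_def)
  let ?A = "rt_element_matrix \<alpha> \<beta> h"
  have "bilin {..<6} {..<6} ?A = cube_form (t * (e / 4)) (t * (1 + e / 12)) t"
  proof (intro HOL.ext)
    fix u v :: "nat \<Rightarrow> real"
    note entry = rt_element_matrix_explicit[OF assms(1-3), folded e_def]
    have lt: "{..<6} = {0, 1, 2, 3, 4, 5 :: nat}" by auto
    have k: "\<beta> / (6 * h ^ 3) = t / 6" by (simp add: t_def)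
    have "bilin {..<6} {..<6} ?A u v = t / 6 * (bilin {..<6} {..<6} (\<lambda>a b.
     [[2 * e + 6, e - 6, 6, - 6, 6, - 6],
      [e - 6, 2 * e + 6, - 6, 6, - 6, 6],
      [6, - 6, 2 * e + 6, e - 6, 6, - 6],
      [- 6, 6, e - 6, 2 * e + 6, - 6, 6],
      [6, - 6, 6, - 6, 2 * e + 6, e - 6],
      [- 6, 6, - 6, 6, e - 6, 2 * e + 6]] ! a ! b) u v)"
      unfolding bilin_def sum_distrib_left
      by (intro sum.cong refl) (use entry in \<open>simp add: k\<close>)
    also have "\<dots> = cube_form (t * (e / 4)) (t * (1 + e / 12)) t u v"
    proof -
      \<comment> \<open>Clears all denominators, so that a polynomial identity remains.\<close>
      define m f where "m = t / 6" and "f = e / 12"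
      then have "t = 6 * m" "e = 12 * f" by simp_all
      then show ?thesis
        unfolding bilin_def lt cube_form_def by simp (simp add: algebra_simps)
    qed
    finally show "bilin {..<6} {..<6} ?A u v = cube_form (t * (e / 4)) (t * (1 + e / 12)) t u v" .
  qed
  from cube_levels[OF this t admissible_initial[OF e], of "L - k"]
  obtain t' a c where "0 < t'" and ac: "(coarsen ^^ (L - k)) (e / 4, 1 + e / 12) = (a, c)"
    and form: "bilin {..<6} {..<6} (level_element_matrix cube_geometry ?A L k) = cube_form (t' * a) (t' * c) t'"
    by (metis prod.collapse level_element_matrix_def)
  have pos: "0 < a" "1 < c" using admissible_coarsen_pow[OF admissible_initial[OF e], of "L - k"]
    by (simp_all add: ac admissible_def)
  have "splitting_constant cube_geometry (level_element_matrix cube_geometry ?A L k) C =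
      sqrt (2 * (t' * a) * t'\<^sup>2 / (t' * c * ((t' * a + t' * c - t') * (t' * a + t' * c + 2 * t'))))"
    by (rule cube_splitting_constant[OF form _ \<open>0 < t'\<close> _ assms(4,5)]) (use pos \<open>0 < t'\<close> in simp_all)
  also have "2 * (t' * a) * t'\<^sup>2 = t' ^ 3 * (2 * a)"
    by (simp add: power2_eq_square power3_eq_cube)
  also have "t' * c * ((t' * a + t' * c - t') * (t' * a + t' * c + 2 * t')) = t' ^ 3 * (c * (a + c - 1) * (a + c + 2))"
    by (simp add: algebra_simps power3_eq_cube)
  also have "t' ^ 3 * (2 * a) / (t' ^ 3 * (c * (a + c - 1) * (a + c + 2))) = cbs_cube a c"
    unfolding cbs_cube_def using \<open>0 < t'\<close> by (intro mult_divide_mult_cancel_left) simp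
  finally show ?thesis unfolding e_def[symmetric] ac by simp
qed

lemma cbs_sequence:
  assumes "0 < e"
  defines "p \<equiv> \<lambda>n. (coarsen ^^ n) (e / 4, 1 + e / 12)"
  shows "case_prod cbs_square (p (Suc n)) < case_prod cbs_square (p n)"
    "case_prod cbs_cube (p (Suc n)) < case_prod cbs_cube (p n)"
    "case_prod cbs_square (p n) < 3 / 8" "case_prod cbs_cube (p n) < 1 / 2"
proof -
  show step: "case_prod cbs_square (p (Suc n)) < case_prod cbs_square (p n)"
    "case_prod cbs_cube (p (Suc n)) < case_prod cbs_cube (p n)" for n
  proof -
    obtain a c where ac: "p n = (a, c)" by fastforce
    then have "admissible (a, c)"
      using admissible_coarsen_pow[OF admissible_initial[OF assms(1)], of n] by (simp add: p_def)
    moreover have "p (Suc n) = (4 * a * c / (a + c), a + c)"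
      using ac by (simp add: p_def) (simp add: coarsen_def)
    ultimately show "case_prod cbs_square (p (Suc n)) < case_prod cbs_square (p n)"
      "case_prod cbs_cube (p (Suc n)) < case_prod cbs_cube (p n)"
      using cbs_decreasing ac by simp_all
  qed
  show "case_prod cbs_square (p n) < 3 / 8"
  proof (induction n)
    case 0
    then show ?case using cbs_initial(1)[OF assms(1)] by (simp add: p_def)
  next
    case (Suc n)
    then show ?case using step(1)[of n] by linarith
  qed
  show "case_prod cbs_cube (p n) < 1 / 2"
  proof (induction n)
    case 0
    then show ?case using cbs_initial(2)[OF assms(1)] by (simp add: p_def)
  next
    case (Suc n)
    then show ?case using step(2)[of n] by linarith
  qed
qed

theorem theorem3p5:
  fixes \<alpha> \<beta> h :: real and L :: nat
    and C2 :: "(int \<times> int) set" and C3 :: "(int \<times> int \<times> int) set"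
  assumes "0 < \<alpha>" and "0 < \<beta>" and "0 < h"
    and "finite C2" and "C2 \<noteq> {}" and "finite C3" and "C3 \<noteq> {}"
  defines "A2 \<equiv> nedelec_element_matrix \<alpha> \<beta> h"
    and "A3 \<equiv> rt_element_matrix \<alpha> \<beta> h"
  shows
    "(\<forall>k\<le>L. \<forall>G\<in>level_macros square_geometry C2 k.
        gamma_level square_geometry A2 L C2 k \<le> gamma_macro square_geometry A2 L k G \<and>
        gamma_macro square_geometry A2 L k G < sqrt (3 / 8)) \<and>
     (\<forall>k<L. gamma_level square_geometry A2 L C2 k < gamma_level square_geometry A2 L C2 (Suc k)) \<and>
     (\<forall>k\<le>L. gamma_level square_geometry A2 L C2 k < sqrt (3 / 8)) \<and>
     (\<forall>k\<le>L. \<forall>G\<in>level_macros cube_geometry C3 k.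
        gamma_level cube_geometry A3 L C3 k \<le> gamma_macro cube_geometry A3 L k G \<and>
        gamma_macro cube_geometry A3 L k G < sqrt (1 / 2)) \<and>
     (\<forall>k<L. gamma_level cube_geometry A3 L C3 k < gamma_level cube_geometry A3 L C3 (Suc k)) \<and>
     (\<forall>k\<le>L. gamma_level cube_geometry A3 L C3 k < sqrt (1 / 2))"
proof -
  define p where "p n = (coarsen ^^ n) (\<alpha> / \<beta> * h\<^sup>2 / 4, 1 + \<alpha> / \<beta> * h\<^sup>2 / 12)" for n
  have e: "0 < \<alpha> / \<beta> * h\<^sup>2" using assms(1-3) by simp
  note bounds = cbs_sequence[OF e, folded p_def]
  have square: "splitting_constant square_geometry (level_element_matrix square_geometry A2 L k) C =
      sqrt (case_prod cbs_square (p (L - k)))" if "finite C" "C \<noteq> {}" for C k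
    unfolding A2_def p_def by (rule square_level_constant[OF assms(1-3) that])
  have cube: "splitting_constant cube_geometry (level_element_matrix cube_geometry A3 L k) C =
      sqrt (case_prod cbs_cube (p (L - k)))" if "finite C" "C \<noteq> {}" for C k
    unfolding A3_def p_def by (rule cube_level_constant[OF assms(1-3) that])
  have levels2: "finite (level_macros square_geometry C2 k)" "level_macros square_geometry C2 k \<noteq> {}" for k
    using assms(4,5) by (simp_all add: square.finite_level_macros square.level_macros_nonempty)
  have levels3: "finite (level_macros cube_geometry C3 k)" "level_macros cube_geometry C3 k \<noteq> {}" for k
    using assms(6,7) by (simp_all add: cube.finite_level_macros cube.level_macros_nonempty)
  have gamma: "gamma_level square_geometry A2 L C2 k = sqrt (case_prod cbs_square (p (L - k)))"
    "gamma_macro square_geometry A2 L k G = sqrt (case_prod cbs_square (p (L - k)))"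
    "gamma_level cube_geometry A3 L C3 k = sqrt (case_prod cbs_cube (p (L - k)))"
    "gamma_macro cube_geometry A3 L k G' = sqrt (case_prod cbs_cube (p (L - k)))" for k G G'
    unfolding gamma_level_def gamma_macro_def
    by (simp_all add: square cube levels2 levels3)
  \<comment> \<open>Level \<open>k\<close> is reached after \<open>L - k\<close> coarsening steps,
    one more than level \<open>Suc k\<close>.\<close>
  have "L - k = Suc (L - Suc k)" if "k < L" for k using that by simp
  then show ?thesis
    unfolding gamma real_sqrt_less_iff using bounds by simp
qed

end
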